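(* Assume the Unique Games Conjecture and P $\neq$ NP. Let $A$ be a polynomial-time learning-augmented approximation algorithm for Maximum Independent Set which, for every input graph and every prediction $\widehat{X}\subseteq V$, outputs an independent set of size at least $\big(1-f\big(\tfrac{\eta^+}{\mathrm{OPT}},\tfrac{\eta^-}{\mathrm{OPT}}\big)\big)\cdot\mathrm{OPT}$, where $\mathrm{OPT}$ is the maximum independent set size, $(\eta^+,\eta^-)=(|\widehat{X}\setminus X^*|,|X^*\setminus\widehat{X}|)$ for any maximum independent set $X^*$, and $f:\mathbb{R}_{\geqslant0}^2\to\mathbb{R}$ is non-decreasing (in each coordinate). Then $f(x,y)\geqslant x+y$ for all $x,y\geqslant0$ with $x+y\leqslant1$.
   Context: An independent set of an undirected graph $G=(V,E)$ is a set of vertices no two of which are adjacent; Maximum Independent Set asks for one of maximum cardinality. A learning-augmented algorithm receives, besides the graph, a predicted set $\widehat{X}\subseteq V$ (not necessarily independent). *)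

theory Defs
  imports Complex_Main "HOL-Computational_Algebra.Polynomial"
begin

section \<open>Multitape Turing machines and polynomial time\<close>

datatype direction = Lft | Stay | Rgt

text \<open>
  Deterministic multitape machines. The states are \<open>{..nstates}\<close>, with \<open>0\<close> initial and
  \<open>nstates\<close> the unique halting state; the tape symbols are \<open>{..<nsyms}\<close>, with \<open>0\<close> the blank and
  \<open>1\<close>, \<open>2\<close> the input bits. Only the values of \<open>delta\<close> at genuine states and symbols matter, so
  the transition table is a finite object.
\<close>

record tm =
  ntapes :: nat
  nsyms :: nat
  nstates :: nat
  delta :: "nat \<Rightarrow> nat list \<Rightarrow> nat \<times> (nat \<times> direction) list"

definition wf_tm :: "tm \<Rightarrow> bool" where
  "wf_tm M \<longleftrightarrow> ntapes M \<ge> 2 \<and> nsyms M \<ge> 3 \<and>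
     (\<forall>q < nstates M. \<forall>ss. length ss = ntapes M \<and> set ss \<subseteq> {..<nsyms M} \<longrightarrow>
        fst (delta M q ss) \<le> nstates M \<and>
        length (snd (delta M q ss)) = ntapes M \<and>
        fst ` set (snd (delta M q ss)) \<subseteq> {..<nsyms M})"

text \<open>A tape is two-way infinite: its contents together with the head position.\<close>

type_synonym tape = "(int \<Rightarrow> nat) \<times> int"
type_synonym config = "nat \<times> tape list"

fun shift :: "direction \<Rightarrow> int" where
  "shift Lft = -1"
| "shift Stay = 0"
| "shift Rgt = 1"

definition act :: "nat \<times> direction \<Rightarrow> tape \<Rightarrow> tape" where
  "act a t = ((fst t)(snd t := fst a), snd t + shift (snd a))"

definition tm_step :: "tm \<Rightarrow> config \<Rightarrow> config" where
  "tm_step M c =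
     (if fst c < nstates M
      then let r = delta M (fst c) (map (\<lambda>t. fst t (snd t)) (snd c))
           in (fst r, map2 act (snd r) (snd c))
      else c)"

definition contents :: "bool list \<Rightarrow> int \<Rightarrow> nat" where
  "contents w i = (if 0 \<le> i \<and> i < int (length w) then (if w ! nat i then 2 else 1) else 0)"

definition init_config :: "tm \<Rightarrow> bool list \<Rightarrow> config" where
  "init_config M w = (0, (contents w, 0) # replicate (ntapes M - 1) (contents [], 0))"

text \<open>The input is given on tape \<open>0\<close>, the output is read off tape \<open>1\<close>.\<close>

definition tm_outputs_within :: "tm \<Rightarrow> bool list \<Rightarrow> nat \<Rightarrow> bool list \<Rightarrow> bool" where
  "tm_outputs_within M w t v \<longleftrightarrow>
     (let c = (tm_step M ^^ t) (init_config M w)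
      in fst c = nstates M \<and> fst (snd c ! 1) = contents v)"

text \<open>
  \<open>polytime_on D enc out\<close>: some machine, started on the word \<open>enc a\<close> of an instance \<open>a \<in> D\<close>, halts
  with output \<open>out a\<close> within a number of steps polynomial in the length of \<open>enc a\<close>. Nothing is
  required on words that do not encode an instance.
\<close>

definition polytime_on :: "'a set \<Rightarrow> ('a \<Rightarrow> bool list) \<Rightarrow> ('a \<Rightarrow> bool list) \<Rightarrow> bool" where
  "polytime_on D enc out \<longleftrightarrow>
     (\<exists>M (p :: nat poly). wf_tm M \<and>
        (\<forall>a\<in>D. tm_outputs_within M (enc a) (poly p (length (enc a))) (out a)))"

abbreviation polytime_fun :: "(bool list \<Rightarrow> bool list) \<Rightarrow> bool" where
  "polytime_fun g \<equiv> polytime_on UNIV (\<lambda>w. w) g"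


section \<open>P and NP\<close>

definition enc_nat :: "nat \<Rightarrow> bool list" where
  "enc_nat n = replicate n True @ [False]"

definition enc_pair :: "bool list \<Rightarrow> bool list \<Rightarrow> bool list" where
  "enc_pair w u = enc_nat (length w) @ w @ u"

definition class_P :: "bool list set set" where
  "class_P = {L. polytime_fun (\<lambda>w. [w \<in> L])}"

definition class_NP :: "bool list set set" where
  "class_NP = {L. \<exists>V\<in>class_P. \<exists>p :: nat poly.
     \<forall>w. w \<in> L \<longleftrightarrow> (\<exists>u. length u \<le> poly p (length w) \<and> enc_pair w u \<in> V)}"

text \<open>
  A promise problem is given by its sets of yes- and no-instances; NP-hardness is with
  respect to polynomial-time many-one reductions.
\<close>

definition NP_hard_promise :: "bool list set \<Rightarrow> bool list set \<Rightarrow> bool" where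
  "NP_hard_promise Yes No \<longleftrightarrow>
     (\<forall>L\<in>class_NP. \<exists>g. polytime_fun g \<and>
        (\<forall>w. (w \<in> L \<longrightarrow> g w \<in> Yes) \<and> (w \<notin> L \<longrightarrow> g w \<in> No)))"


section \<open>The Unique Games Conjecture\<close>

text \<open>
  A unique game is a bipartite multigraph with sides \<open>{..<nleft}\<close> and \<open>{..<nright}\<close>, whose edges
  \<open>(u, v, \<pi>)\<close> carry a permutation \<open>\<pi>\<close> of the labels \<open>{..<nlabels}\<close>, listed as
  \<open>[\<pi> 0, \<dots>, \<pi> (nlabels - 1)]\<close>.
\<close>

record unique_game =
  nleft :: nat
  nright :: nat
  nlabels :: nat
  edges :: "(nat \<times> nat \<times> nat list) list"

definition wf_unique_game :: "unique_game \<Rightarrow> bool" where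
  "wf_unique_game I \<longleftrightarrow> nlabels I > 0 \<and> edges I \<noteq> [] \<and>
     (\<forall>(u, v, \<pi>) \<in> set (edges I). u < nleft I \<and> v < nright I \<and>
        distinct \<pi> \<and> set \<pi> = {..<nlabels I})"

definition satisfied_fraction :: "unique_game \<Rightarrow> (nat \<Rightarrow> nat) \<Rightarrow> (nat \<Rightarrow> nat) \<Rightarrow> real" where
  "satisfied_fraction I a b =
     real (length (filter (\<lambda>(u, v, \<pi>). \<pi> ! a u = b v) (edges I))) / real (length (edges I))"

definition game_value :: "unique_game \<Rightarrow> real" where
  "game_value I = Max {satisfied_fraction I a b | a b.
     (\<forall>u < nleft I. a u < nlabels I) \<and> (\<forall>v < nright I. b v < nlabels I)}"

definition enc_unique_game :: "unique_game \<Rightarrow> bool list" where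
  "enc_unique_game I =
     enc_nat (nleft I) @ enc_nat (nright I) @ enc_nat (nlabels I) @ enc_nat (length (edges I)) @
     concat (map (\<lambda>(u, v, \<pi>). enc_nat u @ enc_nat v @ concat (map enc_nat \<pi>)) (edges I))"

definition unique_games_conjecture :: bool where
  "unique_games_conjecture \<longleftrightarrow>
     (\<forall>\<epsilon> > 0. \<forall>\<delta> > 0. \<exists>k. NP_hard_promise
        (enc_unique_game ` {I. wf_unique_game I \<and> nlabels I = k \<and> game_value I \<ge> 1 - \<epsilon>})
        (enc_unique_game ` {I. wf_unique_game I \<and> nlabels I = k \<and> game_value I \<le> \<delta>}))"


section \<open>Maximum independent set with predictions\<close>

text \<open>Finite simple undirected graphs with vertex set \<open>{..<order}\<close>.\<close>

record ugraph =
  order :: nat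
  uedges :: "nat set set"

definition verts :: "ugraph \<Rightarrow> nat set" where
  "verts G = {..<order G}"

definition wf_ugraph :: "ugraph \<Rightarrow> bool" where
  "wf_ugraph G \<longleftrightarrow> (\<forall>e\<in>uedges G. e \<subseteq> verts G \<and> card e = 2)"

definition independent_set :: "ugraph \<Rightarrow> nat set \<Rightarrow> bool" where
  "independent_set G S \<longleftrightarrow> S \<subseteq> verts G \<and> (\<forall>u\<in>S. \<forall>v\<in>S. {u, v} \<notin> uedges G)"

definition OPT :: "ugraph \<Rightarrow> nat" where
  "OPT G = Max (card ` {S. independent_set G S})"

definition maximum_independent_set :: "ugraph \<Rightarrow> nat set \<Rightarrow> bool" where
  "maximum_independent_set G S \<longleftrightarrow> independent_set G S \<and> card S = OPT G"

definition enc_vertex_set :: "ugraph \<Rightarrow> nat set \<Rightarrow> bool list" where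
  "enc_vertex_set G S = map (\<lambda>v. v \<in> S) [0..<order G]"

definition enc_ugraph :: "ugraph \<Rightarrow> bool list" where
  "enc_ugraph G = enc_nat (order G) @
     concat (map (\<lambda>u. map (\<lambda>v. {u, v} \<in> uedges G) [0..<order G]) [0..<order G])"

text \<open>
  An algorithm maps a graph \<open>G\<close> and a predicted vertex set \<open>X\<close> to a vertex set. Graphs are presented
  by their adjacency matrix, vertex sets by their characteristic vector.
\<close>

definition polytime_prediction_algorithm :: "(ugraph \<Rightarrow> nat set \<Rightarrow> nat set) \<Rightarrow> bool" where
  "polytime_prediction_algorithm A \<longleftrightarrow>
     polytime_on {(G, X). wf_ugraph G \<and> X \<subseteq> verts G}
       (\<lambda>(G, X). enc_ugraph G @ enc_vertex_set G X)
       (\<lambda>(G, X). enc_vertex_set G (A G X))"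

end

theory Submission
  imports Defs "HOL-Library.FuncSet"
begin

text \<open>
  If \<open>f x y < x + y\<close>, the algorithm solves the gap problem behind the Khot--Regev hardness of vertex
  cover, and hence decides every language in NP.

  \<^bold>\<open>From the algorithm to a gap.\<close> Take a graph \<open>H\<close> on \<open>n\<close> vertices whose optimum \<open>o\<close> is either between
  \<open>(1/2 - \<epsilon>) n\<close> and \<open>n/2\<close>, or at most \<open>\<gamma> n\<close>. Take \<open>2xM\<close> copies of \<open>H\<close> predicted to lie wholly in the
  solution, \<open>2yM\<close> copies predicted to miss it, and about \<open>(1 - x - y) M n\<close> correctly predicted isolated
  vertices. In the first case the errors are at most \<open>x\<close> and \<open>y\<close> times the optimum, so the output exceeds
  what is possible at all in the second case.

  \<^bold>\<open>From unique games to the gap.\<close> A vertex of the gadget graph is an edge of the game at some right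
  vertex \<open>v\<close>, \<open>D\<close> further edges at \<open>v\<close> (pseudo-uniformly selected), and a point \<open>\<xi>\<close> of a discrete cube
  whose coordinates are the labels; \<open>\<xi>\<close> encodes a \<open>p\<close>-biased random set of labels, \<open>p\<close> slightly below
  \<open>1/2\<close>. Two vertices are joined if two of their selected edges share the left vertex and the two label
  sets, transported there, are disjoint. Using \<open>D\<close> edges instead of all edges at \<open>v\<close> keeps the loss in
  the completeness case proportional to the fraction of violated edges. Conversely, in a large
  independent set the label families of many tuples have positive \<open>p\<close>-biased measure and are
  cross-intersecting, hence share an influential coordinate. As a family has fewer than \<open>D\<close> influential
  coordinates, two of the \<open>D\<close> edges of the tuple must agree on one of them, and such collisions at \<open>v\<close>
  give a good labeling.

  \<^bold>\<open>Influential coordinates.\<close> By Russo's formula the total influence of a monotone family is bounded at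
  some bias in \<open>(p, 1/2)\<close>. There the martingale argument of Falik and Samorodnitsky, based on a
  logarithmic Sobolev inequality, shows that fixing the influential coordinates of one family to \<open>1\<close>
  makes it almost certain. If none of them is influential for the other family, fixing them to \<open>0\<close> leaves
  that one positive measure, and at bias \<open>1/2\<close> the two families contain complementary, hence disjoint, sets.

  \<^bold>\<open>Polynomial time.\<close> The reduction is written as a bounded arithmetic expression over the input word;
  such expressions compile to counter programs, whose registers are head positions of a Turing machine.
\<close>

section \<open>Monotone families under biased measures\<close>

text \<open>The prediction is blind: it is computed without knowing any solution. A copy predicted
  full contributes \<open>n - o\<close> false positives, a copy predicted empty contributes
  \<open>o\<close> false negatives. Only if \<open>o\<close> is pinned near \<open>n/2\<close> from
  both sides are the two kinds of error charged at the same rate, half a copy each; this is where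
  the factor \<open>2\<close> in the numbers of copies comes from. The optimum of the padded graph
  is then close to \<open>M * n\<close>, and a guaranteed share above \<open>1 - x - y\<close> of it
  exceeds the isolated vertices.

  The bias stays below \<open>1/2\<close> because at \<open>1/2\<close> itself intersecting families
  of measure \<open>1/2\<close> need not have an influential coordinate (majority). The gap up to
  \<open>1/2\<close> is room to raise the bias until the total influence is bounded. Where this
  happens depends on the family, hence two biases \<open>s1\<close> and \<open>s2\<close> in the key
  lemma.

  The number of labels \<open>k\<close> is fixed by the conjecture before the machine is built. So
  the order \<open>E ^ Suc D * m ^ k\<close> of the gadget graph is polynomial in the input, and the
  exponents can be unrolled in the expression that computes it.\<close>

definition bexp :: "real \<Rightarrow> 'a set \<Rightarrow> ('a set \<Rightarrow> real) \<Rightarrow> real" where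
  "bexp s I f = (\<Sum>F\<in>Pow I. s ^ card F * (1 - s) ^ card (I - F) * f F)"

lemma bexp_empty [simp]: "bexp s {} f = f {}"
  by (simp add: bexp_def)

text \<open>Conditioning on the coordinate \<open>i\<close>. The inductions on the coordinate set
  below rest on this recursion.\<close>

lemma bexp_insert:
  assumes "finite I" "i \<notin> I"
  shows "bexp s (insert i I) f = s * bexp s I (\<lambda>F. f (insert i F)) + (1 - s) * bexp s I f"
proof -
  have inj: "inj_on (insert i) (Pow I)" using assms(2) by (auto simp: inj_on_def)
  have disj: "Pow I \<inter> insert i ` Pow I = {}" using assms(2) by auto
  let ?w = "\<lambda>F. s ^ card F * (1 - s) ^ card (insert i I - F) * f F"
  have "bexp s (insert i I) f = sum ?w (Pow I) + sum ?w (insert i ` Pow I)"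
    unfolding bexp_def Pow_insert
    by (rule sum.union_disjoint) (use assms disj in auto)
  moreover have "sum ?w (Pow I) = (1 - s) * bexp s I f"
    unfolding bexp_def sum_distrib_left
  proof (rule sum.cong[OF refl])
    fix F assume "F \<in> Pow I"
    then have "insert i I - F = insert i (I - F)" "i \<notin> I - F" using assms by auto
    then show "?w F = (1 - s) * (s ^ card F * (1 - s) ^ card (I - F) * f F)"
      using assms by simp
  qed
  moreover have "sum ?w (insert i ` Pow I) = s * bexp s I (\<lambda>F. f (insert i F))"
    unfolding bexp_def sum_distrib_left sum.reindex[OF inj] comp_def
  proof (rule sum.cong[OF refl])
    fix F assume F: "F \<in> Pow I"
    then have "insert i I - insert i F = I - F" "i \<notin> F" "finite F"
      using assms by (auto intro: finite_subset)
    then show "?w (insert i F) = s * (s ^ card F * (1 - s) ^ card (I - F) * f (insert i F))"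
      by simp
  qed
  ultimately show ?thesis by simp
qed

lemma bexp_cong:
  "(\<And>F. F \<subseteq> I \<Longrightarrow> f F = g F) \<Longrightarrow> bexp s I f = bexp s I g"
  by (simp add: bexp_def)

lemma bexp_add: "bexp s I (\<lambda>F. f F + g F) = bexp s I f + bexp s I g"
  by (simp add: bexp_def sum.distrib algebra_simps)

lemma bexp_diff: "bexp s I (\<lambda>F. f F - g F) = bexp s I f - bexp s I g"
  by (simp add: bexp_def sum_subtractf algebra_simps)

lemma bexp_cmult: "bexp s I (\<lambda>F. c * f F) = c * bexp s I f"
  by (simp add: bexp_def sum_distrib_left algebra_simps)

lemma bexp_const: "finite I \<Longrightarrow> bexp s I (\<lambda>F. c) = c"
  by (induction I rule: finite_induct) (simp_all add: bexp_insert algebra_simps)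

lemma bexp_mono:
  assumes "0 \<le> s" "s \<le> 1" "\<And>F. F \<subseteq> I \<Longrightarrow> f F \<le> g F"
  shows "bexp s I f \<le> bexp s I g"
  unfolding bexp_def using assms by (intro sum_mono mult_left_mono) auto

lemma bexp_nonneg:
  assumes "0 \<le> s" "s \<le> 1" "\<And>F. F \<subseteq> I \<Longrightarrow> 0 \<le> f F"
  shows "0 \<le> bexp s I f"
  unfolding bexp_def using assms by (intro sum_nonneg mult_nonneg_nonneg) auto

lemma bexp_Un:
  assumes "finite I" "finite J" "I \<inter> J = {}"
  shows "bexp s (I \<union> J) f = bexp s I (\<lambda>F. bexp s J (\<lambda>G. f (F \<union> G)))"
  using assms
proof (induction I arbitrary: f rule: finite_induct)
  case (insert i I)
  then show ?case by (simp add: bexp_insert)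
qed simp

lemma bexp_image:
  assumes "finite I" "inj_on \<pi> I"
  shows "bexp s (\<pi> ` I) f = bexp s I (\<lambda>F. f (\<pi> ` F))"
  using assms
proof (induction I arbitrary: f rule: finite_induct)
  case (insert i I)
  then have "\<pi> i \<notin> \<pi> ` I" by (auto simp: inj_on_def)
  then show ?case using insert by (simp add: bexp_insert)
qed simp

lemma bexp_abs_eq_0:
  assumes "0 < s" "s < 1" "finite I" "bexp s I (\<lambda>F. \<bar>g F\<bar>) = 0" "F \<subseteq> I"
  shows "g F = 0"
proof -
  have "\<forall>F\<in>Pow I. s ^ card F * (1 - s) ^ card (I - F) * \<bar>g F\<bar> = 0"
    using assms by (subst sum_nonneg_eq_0_iff[symmetric]) (auto simp: bexp_def)
  then have "s ^ card F * (1 - s) ^ card (I - F) * \<bar>g F\<bar> = 0" using assms(5) by blast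
  then show ?thesis using assms(1,2) by simp
qed

lemma bexp_square_eq_0:
  assumes "0 < s" "s < 1" "finite I" "bexp s I (\<lambda>F. \<bar>g F\<bar>) = 0"
  shows "bexp s I (\<lambda>F. (g F)\<^sup>2) = 0"
proof -
  have "bexp s I (\<lambda>F. (g F)\<^sup>2) = bexp s I (\<lambda>F. 0)"
    using bexp_abs_eq_0[OF assms] by (intro bexp_cong) simp
  then show ?thesis using assms(3) by (simp add: bexp_const)
qed

text \<open>The expectation of the square of \<open>u * f - v * g\<close> is a nonnegative quadratic
  form in \<open>u\<close> and \<open>v\<close>; well-chosen arguments give the claim without
  dividing by a second moment that may vanish.\<close>

lemma bexp_Cauchy_Schwarz:
  assumes "0 \<le> s" "s \<le> 1"
  shows "bexp s I (\<lambda>F. f F * g F) \<le> sqrt (bexp s I (\<lambda>F. (f F)\<^sup>2)) * sqrt (bexp s I (\<lambda>F. (g F)\<^sup>2))"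
proof -
  define a b c where "a = bexp s I (\<lambda>F. (f F)\<^sup>2)" and "b = bexp s I (\<lambda>F. (g F)\<^sup>2)"
    and "c = bexp s I (\<lambda>F. f F * g F)"
  have nn: "0 \<le> a" "0 \<le> b" unfolding a_def b_def using assms by (auto intro: bexp_nonneg)
  have quad: "0 \<le> u\<^sup>2 * a - 2 * u * v * c + v\<^sup>2 * b" for u v
  proof -
    have "0 \<le> bexp s I (\<lambda>F. (u * f F - v * g F)\<^sup>2)" using assms by (auto intro: bexp_nonneg)
    also have "\<dots> = bexp s I (\<lambda>F. (u\<^sup>2 * (f F)\<^sup>2 - (2 * u * v) * (f F * g F)) + v\<^sup>2 * (g F)\<^sup>2)"
      by (intro bexp_cong) (simp add: power2_eq_square algebra_simps)
    also have "\<dots> = u\<^sup>2 * a - 2 * u * v * c + v\<^sup>2 * b"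
      by (simp add: bexp_add bexp_diff bexp_cmult a_def b_def c_def)
    finally show ?thesis .
  qed
  have "c\<^sup>2 \<le> a * b"
  proof (cases "a = 0")
    case True
    have "c = 0"
    proof (rule ccontr)
      assume "c \<noteq> 0"
      \<comment> \<open>With \<open>a = 0\<close> the form is linear in \<open>u\<close>, and this
        \<open>u\<close> makes it equal to \<open>-1\<close>.\<close>
      then show False using quad[of "(b + 1) / (2 * c)" 1] True by (simp add: field_simps)
    qed
    then show ?thesis using True by simp
  next
    case False
    have "0 \<le> c\<^sup>2 * a - 2 * c * a * c + a\<^sup>2 * b" using quad[of c a] .
    also have "\<dots> = a * (a * b - c\<^sup>2)" by (simp add: power2_eq_square algebra_simps)
    finally show ?thesis using False nn by (simp add: zero_le_mult_iff)
  qed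
  then show ?thesis unfolding a_def[symmetric] b_def[symmetric] c_def[symmetric] real_sqrt_mult[symmetric]
    by (rule real_le_rsqrt)
qed

section \<open>Dirichlet forms and a logarithmic Sobolev inequality\<close>

definition dirichlet :: "real \<Rightarrow> 'a set \<Rightarrow> ('a set \<Rightarrow> real) \<Rightarrow> real" where
  "dirichlet s I g = (\<Sum>i\<in>I. bexp s (I - {i}) (\<lambda>F. (g (insert i F) - g F)\<^sup>2))"

lemma dirichlet_nonneg: "0 \<le> s \<Longrightarrow> s \<le> 1 \<Longrightarrow> 0 \<le> dirichlet s I g"
  unfolding dirichlet_def by (intro sum_nonneg bexp_nonneg) auto

lemma dirichlet_insert:
  assumes "finite I" "i \<notin> I"
  shows "dirichlet s (insert i I) g = bexp s I (\<lambda>F. (g (insert i F) - g F)\<^sup>2)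
     + s * dirichlet s I (\<lambda>F. g (insert i F)) + (1 - s) * dirichlet s I g"
proof -
  have "bexp s (insert i I - {j}) (\<lambda>F. (g (insert j F) - g F)\<^sup>2) =
      s * bexp s (I - {j}) (\<lambda>F. (g (insert i (insert j F)) - g (insert i F))\<^sup>2)
      + (1 - s) * bexp s (I - {j}) (\<lambda>F. (g (insert j F) - g F)\<^sup>2)" if "j \<in> I" for j
  proof -
    have "insert i I - {j} = insert i (I - {j})" using that assms by auto
    then show ?thesis using assms by (simp add: bexp_insert insert_commute)
  qed
  then show ?thesis
    unfolding dirichlet_def using assms
    by (simp add: sum.distrib sum_distrib_left)
qed

text \<open>Two uses of \<open>ln z \<le> z - 1\<close>, for \<open>z = y * a / (b * x)\<close> and
  for \<open>z = x / a\<close>. The bound is chosen so that its first summand vanishes once it is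
  averaged over the two points of the next lemma.\<close>

lemma entropy_term_le:
  fixes a b x y :: real
  assumes "0 < a" "0 < b" "0 \<le> x" "0 \<le> y" "y = 0 \<Longrightarrow> x = 0"
  shows "x * (ln (a / b\<^sup>2) - ln (x / y\<^sup>2)) \<le> 2 * (y * a / b - x) + (x\<^sup>2 / a - x)"
proof (cases "x = 0")
  case True
  then show ?thesis using assms by simp
next
  case False
  then have pos: "0 < x" "0 < y" using assms by (auto simp: less_le)
  have "ln (a / b\<^sup>2) - ln (x / y\<^sup>2) = 2 * ln (y * a / (b * x)) + ln (x / a)"
    using pos assms(1,2) by (simp add: ln_div ln_mult ln_realpow algebra_simps)
  also have "\<dots> \<le> 2 * (y * a / (b * x) - 1) + (x / a - 1)"
    using pos assms(1,2) by (intro add_mono mult_left_mono ln_le_minus_one) auto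
  finally have "x * (ln (a / b\<^sup>2) - ln (x / y\<^sup>2)) \<le> x * (2 * (y * a / (b * x) - 1) + (x / a - 1))"
    using pos by (intro mult_left_mono) auto
  also have "\<dots> = 2 * (y * a / b - x) + (x\<^sup>2 / a - x)"
    using pos assms(1,2) by (simp add: field_simps power2_eq_square)
  finally show ?thesis .
qed

text \<open>This is the inductive step for \<open>log_Sobolev_aux\<close>: \<open>a1\<close>,
  \<open>a0\<close> stand for second moments and \<open>b1\<close>, \<open>b0\<close> for first
  absolute moments on two half cubes, and the last summand bounds from below what the new coordinate
  adds to the Dirichlet form.\<close>

lemma two_point_log_Sobolev:
  fixes s a1 a0 b1 b0 :: real
  assumes s: "0 < s" "s \<le> 1/2" and nn: "0 \<le> a1" "0 \<le> a0" "0 \<le> b1" "0 \<le> b0"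
    and z: "b1 = 0 \<Longrightarrow> a1 = 0" "b0 = 0 \<Longrightarrow> a0 = 0"
  defines "a \<equiv> s * a1 + (1 - s) * a0" and "b \<equiv> s * b1 + (1 - s) * b0"
  shows "a * ln (a / b\<^sup>2) \<le> s * (a1 * ln (a1 / b1\<^sup>2)) + (1 - s) * (a0 * ln (a0 / b0\<^sup>2))
           + 2 * (sqrt a1 - sqrt a0)\<^sup>2"
proof (cases "a = 0")
  case True
  have "s * a1 \<ge> 0" "(1 - s) * a0 \<ge> 0" using s nn by auto
  then have "s * a1 = 0" "(1 - s) * a0 = 0" using True unfolding a_def by linarith+
  then have "a1 = 0" "a0 = 0" using s by auto
  then show ?thesis using True by simp
next
  case False
  have s1: "0 \<le> 1 - s" "0 < 1 - s" using s by auto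
  have a: "0 < a" using False nn s unfolding a_def by (auto simp: less_le intro!: add_nonneg_nonneg mult_nonneg_nonneg)
  have "b \<noteq> 0"
  proof
    assume "b = 0"
    have "s * b1 \<ge> 0" "(1 - s) * b0 \<ge> 0" using s nn by auto
    then have "s * b1 = 0" "(1 - s) * b0 = 0" using \<open>b = 0\<close> unfolding b_def by linarith+
    then have "b1 = 0" "b0 = 0" using s by auto
    then show False using z False unfolding a_def by simp
  qed
  then have b: "0 < b" using nn s unfolding b_def by (auto simp: less_le intro!: add_nonneg_nonneg mult_nonneg_nonneg)
  let ?L = "ln (a / b\<^sup>2)"
  have "a * ?L - s * (a1 * ln (a1 / b1\<^sup>2)) - (1 - s) * (a0 * ln (a0 / b0\<^sup>2))
      = s * (a1 * (?L - ln (a1 / b1\<^sup>2))) + (1 - s) * (a0 * (?L - ln (a0 / b0\<^sup>2)))"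
    unfolding a_def by (simp add: algebra_simps)
  also have "\<dots> \<le> s * (2 * (b1 * a / b - a1) + (a1\<^sup>2 / a - a1)) + (1 - s) * (2 * (b0 * a / b - a0) + (a0\<^sup>2 / a - a0))"
    using entropy_term_le[OF a b nn(1,3) z(1)] entropy_term_le[OF a b nn(2,4) z(2)] s s1
    by (intro add_mono mult_left_mono) auto
  also have "\<dots> = 2 * ((s * b1 + (1 - s) * b0) * a / b - (s * a1 + (1 - s) * a0)) + ((s * a1\<^sup>2 + (1 - s) * a0\<^sup>2) / a - (s * a1 + (1 - s) * a0))"
    using a b by (simp add: field_simps)
  also have "\<dots> = (s * a1\<^sup>2 + (1 - s) * a0\<^sup>2) / a - a"
    using b unfolding a_def[symmetric] b_def[symmetric] by simp
  also have "\<dots> = (s * (1 - s)) * (a1 - a0)\<^sup>2 / a"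
  proof -
    have "s * a1\<^sup>2 + (1 - s) * a0\<^sup>2 - a * a = (s * (1 - s)) * (a1 - a0)\<^sup>2"
      unfolding a_def by (simp add: power2_eq_square algebra_simps)
    then show ?thesis using a by (simp add: field_simps)
  qed
  \<comment> \<open>The difference \<open>a1 - a0\<close> factors through the square roots, and
    \<open>s \<le> 1/2\<close> gives \<open>s * (a1 + a0) \<le> a\<close>.\<close>
  also have "\<dots> \<le> 2 * (sqrt a1 - sqrt a0)\<^sup>2"
  proof -
    have "(a1 - a0)\<^sup>2 = (sqrt a1 - sqrt a0)\<^sup>2 * (sqrt a1 + sqrt a0)\<^sup>2"
    proof -
      have "a1 - a0 = (sqrt a1 - sqrt a0) * (sqrt a1 + sqrt a0)"
        using nn by (simp add: algebra_simps)
      then show ?thesis by (metis power_mult_distrib)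
    qed
    moreover have "(sqrt a1 + sqrt a0)\<^sup>2 \<le> 2 * (a1 + a0)"
      using nn zero_le_power2[of "sqrt a1 - sqrt a0"] by (simp add: power2_sum power2_diff)
    moreover have "s * (a1 + a0) \<le> a" unfolding a_def using s nn mult_right_mono[of s "1 - s" a0] by (simp add: algebra_simps)
    ultimately have "s * (a1 - a0)\<^sup>2 \<le> (sqrt a1 - sqrt a0)\<^sup>2 * (2 * a)"
      using s mult_left_mono[of "s * (sqrt a1 + sqrt a0)\<^sup>2" "2 * a" "(sqrt a1 - sqrt a0)\<^sup>2"]
        mult_left_mono[of "(sqrt a1 + sqrt a0)\<^sup>2" "2 * (a1 + a0)" s]
      by (simp add: algebra_simps)
    moreover have "s * (1 - s) * (a1 - a0)\<^sup>2 \<le> s * (a1 - a0)\<^sup>2"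
      using s by (intro mult_right_mono) auto
    ultimately show ?thesis using a by (simp add: pos_divide_le_eq algebra_simps)
  qed
  finally show ?thesis by simp
qed

text \<open>By Jensen the left side is at most the entropy of the square of \<open>g\<close>. This
  smaller functional compares just two moments, so it can be split along one coordinate and treated
  by induction.\<close>

lemma log_Sobolev_aux:
  assumes "finite I" "0 < s" "s \<le> 1/2"
  shows "bexp s I (\<lambda>F. (g F)\<^sup>2) * ln (bexp s I (\<lambda>F. (g F)\<^sup>2) / (bexp s I (\<lambda>F. \<bar>g F\<bar>))\<^sup>2) \<le> 2 * dirichlet s I g"
  using assms
proof (induction I arbitrary: g rule: finite_induct)
  case empty
  then show ?case by (simp add: dirichlet_def)
next
  case (insert i I)
  let ?g1 = "\<lambda>F. g (insert i F)"
  define a1 a0 b1 b0 where "a1 = bexp s I (\<lambda>F. (?g1 F)\<^sup>2)" and "a0 = bexp s I (\<lambda>F. (g F)\<^sup>2)"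
    and "b1 = bexp s I (\<lambda>F. \<bar>?g1 F\<bar>)" and "b0 = bexp s I (\<lambda>F. \<bar>g F\<bar>)"
  have s01: "0 \<le> s" "s \<le> 1" "s < 1" using insert.prems by auto
  have nn: "0 \<le> a1" "0 \<le> a0" "0 \<le> b1" "0 \<le> b0"
    unfolding a1_def a0_def b1_def b0_def using s01 by (auto intro: bexp_nonneg)
  have z: "b1 = 0 \<Longrightarrow> a1 = 0" "b0 = 0 \<Longrightarrow> a0 = 0"
    unfolding a1_def a0_def b1_def b0_def
    using bexp_square_eq_0[OF insert.prems(1) s01(3) insert.hyps(1), of ?g1]
      bexp_square_eq_0[OF insert.prems(1) s01(3) insert.hyps(1), of g] by blast+
  have IH1: "a1 * ln (a1 / b1\<^sup>2) \<le> 2 * dirichlet s I ?g1" and IH0: "a0 * ln (a0 / b0\<^sup>2) \<le> 2 * dirichlet s I g"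
    unfolding a1_def a0_def b1_def b0_def using insert.IH[of ?g1] insert.IH[of g] insert.prems by auto
  \<comment> \<open>Minkowski's inequality: the \<open>L2\<close> norms of the two halves differ by
    at most the norm of the discrete derivative.\<close>
  have mink: "(sqrt a1 - sqrt a0)\<^sup>2 \<le> bexp s I (\<lambda>F. (g (insert i F) - g F)\<^sup>2)"
  proof -
    have "bexp s I (\<lambda>F. (g (insert i F) - g F)\<^sup>2)
        = bexp s I (\<lambda>F. ((?g1 F)\<^sup>2 - 2 * (?g1 F * g F)) + (g F)\<^sup>2)"
      by (intro bexp_cong) (simp add: power2_eq_square algebra_simps)
    also have "\<dots> = a1 - 2 * bexp s I (\<lambda>F. ?g1 F * g F) + a0"
      by (simp add: bexp_add bexp_diff bexp_cmult a1_def a0_def)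
    finally show ?thesis
      using bexp_Cauchy_Schwarz[OF s01(1,2), of I ?g1 g, folded a1_def a0_def] nn
      by (simp add: power2_diff)
  qed
  have "(s * a1 + (1 - s) * a0) * ln ((s * a1 + (1 - s) * a0) / (s * b1 + (1 - s) * b0)\<^sup>2)
     \<le> s * (a1 * ln (a1 / b1\<^sup>2)) + (1 - s) * (a0 * ln (a0 / b0\<^sup>2)) + 2 * (sqrt a1 - sqrt a0)\<^sup>2"
    using insert.prems nn z by (intro two_point_log_Sobolev) auto
  also have "\<dots> \<le> s * (2 * dirichlet s I ?g1) + (1 - s) * (2 * dirichlet s I g) + 2 * bexp s I (\<lambda>F. (g (insert i F) - g F)\<^sup>2)"
    using IH1 IH0 mink s01 by (intro add_mono mult_left_mono) auto
  finally show ?case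
    using insert.hyps by (simp add: bexp_insert dirichlet_insert a1_def a0_def b1_def b0_def algebra_simps)
qed

text \<open>The logarithm is replaced by a tangent with a free parameter \<open>t\<close>. In this
  linear form the inequalities for different functions can be added with one common
  \<open>t\<close>.\<close>

lemma log_Sobolev:
  assumes "finite I" "0 < s" "s \<le> 1/2" "0 < t"
  shows "bexp s I (\<lambda>F. (g F)\<^sup>2) * (ln t + 1) \<le> 2 * dirichlet s I g + t * (bexp s I (\<lambda>F. \<bar>g F\<bar>))\<^sup>2"
proof -
  define a b where "a = bexp s I (\<lambda>F. (g F)\<^sup>2)" and "b = bexp s I (\<lambda>F. \<bar>g F\<bar>)"
  have s01: "0 \<le> s" "s \<le> 1" "s < 1" using assms by auto
  have nn: "0 \<le> a" "0 \<le> b" unfolding a_def b_def using s01 by (auto intro: bexp_nonneg)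
  have "a * (ln t + 1) \<le> a * ln (a / b\<^sup>2) + t * b\<^sup>2"
  proof (cases "a = 0")
    case True
    then show ?thesis using assms by simp
  next
    case False
    have "b \<noteq> 0"
      using False bexp_square_eq_0[OF assms(2) s01(3) assms(1), of g] unfolding a_def b_def by blast
    then have pos: "0 < a" "0 < b" using nn False by auto
    have "ln t - ln (a / b\<^sup>2) = ln (t * b\<^sup>2 / a)"
      using pos assms(4) by (simp add: ln_div ln_mult)
    also have "\<dots> \<le> t * b\<^sup>2 / a - 1" using pos assms(4) by (intro ln_le_minus_one) auto
    finally have "a * (ln t - ln (a / b\<^sup>2)) \<le> a * (t * b\<^sup>2 / a - 1)" using pos by (intro mult_left_mono) auto
    then show ?thesis using pos by (simp add: algebra_simps)
  qed
  then show ?thesis using log_Sobolev_aux[OF assms(1-3), of g] unfolding a_def b_def by linarith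
qed

section \<open>The martingale argument: averaging out coordinates\<close>

lemma variance_two_point:
  fixes s x y :: real
  shows "s * x\<^sup>2 + (1 - s) * y\<^sup>2 - (s * x + (1 - s) * y)\<^sup>2 = s * (1 - s) * (x - y)\<^sup>2"
  by (simp add: power2_eq_square algebra_simps)

lemma bexp_variance_insert:
  "s * bexp s J (\<lambda>F. (f F)\<^sup>2) + (1 - s) * bexp s J (\<lambda>F. (g F)\<^sup>2)
      - bexp s J (\<lambda>F. (s * f F + (1 - s) * g F)\<^sup>2)
    = s * (1 - s) * bexp s J (\<lambda>F. (f F - g F)\<^sup>2)"
proof -
  have "s * bexp s J (\<lambda>F. (f F)\<^sup>2) + (1 - s) * bexp s J (\<lambda>F. (g F)\<^sup>2)
      - bexp s J (\<lambda>F. (s * f F + (1 - s) * g F)\<^sup>2)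
      = bexp s J (\<lambda>F. s * (f F)\<^sup>2 + (1 - s) * (g F)\<^sup>2 - (s * f F + (1 - s) * g F)\<^sup>2)"
    by (simp only: bexp_add bexp_diff bexp_cmult)
  then show ?thesis by (simp only: variance_two_point bexp_cmult)
qed

text \<open>Averaging out \<open>j\<close> costs \<open>q = s * (1 - s)\<close> times the second
  moment of the discrete derivative \<open>\<delta>\<close>, while the Dirichlet form drops by that
  second moment plus \<open>q\<close> times the Dirichlet form of \<open>\<delta>\<close>. The
  logarithmic Sobolev inequality for \<open>\<delta>\<close> compares the two losses.\<close>

lemma average_one_coordinate:
  fixes h :: "'a set \<Rightarrow> real"
  assumes J: "finite J" "j \<notin> J" and s: "0 < s" "s \<le> 1/2" and t: "0 < t"
  defines "h' \<equiv> \<lambda>F. s * h (insert j F) + (1 - s) * h F"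
  shows "(bexp s (insert j J) (\<lambda>F. (h F)\<^sup>2) - bexp s J (\<lambda>F. (h' F)\<^sup>2)) * (ln t + 1)
      \<le> 2 * (dirichlet s (insert j J) h - dirichlet s J h') + t * (bexp s J (\<lambda>F. \<bar>h (insert j F) - h F\<bar>))\<^sup>2"
proof -
  define \<delta> where "\<delta> = (\<lambda>F. h (insert j F) - h F)"
  define q where "q = s * (1 - s)"
  have q: "0 \<le> q" "q \<le> 1" unfolding q_def using s by (auto intro: mult_le_one)
  have e1: "bexp s (insert j J) (\<lambda>F. (h F)\<^sup>2) - bexp s J (\<lambda>F. (h' F)\<^sup>2) = q * bexp s J (\<lambda>F. (\<delta> F)\<^sup>2)"
    unfolding h'_def \<delta>_def q_def bexp_insert[OF J] by (rule bexp_variance_insert)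
  have "s * dirichlet s J (\<lambda>F. h (insert j F)) + (1 - s) * dirichlet s J h - dirichlet s J h' = q * dirichlet s J \<delta>"
    unfolding dirichlet_def sum_distrib_left sum.distrib[symmetric] sum_subtractf[symmetric]
  proof (rule sum.cong[OF refl])
    fix i assume "i \<in> J"
    show "s * bexp s (J - {i}) (\<lambda>F. (h (insert j (insert i F)) - h (insert j F))\<^sup>2)
         + (1 - s) * bexp s (J - {i}) (\<lambda>F. (h (insert i F) - h F)\<^sup>2)
         - bexp s (J - {i}) (\<lambda>F. (h' (insert i F) - h' F)\<^sup>2)
       = q * bexp s (J - {i}) (\<lambda>F. (\<delta> (insert i F) - \<delta> F)\<^sup>2)"
      using bexp_variance_insert[of s "J - {i}" "\<lambda>F. h (insert j (insert i F)) - h (insert j F)"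
          "\<lambda>F. h (insert i F) - h F"]
      unfolding h'_def \<delta>_def q_def by (simp add: algebra_simps)
  qed
  then have e2: "dirichlet s (insert j J) h - dirichlet s J h' = bexp s J (\<lambda>F. (\<delta> F)\<^sup>2) + q * dirichlet s J \<delta>"
    by (simp add: dirichlet_insert[OF J] \<delta>_def)
  have nn: "0 \<le> bexp s J (\<lambda>F. (\<delta> F)\<^sup>2)" using s by (intro bexp_nonneg) auto
  have "q * (bexp s J (\<lambda>F. (\<delta> F)\<^sup>2) * (ln t + 1))
      \<le> q * (2 * dirichlet s J \<delta> + t * (bexp s J (\<lambda>F. \<bar>\<delta> F\<bar>))\<^sup>2)"
    using log_Sobolev[OF J(1) s t] q by (intro mult_left_mono) auto
  moreover have "q * (t * (bexp s J (\<lambda>F. \<bar>\<delta> F\<bar>))\<^sup>2) \<le> 1 * (t * (bexp s J (\<lambda>F. \<bar>\<delta> F\<bar>))\<^sup>2)"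
    using q t by (intro mult_right_mono) auto
  ultimately show ?thesis unfolding e1 e2 using nn by (simp add: \<delta>_def algebra_simps)
qed

text \<open>The one-coordinate losses telescope. Averaging does not increase the \<open>L1\<close>
  norms of the other discrete derivatives, so those of the averaged functions may be replaced by
  those of \<open>h\<close>.\<close>

lemma average_coordinates:
  fixes h :: "'a set \<Rightarrow> real"
  assumes "finite D" "finite C" "C \<inter> D = {}" and s: "0 < s" "s \<le> 1/2" and t: "0 < t"
  shows "(bexp s (C \<union> D) (\<lambda>F. (h F)\<^sup>2) - bexp s C (\<lambda>F. (bexp s D (\<lambda>G. h (F \<union> G)))\<^sup>2)) * (ln t + 1)
      \<le> 2 * dirichlet s (C \<union> D) h
         + t * (\<Sum>j\<in>D. (bexp s (C \<union> D - {j}) (\<lambda>F. \<bar>h (insert j F) - h F\<bar>))\<^sup>2)"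
  using assms(1,3)
proof (induction D arbitrary: h rule: finite_induct)
  case empty
  then show ?case using dirichlet_nonneg[of s C h] s by simp
next
  case (insert j D)
  define h' where "h' = (\<lambda>F. s * h (insert j F) + (1 - s) * h F)"
  let ?J = "C \<union> D"
  have J: "finite ?J" "j \<notin> ?J" using insert.hyps insert.prems assms(2) by auto
  have eqJ: "C \<union> insert j D = insert j ?J" by auto
  have step: "(bexp s (insert j ?J) (\<lambda>F. (h F)\<^sup>2) - bexp s ?J (\<lambda>F. (h' F)\<^sup>2)) * (ln t + 1)
      \<le> 2 * (dirichlet s (insert j ?J) h - dirichlet s ?J h') + t * (bexp s ?J (\<lambda>F. \<bar>h (insert j F) - h F\<bar>))\<^sup>2"
    unfolding h'_def by (rule average_one_coordinate[OF J s t])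
  have IH: "(bexp s ?J (\<lambda>F. (h' F)\<^sup>2) - bexp s C (\<lambda>F. (bexp s D (\<lambda>G. h' (F \<union> G)))\<^sup>2)) * (ln t + 1)
      \<le> 2 * dirichlet s ?J h' + t * (\<Sum>i\<in>D. (bexp s (?J - {i}) (\<lambda>F. \<bar>h' (insert i F) - h' F\<bar>))\<^sup>2)"
    using insert.prems by (intro insert.IH) auto
  have avg: "bexp s (insert j D) (\<lambda>G. h (F \<union> G)) = bexp s D (\<lambda>G. h' (F \<union> G))" for F
    using insert.hyps by (simp add: bexp_insert h'_def bexp_add bexp_cmult)
  have "(\<Sum>i\<in>D. (bexp s (?J - {i}) (\<lambda>F. \<bar>h' (insert i F) - h' F\<bar>))\<^sup>2)
      \<le> (\<Sum>i\<in>D. (bexp s (insert j ?J - {i}) (\<lambda>F. \<bar>h (insert i F) - h F\<bar>))\<^sup>2)"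
  proof (intro sum_mono power_mono)
    fix i assume i: "i \<in> D"
    then have e: "insert j ?J - {i} = insert j (?J - {i})" using J by auto
    have "bexp s (?J - {i}) (\<lambda>F. \<bar>h' (insert i F) - h' F\<bar>)
       \<le> bexp s (?J - {i}) (\<lambda>F. s * \<bar>h (insert j (insert i F)) - h (insert j F)\<bar> + (1 - s) * \<bar>h (insert i F) - h F\<bar>)"
    proof (rule bexp_mono)
      fix F
      have "h' (insert i F) - h' F = s * (h (insert j (insert i F)) - h (insert j F)) + (1 - s) * (h (insert i F) - h F)"
        unfolding h'_def by (simp add: algebra_simps)
      then show "\<bar>h' (insert i F) - h' F\<bar> \<le> s * \<bar>h (insert j (insert i F)) - h (insert j F)\<bar> + (1 - s) * \<bar>h (insert i F) - h F\<bar>"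
        using abs_triangle_ineq[of "s * (h (insert j (insert i F)) - h (insert j F))" "(1 - s) * (h (insert i F) - h F)"] s
        by (simp add: abs_mult)
    qed (use s in auto)
    also have "\<dots> = bexp s (insert j ?J - {i}) (\<lambda>F. \<bar>h (insert i F) - h F\<bar>)"
      unfolding e using J by (simp add: bexp_insert bexp_add bexp_cmult insert_commute)
    finally show "bexp s (?J - {i}) (\<lambda>F. \<bar>h' (insert i F) - h' F\<bar>)
       \<le> bexp s (insert j ?J - {i}) (\<lambda>F. \<bar>h (insert i F) - h F\<bar>)" .
    show "0 \<le> bexp s (?J - {i}) (\<lambda>F. \<bar>h' (insert i F) - h' F\<bar>)" using s by (intro bexp_nonneg) auto
  qed
  then have "t * (\<Sum>i\<in>D. (bexp s (?J - {i}) (\<lambda>F. \<bar>h' (insert i F) - h' F\<bar>))\<^sup>2)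
      \<le> t * (\<Sum>i\<in>D. (bexp s (insert j ?J - {i}) (\<lambda>F. \<bar>h (insert i F) - h F\<bar>))\<^sup>2)"
    using t by (intro mult_left_mono) auto
  moreover have "insert j ?J - {j} = ?J" using J by auto
  ultimately show ?case
    unfolding eqJ avg using step IH insert.hyps by (simp add: algebra_simps)
qed

section \<open>Influences, Russo's formula and the influential core\<close>

definition infl :: "real \<Rightarrow> 'a set \<Rightarrow> ('a set \<Rightarrow> bool) \<Rightarrow> 'a \<Rightarrow> real" where
  "infl s I P i = bexp s (I - {i}) (\<lambda>F. of_bool (P (insert i F)) - of_bool (P F))"

lemma bexp_has_derivative:
  assumes "finite I"
  shows "((\<lambda>s. bexp s I f) has_real_derivative
           (\<Sum>i\<in>I. bexp s (I - {i}) (\<lambda>F. f (insert i F) - f F))) (at s)"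
  using assms
proof (induction I arbitrary: f rule: finite_induct)
  case empty
  then show ?case by simp
next
  case (insert i I)
  let ?D = "\<lambda>f. \<Sum>j\<in>I. bexp s (I - {j}) (\<lambda>F. f (insert j F) - f F)"
  have d: "((\<lambda>s. s * bexp s I (\<lambda>F. f (insert i F)) + (1 - s) * bexp s I f) has_real_derivative
      (1 * bexp s I (\<lambda>F. f (insert i F)) + ?D (\<lambda>F. f (insert i F)) * s)
      + ((0 - 1) * bexp s I f + ?D f * (1 - s))) (at s)"
    by (intro DERIV_add DERIV_mult DERIV_diff DERIV_ident DERIV_const insert.IH)
  have "bexp s (insert i I - {j}) (\<lambda>F. f (insert j F) - f F)
      = s * bexp s (I - {j}) (\<lambda>F. f (insert i (insert j F)) - f (insert i F))
        + (1 - s) * bexp s (I - {j}) (\<lambda>F. f (insert j F) - f F)" if "j \<in> I" for j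
  proof -
    have "insert i I - {j} = insert i (I - {j})" using that insert.hyps by auto
    then show ?thesis using insert.hyps by (simp add: bexp_insert insert_commute)
  qed
  then have e: "(\<Sum>j\<in>insert i I. bexp s (insert i I - {j}) (\<lambda>F. f (insert j F) - f F))
     = bexp s I (\<lambda>F. f (insert i F) - f F) + (s * ?D (\<lambda>F. f (insert i F)) + (1 - s) * ?D f)"
    using insert.hyps by (simp add: sum.distrib sum_distrib_left)
  show ?case unfolding e bexp_insert[OF insert.hyps]
    using d by (simp add: bexp_diff algebra_simps)
qed

lemma infl_nonneg:
  assumes "mono P" "0 \<le> s" "s \<le> 1"
  shows "0 \<le> infl s I P i"
  unfolding infl_def
proof (rule bexp_nonneg[OF assms(2,3)])
  fix F
  have "P F \<le> P (insert i F)" using monoD[OF assms(1), of F "insert i F"] by auto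
  then show "(0::real) \<le> of_bool (P (insert i F)) - of_bool (P F)" by auto
qed

text \<open>Defined by signed differences, an influence is literally the derivative of the measure
  in the bias of one coordinate; for a monotone family it is the probability that this coordinate is
  pivotal.\<close>

lemma Russo:
  assumes "finite I"
  shows "((\<lambda>s. bexp s I (\<lambda>F. of_bool (P F))) has_real_derivative (\<Sum>i\<in>I. infl s I P i)) (at s)"
  using bexp_has_derivative[OF assms] unfolding infl_def .

lemma bexp_mono_bias:
  assumes "finite I" "mono P" "0 \<le> s" "s \<le> s'" "s' \<le> 1"
  shows "bexp s I (\<lambda>F. of_bool (P F)) \<le> bexp s' I (\<lambda>F. of_bool (P F))"
proof (rule DERIV_nonneg_imp_nondecreasing[OF assms(4)])
  fix x assume "s \<le> x" "x \<le> s'"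
  then show "\<exists>y. ((\<lambda>s. bexp s I (\<lambda>F. of_bool (P F))) has_real_derivative y) (at x) \<and> 0 \<le> y"
    using Russo[OF assms(1)] assms by (intro exI[of _ "\<Sum>i\<in>I. infl x I P i"] conjI sum_nonneg infl_nonneg) auto
qed

text \<open>Mean value theorem: the measure rises by at most \<open>1\<close> between
  \<open>p\<close> and \<open>1/2\<close>, and its derivative is the total influence.\<close>

lemma small_total_influence:
  assumes "finite I" "0 < p" "p < 1/2"
  obtains s where "p < s" "s < 1/2" "(\<Sum>i\<in>I. infl s I P i) \<le> 1 / (1/2 - p)"
proof -
  let ?m = "\<lambda>s. bexp s I (\<lambda>F. of_bool (P F))"
  obtain z where z: "p < z" "z < 1/2" "?m (1/2) - ?m p = (1/2 - p) * (\<Sum>i\<in>I. infl z I P i)"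
    using MVT2[OF assms(3), of ?m "\<lambda>s. \<Sum>i\<in>I. infl s I P i"] Russo[OF assms(1)] by blast
  have "?m (1/2) \<le> bexp (1/2) I (\<lambda>F. 1)" by (intro bexp_mono) auto
  moreover have "0 \<le> ?m p" using assms by (intro bexp_nonneg) auto
  ultimately have "(1/2 - p) * (\<Sum>i\<in>I. infl z I P i) \<le> 1" using z(3) assms by (simp add: bexp_const)
  then have "(\<Sum>i\<in>I. infl z I P i) \<le> 1 / (1/2 - p)" using assms by (simp add: field_simps)
  then show ?thesis using that z by blast
qed

text \<open>Let \<open>m\<close> be the conditional measure given the part of the set inside
  \<open>C\<close>. Averaging over the other coordinates, whose influences lie below
  \<open>\<tau>\<close>, changes the second moment by at most
  \<open>3 * K / (1 + ln (1 / \<tau>))\<close>. If even the largest value \<open>m C\<close> were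
  below \<open>1 - \<eta>\<close>, then \<open>m\<close> would stay away from \<open>1\<close>
  everywhere and the change would be at least \<open>\<eta> * \<gamma>\<close>.\<close>

lemma influential_core:
  assumes I: "finite I" and P: "mono P" and s: "0 < s" "s \<le> 1/2"
    and K: "(\<Sum>i\<in>I. infl s I P i) \<le> K" and \<tau>: "0 < \<tau>" "\<tau> \<le> 1" and \<eta>: "0 < \<eta>"
    and \<gamma>: "\<gamma> \<le> bexp s I (\<lambda>F. of_bool (P F))"
    and large: "3 * K < \<gamma> * \<eta> * (1 + ln (1 / \<tau>))"
  defines "C \<equiv> {i\<in>I. \<tau> \<le> infl s I P i}"
  shows "1 - \<eta> \<le> bexp s (I - C) (\<lambda>G. of_bool (P (C \<union> G)))"
proof (rule ccontr)
  assume not: "\<not> ?thesis"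
  define D where "D = I - C"
  let ?h = "\<lambda>F. of_bool (P F) :: real"
  define m where "m = (\<lambda>F. bexp s D (\<lambda>G. ?h (F \<union> G)))"
  have CD: "finite C" "finite D" "C \<inter> D = {}" "C \<union> D = I" using I unfolding C_def D_def by auto
  have s01: "0 \<le> s" "s \<le> 1" using s by auto
  have step: "?h F \<le> ?h (insert i F)" for F i
    using monoD[OF P, of F "insert i F"] by auto
  have sq: "(?h (insert i F) - ?h F)\<^sup>2 = ?h (insert i F) - ?h F" "\<bar>?h (insert i F) - ?h F\<bar> = ?h (insert i F) - ?h F" for F i
    using step[of F i] by (auto simp: of_bool_def)
  have h2: "(of_bool b :: real)\<^sup>2 = of_bool b" for b by (cases b) auto
  \<comment> \<open>Discrete derivatives of a monotone indicator are \<open>0\<close> or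
    \<open>1\<close>, so squaring does not change them.\<close>
  have dirichlet: "dirichlet s I ?h = (\<Sum>i\<in>I. infl s I P i)" unfolding dirichlet_def infl_def sq ..
  have nn: "0 \<le> infl s I P i" for i using infl_nonneg[OF P s01] .
  have "(\<Sum>j\<in>D. (infl s I P j)\<^sup>2) \<le> (\<Sum>j\<in>D. \<tau> * infl s I P j)"
    unfolding power2_eq_square using nn by (intro sum_mono mult_right_mono) (auto simp: D_def C_def)
  also have "\<dots> \<le> \<tau> * (\<Sum>j\<in>I. infl s I P j)"
    unfolding sum_distrib_left[symmetric] using \<tau> nn I by (intro mult_left_mono sum_mono2) (auto simp: D_def)
  also have "\<dots> \<le> \<tau> * K" using K \<tau> by (intro mult_left_mono) auto
  finally have "1 / \<tau> * (\<Sum>j\<in>D. (infl s I P j)\<^sup>2) \<le> K" using \<tau> by (simp add: field_simps)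
  \<comment> \<open>The parameter \<open>t = 1 / \<tau>\<close> cancels the bound
    \<open>\<tau> * K\<close> on the sum of the squared small influences; with the Dirichlet term
    this makes \<open>3 * K\<close>.\<close>
  moreover have "(bexp s I (\<lambda>F. (?h F)\<^sup>2) - bexp s C (\<lambda>F. (m F)\<^sup>2)) * (ln (1 / \<tau>) + 1)
      \<le> 2 * dirichlet s I ?h + 1 / \<tau> * (\<Sum>j\<in>D. (infl s I P j)\<^sup>2)"
    using average_coordinates[OF CD(2,1,3) s, of "1 / \<tau>" ?h] \<tau> unfolding CD(4) m_def infl_def sq by simp
  ultimately have V: "(bexp s I ?h - bexp s C (\<lambda>F. (m F)\<^sup>2)) * (ln (1 / \<tau>) + 1) \<le> 3 * K"
    using K unfolding dirichlet by (simp add: h2)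
  have Em: "bexp s I ?h = bexp s C m" unfolding m_def using bexp_Un[OF CD(1-3), of s ?h] CD(4) by simp
  have m0: "0 \<le> m F" for F unfolding m_def using s01 by (intro bexp_nonneg) auto
  have "m F \<le> 1 - \<eta>" if "F \<subseteq> C" for F
  proof -
    have "m F \<le> m C" unfolding m_def
    proof (rule bexp_mono[OF s01])
      fix G
      have "P (F \<union> G) \<le> P (C \<union> G)" using that by (intro monoD[OF P]) auto
      then show "?h (F \<union> G) \<le> ?h (C \<union> G)" by auto
    qed
    then show ?thesis using not unfolding m_def D_def by simp
  qed
  then have "bexp s C (\<lambda>F. \<eta> * m F) \<le> bexp s C (\<lambda>F. m F - (m F)\<^sup>2)"
    using m0 mult_right_mono[of "m F" "1 - \<eta>" "m F" for F]
    by (intro bexp_mono[OF s01]) (fastforce simp: power2_eq_square algebra_simps)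
  then have "\<eta> * bexp s C m \<le> bexp s I ?h - bexp s C (\<lambda>F. (m F)\<^sup>2)"
    unfolding Em by (simp add: bexp_cmult bexp_diff)
  moreover have "\<eta> * \<gamma> \<le> \<eta> * bexp s C m" using \<gamma> \<eta> unfolding Em by simp
  moreover have "0 \<le> ln (1 / \<tau>)" using \<tau> by simp
  ultimately have "\<eta> * \<gamma> * (ln (1 / \<tau>) + 1) \<le> 3 * K"
    using V mult_right_mono[of "\<eta> * \<gamma>" "bexp s I ?h - bexp s C (\<lambda>F. (m F)\<^sup>2)" "ln (1 / \<tau>) + 1"] by linarith
  then show False using large by (simp add: algebra_simps)
qed

section \<open>Cross-intersecting families\<close>

lemma bexp_ge_empty:
  assumes "finite C" "0 \<le> s" "s \<le> 1" "\<And>F. F \<subseteq> C \<Longrightarrow> 0 \<le> f F"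
  shows "(1 - s) ^ card C * f {} \<le> bexp s C f"
proof -
  let ?w = "\<lambda>F. s ^ card F * (1 - s) ^ card (C - F) * f F"
  have "?w {} \<le> sum ?w (Pow C)" using assms by (intro member_le_sum) auto
  then show ?thesis unfolding bexp_def by simp
qed

text \<open>The coordinates of \<open>C\<close> are removed one by one. Those already removed are
  all absent with probability at least \<open>1 / 2 ^ card C\<close>, so restricting to their
  absence multiplies an influence by at most \<open>2 ^ card C\<close>.\<close>

lemma bexp_restrict_to_zero:
  assumes "finite I" "C \<subseteq> I" "mono Q" "0 \<le> s" "s \<le> 1/2" "0 \<le> \<tau>"
    and "\<And>i. i \<in> C \<Longrightarrow> infl s I Q i \<le> \<tau>"
  shows "bexp s I (\<lambda>F. of_bool (Q F)) \<le> bexp s (I - C) (\<lambda>F. of_bool (Q F)) + real (card C) * \<tau> * 2 ^ card C"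
proof -
  have "finite C" using assms(1,2) finite_subset by blast
  then show ?thesis using assms(2,7)
  proof (induction C rule: finite_induct)
    case empty
    then show ?case by simp
  next
    case (insert i C)
    define J where "J = I - insert i C"
    define \<delta> :: "'a set \<Rightarrow> real" where "\<delta> = (\<lambda>F. of_bool (Q (insert i F)) - of_bool (Q F))"
    have J: "finite J" "i \<notin> J" "I - C = insert i J" "I - {i} = C \<union> J" "C \<inter> J = {}"
      using assms(1) insert.prems insert.hyps unfolding J_def by auto
    have s01: "0 \<le> s" "s \<le> 1" using assms by auto
    have \<delta>0: "0 \<le> \<delta> F" for F
      unfolding \<delta>_def using monoD[OF assms(3), of F "insert i F"] by auto
    have "(1 - s) ^ card C * bexp s J (\<lambda>G. \<delta> ({} \<union> G)) \<le> bexp s C (\<lambda>F. bexp s J (\<lambda>G. \<delta> (F \<union> G)))"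
      using insert.hyps s01 \<delta>0 by (intro bexp_ge_empty bexp_nonneg)
    also have "\<dots> = infl s I Q i"
      unfolding infl_def J(4) \<delta>_def by (rule bexp_Un[symmetric, OF insert.hyps(1) J(1,5)])
    also have "\<dots> \<le> \<tau>" using insert.prems by simp
    finally have le: "(1 - s) ^ card C * bexp s J \<delta> \<le> \<tau>" by simp
    have Jn: "0 \<le> bexp s J \<delta>" using s01 \<delta>0 by (intro bexp_nonneg)
    have "(1/2) ^ card C * bexp s J \<delta> \<le> (1 - s) ^ card C * bexp s J \<delta>"
      using assms Jn by (intro mult_right_mono power_mono) auto
    then have "(1/2) ^ card C * bexp s J \<delta> \<le> \<tau>" using le by linarith
    then have "bexp s J \<delta> \<le> \<tau> * 2 ^ card C" by (simp add: power_divide field_simps)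
    moreover have "s * bexp s J \<delta> \<le> 1 * bexp s J \<delta>" using s01 Jn by (intro mult_right_mono)
    ultimately have a: "s * bexp s J \<delta> \<le> \<tau> * 2 ^ card C" by simp
    have b: "bexp s (I - C) (\<lambda>F. of_bool (Q F)) = bexp s J (\<lambda>F. of_bool (Q F)) + s * bexp s J \<delta>"
      unfolding J(3) \<delta>_def using J by (simp add: bexp_insert bexp_diff algebra_simps)
    have "bexp s I (\<lambda>F. of_bool (Q F)) \<le> bexp s (I - C) (\<lambda>F. of_bool (Q F)) + real (card C) * \<tau> * 2 ^ card C"
      using insert by auto
    then have "bexp s I (\<lambda>F. of_bool (Q F)) \<le> bexp s J (\<lambda>F. of_bool (Q F)) + (1 + real (card C)) * \<tau> * 2 ^ card C"
      using a b by (simp add: algebra_simps)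
    also have "\<dots> \<le> bexp s J (\<lambda>F. of_bool (Q F)) + (1 + real (card C)) * \<tau> * 2 ^ Suc (card C)"
      using assms(6) by (intro add_left_mono mult_left_mono power_increasing) auto
    finally show ?case using insert.hyps by (simp add: J_def)
  qed
qed

text \<open>Complementation preserves the measure of bias \<open>1/2\<close>. Without such a
  \<open>G\<close> the two events would be disjoint after complementing one of them.\<close>

lemma complementary_pair:
  assumes D: "finite D"
    and gt: "1 < bexp (1/2) D (\<lambda>F. of_bool (P F)) + bexp (1/2) D (\<lambda>F. of_bool (Q F))"
  obtains G where "G \<subseteq> D" "P G" "Q (D - G)"
proof (rule ccontr)
  assume "\<not> thesis"
  then have none: "\<forall>G. G \<subseteq> D \<longrightarrow> \<not> (P G \<and> Q (D - G))" using that by blast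
  have w: "(1/2::real) ^ card F * (1 - 1/2) ^ card (D - F) = (1/2) ^ card D" if "F \<subseteq> D" for F
  proof -
    have "card F + card (D - F) = card D" using that D by (metis card_Diff_subset card_mono finite_subset le_add_diff_inverse)
    then show ?thesis by (simp add: power_add[symmetric])
  qed
  have half: "bexp (1/2) D f = (1/2) ^ card D * sum f (Pow D)" for f
    unfolding bexp_def sum_distrib_left by (intro sum.cong refl) (use w in auto)
  have "sum (\<lambda>F. of_bool (Q (D - F)) :: real) (Pow D) = sum (\<lambda>F. of_bool (Q F)) (Pow D)"
    by (rule sum.reindex_bij_witness[of _ "\<lambda>F. D - F" "\<lambda>F. D - F"]) (auto simp: double_diff)
  then have "bexp (1/2) D (\<lambda>F. of_bool (P F)) + bexp (1/2) D (\<lambda>F. of_bool (Q F))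
     = bexp (1/2) D (\<lambda>F. of_bool (P F) + of_bool (Q (D - F)))" unfolding bexp_add by (simp add: half)
  also have "\<dots> \<le> bexp (1/2) D (\<lambda>F. 1)" using none by (intro bexp_mono) (auto simp: of_bool_def)
  finally show False using gt D by (simp add: bexp_const)
qed

text \<open>The roles are asymmetric: only \<open>P\<close> must have bounded total influence at its
  bias, because only the core of \<open>P\<close> is counted. The final \<open>\<tau>\<close> has to
  be much smaller than the level \<open>\<tau>0\<close> that defines the core, since setting up to
  \<open>N\<close> coordinates to zero can magnify influences by \<open>2 ^ N\<close>, and
  \<open>N\<close> depends on \<open>\<tau>0\<close>.\<close>

lemma common_influential_coordinate:
  fixes p \<gamma> :: real
  assumes p: "0 < p" "p < 1/2" and \<gamma>: "0 < \<gamma>"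
  obtains \<tau> where "0 < \<tau>"
    "\<And>(I :: 'a set) P Q s1 s2. finite I \<Longrightarrow> mono P \<Longrightarrow> mono Q \<Longrightarrow> p \<le> s1 \<Longrightarrow> s1 \<le> 1/2 \<Longrightarrow> p \<le> s2 \<Longrightarrow> s2 \<le> 1/2 \<Longrightarrow>
      \<gamma> \<le> bexp p I (\<lambda>F. of_bool (P F)) \<Longrightarrow> \<gamma> \<le> bexp p I (\<lambda>F. of_bool (Q F)) \<Longrightarrow>
      (\<Sum>i\<in>I. infl s1 I P i) \<le> 1 / (1/2 - p) \<Longrightarrow>
      (\<And>F G. F \<subseteq> I \<Longrightarrow> G \<subseteq> I \<Longrightarrow> P F \<Longrightarrow> Q G \<Longrightarrow> F \<inter> G \<noteq> {}) \<Longrightarrow>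
      \<exists>i\<in>I. \<tau> \<le> infl s1 I P i \<and> \<tau> \<le> infl s2 I Q i"
proof -
  define K where "K = 1 / (1/2 - p)"
  \<comment> \<open>With \<open>\<eta> = \<gamma> / 4\<close> this is what
    \<open>influential_core\<close> asks for: \<open>\<gamma>\<close> times
    \<open>\<gamma> / 4\<close> times \<open>ln (1 / \<tau>0)\<close> equals
    \<open>3 * K\<close>.\<close>
  define \<tau>0 where "\<tau>0 = exp (- (12 * K / \<gamma>\<^sup>2))"
  define N where "N = nat \<lceil>K / \<tau>0\<rceil>"
  \<comment> \<open>The second bound limits the loss of \<open>Q\<close> on the core, of at most
    \<open>N\<close> coordinates, to \<open>\<gamma> / 4\<close>. Then the two measures at bias
    \<open>1/2\<close> add up to at least \<open>1 + \<gamma> / 2\<close>.\<close>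
  define \<tau> where "\<tau> = min \<tau>0 (\<gamma> / (4 * (real N + 1) * 2 ^ N))"
  have K: "0 < K" unfolding K_def using p by simp
  have \<tau>0: "0 < \<tau>0" "\<tau>0 \<le> 1" unfolding \<tau>0_def using K \<gamma> by auto
  have \<tau>: "0 < \<tau>" "\<tau> \<le> \<tau>0" "\<tau> \<le> \<gamma> / (4 * (real N + 1) * 2 ^ N)" unfolding \<tau>_def using \<tau>0 \<gamma> by auto
  have "ln (1 / \<tau>0) = 12 * K / \<gamma>\<^sup>2" unfolding \<tau>0_def by (simp add: ln_div)
  then have large: "3 * K < \<gamma> * (\<gamma> / 4) * (1 + ln (1 / \<tau>0))"
    using \<gamma> by (simp add: power2_eq_square field_simps)
  have cancel: "r * (\<gamma> / (4 * r * u)) * u = \<gamma> / 4" if "0 < r" "0 < u" for r u :: real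
    using that by (simp add: field_simps)
  show ?thesis
  proof (rule that[OF \<tau>(1)])
    fix I :: "'a set" and P Q s1 s2
    assume I: "finite I" and mono: "mono P" "mono Q" and s: "p \<le> s1" "s1 \<le> 1/2" "p \<le> s2" "s2 \<le> 1/2"
      and big: "\<gamma> \<le> bexp p I (\<lambda>F. of_bool (P F))" "\<gamma> \<le> bexp p I (\<lambda>F. of_bool (Q F))"
      and tot: "(\<Sum>i\<in>I. infl s1 I P i) \<le> 1 / (1/2 - p)"
      and cross: "\<And>F G. F \<subseteq> I \<Longrightarrow> G \<subseteq> I \<Longrightarrow> P F \<Longrightarrow> Q G \<Longrightarrow> F \<inter> G \<noteq> {}"
    show "\<exists>i\<in>I. \<tau> \<le> infl s1 I P i \<and> \<tau> \<le> infl s2 I Q i"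
    proof (rule ccontr)
      assume none: "\<not> ?thesis"
      define C where "C = {i\<in>I. \<tau>0 \<le> infl s1 I P i}"
      have C: "C \<subseteq> I" "finite C" using I unfolding C_def by auto
      have "real (card C) * \<tau>0 = (\<Sum>i\<in>C. \<tau>0)" by simp
      also have "\<dots> \<le> (\<Sum>i\<in>C. infl s1 I P i)" by (intro sum_mono) (auto simp: C_def)
      also have "\<dots> \<le> (\<Sum>i\<in>I. infl s1 I P i)" using I C s p mono by (intro sum_mono2 infl_nonneg) auto
      finally have "real (card C) * \<tau>0 \<le> K" using tot unfolding K_def by simp
      then have "real (card C) \<le> K / \<tau>0" using \<tau>0 by (simp add: field_simps)
      then have cardC: "card C \<le> N" unfolding N_def by linarith
      have "1 - \<gamma> / 4 \<le> bexp s1 (I - C) (\<lambda>G. of_bool (P (C \<union> G)))"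
        unfolding C_def
      proof (rule influential_core[OF I mono(1) _ s(2) tot \<tau>0])
        show "\<gamma> \<le> bexp s1 I (\<lambda>F. of_bool (P F))"
          using big(1) bexp_mono_bias[OF I mono(1), of p s1] p s by simp
      qed (use p s \<gamma> large in \<open>auto simp: K_def\<close>)
      also have "\<dots> \<le> bexp (1/2) (I - C) (\<lambda>G. of_bool (P (C \<union> G)))"
      proof (rule bexp_mono_bias)
        show "mono (\<lambda>G. P (C \<union> G))"
        proof (rule monoI)
          fix x y :: "'a set" assume "x \<le> y"
          then have "C \<union> x \<le> C \<union> y" by auto
          then show "P (C \<union> x) \<le> P (C \<union> y)" by (rule monoD[OF mono(1)])
        qed
      qed (use I p s in auto)
      finally have PC: "1 - \<gamma> / 4 \<le> bexp (1/2) (I - C) (\<lambda>G. of_bool (P (C \<union> G)))" .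
      have "\<gamma> \<le> bexp s2 I (\<lambda>F. of_bool (Q F))"
        using big(2) bexp_mono_bias[OF I mono(2), of p s2] p s by simp
      also have "\<dots> \<le> bexp s2 (I - C) (\<lambda>F. of_bool (Q F)) + real (card C) * \<tau> * 2 ^ card C"
      proof (rule bexp_restrict_to_zero[OF I C(1) mono(2)])
        fix i assume "i \<in> C"
        then have "i \<in> I" "\<tau> \<le> infl s1 I P i" using \<tau>(2) unfolding C_def by auto
        then show "infl s2 I Q i \<le> \<tau>" using none by force
      qed (use p s \<tau> in auto)
      also have "real (card C) * \<tau> * 2 ^ card C \<le> (real N + 1) * (\<gamma> / (4 * (real N + 1) * 2 ^ N)) * 2 ^ N"
        using cardC \<tau> \<gamma> by (intro mult_mono power_increasing) auto
      also have "\<dots> = \<gamma> / 4"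
        using cancel[of "real N + 1" "2 ^ N"] by simp
      also have "bexp s2 (I - C) (\<lambda>F. of_bool (Q F)) \<le> bexp (1/2) (I - C) (\<lambda>F. of_bool (Q F))"
        using I s p by (intro bexp_mono_bias mono) auto
      finally have QC: "\<gamma> \<le> bexp (1/2) (I - C) (\<lambda>F. of_bool (Q F)) + \<gamma> / 4" by simp
      have "finite (I - C)" using I by simp
      moreover have "1 < bexp (1/2) (I - C) (\<lambda>G. of_bool (P (C \<union> G))) + bexp (1/2) (I - C) (\<lambda>F. of_bool (Q F))"
        using PC QC \<gamma> by linarith
      ultimately obtain G where G: "G \<subseteq> I - C" "P (C \<union> G)" "Q (I - C - G)"
        by (rule complementary_pair)
      have "(C \<union> G) \<inter> (I - C - G) \<noteq> {}" using C G by (intro cross) auto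
      then show False by auto
    qed
  qed
qed

section \<open>Composition of polynomial-time machines\<close>

abbreviation sym :: "tape \<Rightarrow> nat" where
  "sym t \<equiv> fst t (snd t)"

lemma act_keep [simp]: "act (sym t, Stay) t = t"
  by (simp add: act_def)

lemma map2_act_keep [simp]: "map2 act (map (\<lambda>s. (s, Stay)) (map sym ts)) ts = ts"
  by (induction ts) simp_all

definition good_config :: "tm \<Rightarrow> config \<Rightarrow> bool" where
  "good_config M c \<longleftrightarrow> fst c \<le> nstates M \<and> length (snd c) = ntapes M \<and>
     (\<forall>t\<in>set (snd c). \<forall>i. fst t i < nsyms M)"

lemma good_config_reads:
  "good_config M c \<Longrightarrow> length (map sym (snd c)) = ntapes M \<and> set (map sym (snd c)) \<subseteq> {..<nsyms M}"
  by (auto simp: good_config_def)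

lemma map2_act_bounded:
  assumes "\<forall>t\<in>set ts. \<forall>i. fst t i < S" "fst ` set as \<subseteq> {..<S}" "t \<in> set (map2 act as ts)"
  shows "fst t i < S"
proof -
  obtain a u where "(a, u) \<in> set (zip as ts)" "t = act a u" using assms(3) by auto
  then have "a \<in> set as" "u \<in> set ts" "t = act a u" by (auto dest: set_zip_leftD set_zip_rightD)
  then show ?thesis using assms(1,2) by (auto simp: act_def)
qed

lemma tm_step_running:
  "fst c < nstates M \<Longrightarrow> tm_step M c = (fst (delta M (fst c) (map sym (snd c))),
     map2 act (snd (delta M (fst c) (map sym (snd c)))) (snd c))"
  by (simp add: tm_step_def Let_def)

lemma tm_step_halted: "\<not> fst c < nstates M \<Longrightarrow> tm_step M c = c"
  by (simp add: tm_step_def)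

lemma good_config_step:
  assumes "wf_tm M" "good_config M c"
  shows "good_config M (tm_step M c)"
proof (cases "fst c < nstates M")
  case True
  let ?ss = "map sym (snd c)"
  have d: "fst (delta M (fst c) ?ss) \<le> nstates M" "length (snd (delta M (fst c) ?ss)) = ntapes M"
    "fst ` set (snd (delta M (fst c) ?ss)) \<subseteq> {..<nsyms M}"
    using assms(1) True good_config_reads[OF assms(2)] unfolding wf_tm_def by blast+
  have "\<forall>t\<in>set (snd c). \<forall>i. fst t i < nsyms M" "length (snd c) = ntapes M"
    using assms(2) unfolding good_config_def by auto
  then show ?thesis
    using d map2_act_bounded[OF _ d(3)] True unfolding good_config_def tm_step_def Let_def by auto
qed (use assms in \<open>simp add: tm_step_def\<close>)

lemma contents_lt_3: "contents w i < 3"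
  by (simp add: contents_def)

lemma good_config_init: "wf_tm M \<Longrightarrow> good_config M (init_config M w)"
  using contents_lt_3 unfolding good_config_def init_config_def wf_tm_def
  by (auto intro: less_le_trans)

lemma good_config_run: "wf_tm M \<Longrightarrow> good_config M ((tm_step M ^^ t) (init_config M w))"
  by (induction t) (simp_all add: good_config_init good_config_step)

lemma tm_halted: "fst c = nstates M \<Longrightarrow> (tm_step M ^^ n) c = c"
  by (induction n) (simp_all add: tm_step_def)

lemma tm_outputs_within_mono:
  assumes "tm_outputs_within M w t v" "t \<le> t'"
  shows "tm_outputs_within M w t' v"
proof -
  have "(tm_step M ^^ t') c = (tm_step M ^^ (t' - t)) ((tm_step M ^^ t) c)" for c
    using assms(2) by (metis comp_apply funpow_add le_add_diff_inverse2)
  then show ?thesis using assms(1) tm_halted unfolding tm_outputs_within_def Let_def by metis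
qed

lemma abs_shift_le: "\<bar>shift d\<bar> \<le> 1"
  by (cases d) auto

text \<open>Writing precedes moving, so after \<open>t\<close> steps cells at distance
  \<open>t\<close> are still blank although the head may stand there. This bounds both the length of
  an output and the time to return to its origin.\<close>

lemma run_tape1_bounds:
  fixes w :: "bool list"
  assumes "wf_tm M"
  defines "u t \<equiv> snd ((tm_step M ^^ t) (init_config M w)) ! 1"
  shows "\<bar>snd (u t)\<bar> \<le> int t \<and> (\<forall>i. int t \<le> \<bar>i\<bar> \<longrightarrow> fst (u t) i = 0)"
proof (induction t)
  case 0
  have "ntapes M \<ge> 2" using assms(1) by (simp add: wf_tm_def)
  then have "u 0 = (contents [], 0)" unfolding u_def init_config_def by (simp add: nth_Cons')
  then show ?case by (simp add: contents_def)
next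
  case (Suc t)
  define c where "c = (tm_step M ^^ t) (init_config M w)"
  have g: "good_config M c" unfolding c_def using assms(1) by (rule good_config_run)
  show ?case
  proof (cases "fst c < nstates M")
    case True
    define r where "r = delta M (fst c) (map sym (snd c))"
    have "length (snd r) = ntapes M" "ntapes M \<ge> 2" "length (snd c) = ntapes M"
      using assms(1) True good_config_reads[OF g] g unfolding wf_tm_def r_def good_config_def by blast+
    then have "u (Suc t) = act (snd r ! 1) (u t)"
      unfolding u_def funpow.simps comp_def c_def[symmetric] tm_step_running[OF True] r_def[symmetric]
      by simp
    then show ?thesis using Suc abs_shift_le[of "snd (snd r ! 1)"] by (auto simp: act_def)
  next
    case False
    then have "u (Suc t) = u t" unfolding u_def c_def by (simp add: tm_step_halted)
    then show ?thesis using Suc by auto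
  qed
qed

lemma output_length_le:
  assumes "wf_tm M" "tm_outputs_within M w t v"
  shows "length v \<le> t"
proof (cases v)
  case (Cons a v')
  have "contents v (int (length v) - 1) \<noteq> 0"
    using Cons by (simp add: contents_def nat_diff_distrib)
  then have "\<not> int t \<le> \<bar>int (length v) - 1\<bar>"
    using run_tape1_bounds[OF assms(1), where w = w and t = t] assms(2) unfolding tm_outputs_within_def Let_def by metis
  then show ?thesis using Cons by simp
qed simp

section \<open>Machines with an arbitrary finite set of states\<close>

definition astep :: "'q \<Rightarrow> ('q \<Rightarrow> nat list \<Rightarrow> 'q \<times> (nat \<times> direction) list) \<Rightarrow> 'q \<times> tape list \<Rightarrow> 'q \<times> tape list" where
  "astep qh dl c = (if fst c = qh then c
     else (fst (dl (fst c) (map sym (snd c))), map2 act (snd (dl (fst c) (map sym (snd c)))) (snd c)))"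

definition init_tapes :: "nat \<Rightarrow> bool list \<Rightarrow> tape list" where
  "init_tapes K w = (contents w, 0) # replicate (K - 1) (contents [], 0)"

lemma astep_halted: "fst c = qh \<Longrightarrow> astep qh dl c = c"
  by (simp add: astep_def)

lemma astep_running: "fst c \<noteq> qh \<Longrightarrow> astep qh dl c =
    (fst (dl (fst c) (map sym (snd c))), map2 act (snd (dl (fst c) (map sym (snd c)))) (snd c))"
  by (simp add: astep_def)

text \<open>Structured states, such as program continuations, are numbered only here. The numbering
  must send \<open>q0\<close> to \<open>0\<close> and \<open>qh\<close> to the last number, the two
  states singled out by the machine model; the others are arbitrary.\<close>

lemma finite_state_machine_to_tm:
  fixes Q :: "'q set"
  assumes fin: "finite Q" and q: "q0 \<in> Q" "qh \<in> Q" "q0 \<noteq> qh" and K: "2 \<le> K" and S: "3 \<le> S"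
    and wf: "\<And>q ss. q \<in> Q \<Longrightarrow> q \<noteq> qh \<Longrightarrow> length ss = K \<Longrightarrow> set ss \<subseteq> {..<S} \<Longrightarrow>
        fst (dl q ss) \<in> Q \<and> length (snd (dl q ss)) = K \<and> fst ` set (snd (dl q ss)) \<subseteq> {..<S}"
  obtains M where "wf_tm M"
    "\<And>w t ts v. (astep qh dl ^^ t) (q0, init_tapes K w) = (qh, ts) \<Longrightarrow> fst (ts ! 1) = contents v \<Longrightarrow>
        tm_outputs_within M w t v"
proof -
  define n where "n = card Q - 1"
  have "card {q0, qh} \<le> card Q" using q fin by (intro card_mono) auto
  then have c2: "2 \<le> card Q" using q by simp
  have "card (Q - {q0, qh}) = card {1..<n}" using q fin c2 by (simp add: n_def card_Diff_subset)
  then obtain h0 where h0: "bij_betw h0 (Q - {q0, qh}) {1..<n}"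
    using fin by (meson finite_Diff finite_atLeastLessThan finite_same_card_bij)
  define h where "h = (\<lambda>x. if x = q0 then 0 else if x = qh then n else h0 x)"
  have h_simps: "h q0 = 0" "h qh = n" using q by (auto simp: h_def)
  have rng: "x \<in> Q \<Longrightarrow> x \<noteq> q0 \<Longrightarrow> x \<noteq> qh \<Longrightarrow> 1 \<le> h x \<and> h x < n" for x
    using bij_betwE[OF h0] by (force simp: h_def)
  have n1: "1 \<le> n" using c2 by (simp add: n_def)
  have inj: "inj_on h Q"
  proof (rule inj_onI)
    fix x y assume xy: "x \<in> Q" "y \<in> Q" "h x = h y"
    have "h0 x = h0 y \<Longrightarrow> x \<in> Q - {q0, qh} \<Longrightarrow> y \<in> Q - {q0, qh} \<Longrightarrow> x = y"
      using h0 by (auto simp: bij_betw_def dest: inj_onD)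
    then show "x = y" using xy rng[of x] rng[of y] n1 h_simps
      by (cases "x = q0"; cases "x = qh"; cases "y = q0"; cases "y = qh") (auto simp: h_def)
  qed
  have hle: "x \<in> Q \<Longrightarrow> h x \<le> n" for x using rng[of x] h_simps by (cases "x = q0"; cases "x = qh") auto
  have hlt: "x \<in> Q \<Longrightarrow> x \<noteq> qh \<Longrightarrow> h x < n" for x
    using rng[of x] h_simps n1 by (cases "x = q0") auto
  have img: "h ` Q = {..n}"
  proof (rule card_subset_eq)
    show "card (h ` Q) = card {..n}" using card_image[OF inj] c2 by (simp add: n_def)
  qed (use hle in auto)
  define g where "g = inv_into Q h"
  have gh: "x \<in> Q \<Longrightarrow> g (h x) = x" for x unfolding g_def using inj by simp
  have gq: "m < n \<Longrightarrow> g m \<in> Q \<and> g m \<noteq> qh" for m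
    unfolding g_def using img h_simps by (metis atMost_iff f_inv_into_f inv_into_into less_imp_le nat_less_le)
  define M where "M = \<lparr>ntapes = K, nsyms = S, nstates = n,
     delta = (\<lambda>m ss. (h (fst (dl (g m) ss)), snd (dl (g m) ss)))\<rparr>"
  have M_simps: "ntapes M = K" "nsyms M = S" "nstates M = n"
    "delta M m ss = (h (fst (dl (g m) ss)), snd (dl (g m) ss))" for m ss by (simp_all add: M_def)
  have wfM: "wf_tm M"
    unfolding wf_tm_def M_simps using K S wf gq hle by fastforce
  have sim: "\<exists>q ts. (astep qh dl ^^ t) (q0, init_tapes K w) = (q, ts) \<and> q \<in> Q \<and>
      (tm_step M ^^ t) (init_config M w) = (h q, ts)" for t w
  proof (induction t)
    case 0
    then show ?case using q by (simp add: init_tapes_def init_config_def M_simps h_simps)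
  next
    case (Suc t)
    then obtain p ts where p: "(astep qh dl ^^ t) (q0, init_tapes K w) = (p, ts)" "p \<in> Q"
      "(tm_step M ^^ t) (init_config M w) = (h p, ts)" by blast
    have g: "good_config M (h p, ts)" using good_config_run[OF wfM, of t w] p(3) by simp
    show ?case
    proof (cases "p = qh")
      case True
      then show ?thesis using p q by (simp add: astep_halted tm_step_halted M_simps h_simps)
    next
      case False
      have "length (map sym ts) = K" "set (map sym ts) \<subseteq> {..<S}" using good_config_reads[OF g] by (simp_all add: M_simps)
      then have "fst (dl p (map sym ts)) \<in> Q" using wf[OF p(2) False] by blast
      then show ?thesis using p False hlt[OF p(2) False] gh[OF p(2)]
        by (simp add: astep_running tm_step_running M_simps)
    qed
  qed
  show thesis
  proof (rule that[OF wfM])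
    fix w t ts v assume a: "(astep qh dl ^^ t) (q0, init_tapes K w) = (qh, ts)" "fst (ts ! 1) = contents v"
    then have "(tm_step M ^^ t) (init_config M w) = (n, ts)" using sim[of t w] h_simps by auto
    then show "tm_outputs_within M w t v" using a by (simp add: tm_outputs_within_def M_simps)
  qed
qed

section \<open>Sequential composition of two machines\<close>

datatype comp_state = Start | Run1 nat bool | Run2 nat

text \<open>
  The tapes are arranged as \<open>a0 # b1 # a1 # x # as @ bs\<close>, where the first machine works on
  \<open>a0 # a1 # as\<close> and the second one on \<open>a1 # b1 # bs\<close>. The head of \<open>x\<close> follows that of \<open>a1\<close>; with its
  mark at the origin and the sign kept in \<open>Run1\<close> the head of \<open>a1\<close> finds its way back to the origin.
\<close>

definition keep :: "nat list \<Rightarrow> (nat \<times> direction) list" where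
  "keep ss = map (\<lambda>s. (s, Stay)) ss"

lemma keep_simps [simp]: "length (keep ss) = length ss" "fst ` set (keep ss) = set ss"
  by (force simp: keep_def)+

lemma map2_act_keep' [simp]: "map2 act (keep (map sym ts)) ts = ts"
  unfolding keep_def by (rule map2_act_keep)

definition comp_delta :: "tm \<Rightarrow> tm \<Rightarrow> comp_state \<Rightarrow> nat list \<Rightarrow> comp_state \<times> (nat \<times> direction) list" where
  "comp_delta M1 M2 q ss =
    (let s0 = ss ! 0; sb = ss ! 1; s1 = ss ! 2; sx = ss ! 3;
         as = take (ntapes M1 - 2) (drop 4 ss); bs = drop (ntapes M1 - 2) (drop 4 ss);
         halt = (Run2 (nstates M2), keep ss)
     in case q of
       Start \<Rightarrow> (Run1 0 True, [(s0, Stay), (sb, Stay), (s1, Stay), (1, Stay)] @ keep (drop 4 ss))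
     | Run1 p b \<Rightarrow>
         if p < nstates M1 then
           if set (s0 # s1 # as) \<subseteq> {..<nsyms M1} then
             let r = delta M1 p (s0 # s1 # as); x = snd r
             in (Run1 (fst r) (if sx = 1 then snd (x ! 1) = Rgt else b),
                 [x ! 0, (sb, Stay), x ! 1, (sx, snd (x ! 1))] @ drop 2 x @ keep bs)
           else halt
         else if sx = 1 then (Run2 0, keep ss)
         else (Run1 p b, [(s0, Stay), (sb, Stay), (s1, if b then Lft else Rgt), (sx, if b then Lft else Rgt)] @ keep (drop 4 ss))
     | Run2 p \<Rightarrow>
         if set (s1 # sb # bs) \<subseteq> {..<nsyms M2} then
           let r = delta M2 p (s1 # sb # bs); x = snd r
           in (Run2 (fst r), [(s0, Stay), x ! 1, x ! 0, (sx, Stay)] @ keep as @ drop 2 x)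
         else halt)"

lemma list_split_2: "2 \<le> length xs \<Longrightarrow> xs = xs ! 0 # xs ! 1 # drop 2 xs"
  by (metis Cons_nth_drop_Suc One_nat_def Suc_1 Suc_le_lessD drop0 le_less_trans less_numeral_extra(1) less_or_eq_imp_le not_less_eq_eq numeral_2_eq_2 zero_less_Suc)

lemma list_split_4: "4 \<le> length xs \<Longrightarrow> xs = xs ! 0 # xs ! 1 # xs ! 2 # xs ! 3 # drop 4 xs"
  by (auto simp: numeral_eq_Suc Suc_le_length_iff)

text \<open>Well-formedness concerns all tuples over the larger of the two alphabets. This is why
  \<open>comp_delta\<close> halts on a symbol foreign to the machine being simulated, which does not
  occur in a genuine run.\<close>

lemma comp_delta_wf:
  assumes wf: "wf_tm M1" "wf_tm M2"
  defines "Q \<equiv> insert Start ((\<lambda>(p, b). Run1 p b) ` ({..nstates M1} \<times> UNIV) \<union> Run2 ` {..nstates M2})"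
    and "S \<equiv> max (nsyms M1) (nsyms M2)"
  assumes q: "q \<in> Q" "q \<noteq> Run2 (nstates M2)" and ss: "length ss = ntapes M1 + ntapes M2" "set ss \<subseteq> {..<S}"
  shows "fst (comp_delta M1 M2 q ss) \<in> Q \<and> length (snd (comp_delta M1 M2 q ss)) = ntapes M1 + ntapes M2
     \<and> fst ` set (snd (comp_delta M1 M2 q ss)) \<subseteq> {..<S}"
proof -
  have k: "2 \<le> ntapes M1" "2 \<le> ntapes M2" "3 \<le> nsyms M1" "3 \<le> nsyms M2" using wf by (auto simp: wf_tm_def)
  define as bs where "as = take (ntapes M1 - 2) (drop 4 ss)" and "bs = drop (ntapes M1 - 2) (drop 4 ss)"
  obtain s0 sb s1 sx where ss_eq: "ss = s0 # sb # s1 # sx # as @ bs"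
    using list_split_4[of ss] ss k unfolding as_def bs_def append_take_drop_id by (metis add_mono numeral_Bit0)
  have len: "length as = ntapes M1 - 2" "length bs = ntapes M2 - 2"
    using ss k unfolding as_def bs_def by auto
  have d4: "drop 4 ss = as @ bs" unfolding as_def bs_def by (rule append_take_drop_id[symmetric])
  have in_S: "s0 < S" "sb < S" "s1 < S" "sx < S" "set as \<subseteq> {..<S}" "set bs \<subseteq> {..<S}" "1 < S" "0 < S"
    using ss(2) k unfolding ss_eq S_def by auto
  have lens: "length ss = 4 + length as + length bs" unfolding ss_eq by simp
  have ln: "4 + length as + length bs = ntapes M1 + ntapes M2" using len k by simp
  have halt: "Run2 (nstates M2) \<in> Q" "Run2 0 \<in> Q" unfolding Q_def by auto
  have nth: "ss ! 0 = s0" "ss ! 1 = sb" "ss ! 2 = s1" "ss ! 3 = sx" by (simp_all add: ss_eq)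
  note cd = comp_delta_def[of M1 M2 _ ss, folded as_def bs_def, unfolded nth d4 Let_def]
  show ?thesis
  proof (cases q)
    case Start
    then show ?thesis using in_S ln by (auto simp: image_Un cd Q_def)
  next
    case (Run2 p)
    then have p: "p < nstates M2" using q unfolding Q_def by auto
    show ?thesis
    proof (cases "set (s1 # sb # bs) \<subseteq> {..<nsyms M2}")
      case True
      define r where "r = delta M2 p (s1 # sb # bs)"
      have "length (s1 # sb # bs) = ntapes M2" using len k by simp
      then have r: "fst r \<le> nstates M2" "length (snd r) = ntapes M2" "fst ` set (snd r) \<subseteq> {..<nsyms M2}"
        using wf(2) p True unfolding wf_tm_def r_def by blast+
      define x0 x1 xs where "x0 = snd r ! 0" and "x1 = snd r ! 1" and "xs = drop 2 (snd r)"
      have x: "snd r = x0 # x1 # xs" using list_split_2[of "snd r"] r k unfolding x0_def x1_def xs_def by auto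
      have "fst ` set (x0 # x1 # xs) \<subseteq> {..<S}" "length xs = length bs" using r x len k unfolding S_def by auto
      then show ?thesis using Run2 True r in_S ln
        by (auto simp: image_Un cd Q_def r_def[symmetric] x)
    next
      case False
      then show ?thesis using Run2 halt ss by (auto simp: cd)
    qed
  next
    case (Run1 p b)
    then have p: "p \<le> nstates M1" using q unfolding Q_def by auto
    show ?thesis
    proof (cases "p < nstates M1")
      case True
      show ?thesis
      proof (cases "set (s0 # s1 # as) \<subseteq> {..<nsyms M1}")
        case t: True
        define r where "r = delta M1 p (s0 # s1 # as)"
        have "length (s0 # s1 # as) = ntapes M1" using len k by simp
        then have r: "fst r \<le> nstates M1" "length (snd r) = ntapes M1" "fst ` set (snd r) \<subseteq> {..<nsyms M1}"
          using wf(1) True t unfolding wf_tm_def r_def by blast+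
        define x0 x1 xs where "x0 = snd r ! 0" and "x1 = snd r ! 1" and "xs = drop 2 (snd r)"
        have x: "snd r = x0 # x1 # xs" using list_split_2[of "snd r"] r k unfolding x0_def x1_def xs_def by auto
        have "fst ` set (x0 # x1 # xs) \<subseteq> {..<S}" "length xs = length as" using r x len k unfolding S_def by auto
        then show ?thesis using Run1 True t r in_S ln
          by (auto simp: image_Un cd Q_def r_def[symmetric] x)
      next
        case False
        then show ?thesis using Run1 True halt ss by (auto simp: cd)
      qed
    next
      case False
      show ?thesis
      proof (cases "sx = 1")
        case t: True
        then show ?thesis using Run1 False halt ss by (simp add: cd)
      next
        case f: False
        then show ?thesis using Run1 False p in_S ln by (auto simp: image_Un cd Q_def)
      qed
    qed
  qed
qed

definition emb1 :: "bool \<Rightarrow> tape \<Rightarrow> tape list \<Rightarrow> config \<Rightarrow> comp_state \<times> tape list" where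
  "emb1 b b1 bs c = (Run1 (fst c) b, snd c ! 0 # b1 # snd c ! 1 # (contents [False], snd (snd c ! 1)) # drop 2 (snd c) @ bs)"

definition emb2 :: "tape \<Rightarrow> tape \<Rightarrow> tape list \<Rightarrow> config \<Rightarrow> comp_state \<times> tape list" where
  "emb2 a0 x as c = (Run2 (fst c), a0 # snd c ! 1 # snd c ! 0 # x # as @ drop 2 (snd c))"

lemma contents_mark: "contents [False] i = (if i = 0 then 1 else 0)"
  by (auto simp: contents_def)

text \<open>The flag tells on which side of the origin the output head is. It is set anew whenever
  the mark is read and has no meaning at the origin, hence the conditional invariant.\<close>

lemma emb1_step:
  assumes wf: "wf_tm M1" and g: "good_config M1 c" and run: "fst c < nstates M1"
    and b: "snd (snd c ! 1) \<noteq> 0 \<Longrightarrow> b = (0 < snd (snd c ! 1))"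
  obtains b' where "astep (Run2 n2) (comp_delta M1 M2) (emb1 b b1 bs c) = emb1 b' b1 bs (tm_step M1 c)"
    "snd (snd (tm_step M1 c) ! 1) \<noteq> 0 \<Longrightarrow> b' = (0 < snd (snd (tm_step M1 c) ! 1))"
proof -
  have k: "2 \<le> ntapes M1" using wf by (auto simp: wf_tm_def)
  define a0 a1 as where "a0 = snd c ! 0" and "a1 = snd c ! 1" and "as = drop 2 (snd c)"
  have len: "length (snd c) = ntapes M1" using g by (simp add: good_config_def)
  have c: "snd c = a0 # a1 # as" using list_split_2[of "snd c"] len k unfolding a0_def a1_def as_def by auto
  define r where "r = delta M1 (fst c) (map sym (snd c))"
  have rd: "length (map sym (snd c)) = ntapes M1" "set (map sym (snd c)) \<subseteq> {..<nsyms M1}"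
    using good_config_reads[OF g] by auto
  have r: "length (snd r) = ntapes M1" using wf run rd unfolding wf_tm_def r_def by blast
  define x0 x1 xs where "x0 = snd r ! 0" and "x1 = snd r ! 1" and "xs = drop 2 (snd r)"
  have x: "snd r = x0 # x1 # xs" using list_split_2[of "snd r"] r k unfolding x0_def x1_def xs_def by auto
  have las: "length as = ntapes M1 - 2" "length xs = length as" using len c r x by auto
  define b' where "b' = (if snd a1 = 0 then snd x1 = Rgt else b)"
  have st: "tm_step M1 c = (fst r, act x0 a0 # act x1 a1 # map2 act xs as)"
    unfolding tm_step_running[OF run] r_def[symmetric] unfolding x c by simp
  have act_mark: "act (contents [False] (snd a1), snd x1) (contents [False], snd a1) = (contents [False], snd (act x1 a1))"
    by (simp add: act_def)
  have "astep (Run2 n2) (comp_delta M1 M2) (emb1 b b1 bs c) = emb1 b' b1 bs (tm_step M1 c)"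
  proof -
    let ?ts = "a0 # b1 # a1 # (contents [False], snd a1) # as @ bs"
    have e: "emb1 b b1 bs c = (Run1 (fst c) b, ?ts)" unfolding emb1_def c by simp
    have cd: "comp_delta M1 M2 (Run1 (fst c) b) (map sym ?ts) =
       (Run1 (fst r) b', [x0, (sym b1, Stay), x1, (contents [False] (snd a1), snd x1)] @ xs @ keep (map sym bs))"
      using run rd(2) las x unfolding comp_delta_def b'_def r_def c
      by (cases "snd a1 = 0") (simp_all add: Let_def contents_mark)
    show ?thesis
      unfolding e astep_def using las by (simp add: cd[simplified] emb1_def st act_mark)
  qed
  moreover have "snd (act x1 a1) \<noteq> 0 \<Longrightarrow> b' = (0 < snd (act x1 a1))"
    using b unfolding b'_def c by (cases "snd x1") (auto simp: act_def)
  ultimately show ?thesis using that st by simp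
qed

lemma emb2_step:
  assumes wf: "wf_tm M2" and g: "good_config M2 c" and las: "length as = ntapes M1 - 2"
  shows "astep (Run2 (nstates M2)) (comp_delta M1 M2) (emb2 a0 x as c) = emb2 a0 x as (tm_step M2 c)"
proof (cases "fst c < nstates M2")
  case False
  then have "fst c = nstates M2" using g by (simp add: good_config_def)
  then show ?thesis by (simp add: astep_def emb2_def tm_step_def)
next
  case run: True
  have k: "2 \<le> ntapes M2" using wf by (auto simp: wf_tm_def)
  define t0 t1 bs where "t0 = snd c ! 0" and "t1 = snd c ! 1" and "bs = drop 2 (snd c)"
  have len: "length (snd c) = ntapes M2" using g by (simp add: good_config_def)
  have c: "snd c = t0 # t1 # bs" using list_split_2[of "snd c"] len k unfolding t0_def t1_def bs_def by auto
  define r where "r = delta M2 (fst c) (map sym (snd c))"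
  have rd: "length (map sym (snd c)) = ntapes M2" "set (map sym (snd c)) \<subseteq> {..<nsyms M2}"
    using good_config_reads[OF g] by auto
  have r: "length (snd r) = ntapes M2" using wf run rd unfolding wf_tm_def r_def by blast
  define x0 x1 xs where "x0 = snd r ! 0" and "x1 = snd r ! 1" and "xs = drop 2 (snd r)"
  have x: "snd r = x0 # x1 # xs" using list_split_2[of "snd r"] r k unfolding x0_def x1_def xs_def by auto
  have st: "tm_step M2 c = (fst r, act x0 t0 # act x1 t1 # map2 act xs bs)"
    unfolding tm_step_running[OF run] r_def[symmetric] unfolding x c by simp
  let ?ts = "a0 # t1 # t0 # x # as @ bs"
  have e: "emb2 a0 x as c = (Run2 (fst c), ?ts)" unfolding emb2_def c by simp
  have cd: "comp_delta M1 M2 (Run2 (fst c)) (map sym ?ts) =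
     (Run2 (fst r), [(sym a0, Stay), x1, x0, (sym x, Stay)] @ keep (map sym as) @ xs)"
    using rd(2) las x unfolding comp_delta_def r_def c by (simp add: Let_def)
  show ?thesis
    unfolding e astep_def using run by (simp add: cd[simplified] emb2_def st)
qed

text \<open>The flag points the head back to the origin; the one step more than the distance reads
  the mark and enters the second phase.\<close>

lemma comp_rewind:
  assumes "snd a1 \<noteq> 0 \<Longrightarrow> b = (0 < snd a1)"
  shows "(astep (Run2 n2) (comp_delta M1 M2) ^^ Suc (nat \<bar>snd a1\<bar>))
      (Run1 (nstates M1) b, a0 # b1 # a1 # (contents [False], snd a1) # ts)
    = (Run2 0, a0 # b1 # (fst a1, 0) # (contents [False], 0) # ts)"
  using assms
proof (induction "nat \<bar>snd a1\<bar>" arbitrary: a1)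
  case 0
  then have "a1 = (fst a1, 0)" by (cases a1) auto
  then obtain h where a1: "a1 = (h, 0)" by blast
  have "comp_delta M1 M2 (Run1 (nstates M1) b) (map sym (a0 # b1 # a1 # (contents [False], snd a1) # ts))
     = (Run2 0, keep (map sym (a0 # b1 # a1 # (contents [False], snd a1) # ts)))"
    by (simp add: comp_delta_def a1 contents_mark Let_def)
  then have "astep (Run2 n2) (comp_delta M1 M2) (Run1 (nstates M1) b, a0 # b1 # a1 # (contents [False], snd a1) # ts)
     = (Run2 0, a0 # b1 # a1 # (contents [False], snd a1) # ts)"
    by (subst astep_running) (simp_all only: fst_conv snd_conv map2_act_keep' comp_state.distinct simp_thms not_False_eq_True)
  then show ?case using a1 by simp
next
  case (Suc n)
  let ?d = "if b then Lft else Rgt"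
  let ?a = "act (sym a1, ?d) a1"
  have nz: "snd a1 \<noteq> 0" using Suc.hyps by auto
  have b: "b = (0 < snd a1)" using Suc.prems nz by blast
  have a: "fst ?a = fst a1" "n = nat \<bar>snd ?a\<bar>" "snd ?a \<noteq> 0 \<Longrightarrow> b = (0 < snd ?a)"
    using Suc.hyps nz b by (auto simp: act_def)
  have mark: "act (0, ?d) (contents [False], snd a1) = (contents [False], snd ?a)"
    using nz by (auto simp: act_def contents_mark)
  have "comp_delta M1 M2 (Run1 (nstates M1) b) (map sym (a0 # b1 # a1 # (contents [False], snd a1) # ts))
     = (Run1 (nstates M1) b, [(sym a0, Stay), (sym b1, Stay), (sym a1, ?d), (0, ?d)] @ keep (map sym ts))"
    using nz by (simp add: comp_delta_def contents_mark Let_def)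
  then have "astep (Run2 n2) (comp_delta M1 M2) (Run1 (nstates M1) b, a0 # b1 # a1 # (contents [False], snd a1) # ts)
     = (Run1 (nstates M1) b, map2 act ([(sym a0, Stay), (sym b1, Stay), (sym a1, ?d), (0, ?d)] @ keep (map sym ts))
          (a0 # b1 # a1 # (contents [False], snd a1) # ts))"
    by (subst astep_running) (simp_all only: fst_conv snd_conv comp_state.distinct simp_thms not_False_eq_True)
  also have "\<dots> = (Run1 (nstates M1) b, a0 # b1 # ?a # (contents [False], snd ?a) # ts)"
    using mark by simp
  finally have step: "astep (Run2 n2) (comp_delta M1 M2) (Run1 (nstates M1) b, a0 # b1 # a1 # (contents [False], snd a1) # ts)
     = (Run1 (nstates M1) b, a0 # b1 # ?a # (contents [False], snd ?a) # ts)" .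
  have "(astep (Run2 n2) (comp_delta M1 M2) ^^ Suc n) (Run1 (nstates M1) b, a0 # b1 # ?a # (contents [False], snd ?a) # ts)
     = (Run2 0, a0 # b1 # (fst ?a, 0) # (contents [False], 0) # ts)"
    using Suc.hyps(1)[OF a(2,3)] a(2) by simp
  then show ?case
    unfolding Suc.hyps(2)[symmetric] funpow_Suc_right[of "Suc n"] comp_apply step a(1) by simp
qed

lemma poly_nat_mono: "x \<le> y \<Longrightarrow> poly (p :: nat poly) x \<le> poly p y"
  by (induction p) (auto intro: add_mono mult_mono)

lemma comp_run1:
  assumes wf: "wf_tm M1" and run: "\<And>t'. t' < t \<Longrightarrow> fst ((tm_step M1 ^^ t') (init_config M1 w)) < nstates M1"
  shows "\<exists>b. (astep (Run2 n2) (comp_delta M1 M2) ^^ t) (emb1 True b1 bs (init_config M1 w))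
       = emb1 b b1 bs ((tm_step M1 ^^ t) (init_config M1 w)) \<and>
      (snd (snd ((tm_step M1 ^^ t) (init_config M1 w)) ! 1) \<noteq> 0 \<longrightarrow>
        b = (0 < snd (snd ((tm_step M1 ^^ t) (init_config M1 w)) ! 1)))"
  using run
proof (induction t)
  case 0
  have "ntapes M1 \<ge> 2" using wf by (simp add: wf_tm_def)
  then show ?case by (auto simp: init_config_def nth_Cons')
next
  case (Suc t)
  let ?c = "(tm_step M1 ^^ t) (init_config M1 w)"
  obtain b where b: "(astep (Run2 n2) (comp_delta M1 M2) ^^ t) (emb1 True b1 bs (init_config M1 w)) = emb1 b b1 bs ?c"
    "snd (snd ?c ! 1) \<noteq> 0 \<Longrightarrow> b = (0 < snd (snd ?c ! 1))"
    using Suc by (meson less_SucI)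
  obtain b' where "astep (Run2 n2) (comp_delta M1 M2) (emb1 b b1 bs ?c) = emb1 b' b1 bs (tm_step M1 ?c)"
    "snd (snd (tm_step M1 ?c) ! 1) \<noteq> 0 \<Longrightarrow> b' = (0 < snd (snd (tm_step M1 ?c) ! 1))"
    using emb1_step[OF wf good_config_run[OF wf] Suc.prems[OF lessI] b(2)] by metis
  then show ?case using b(1) by auto
qed

lemma comp_run2:
  assumes "wf_tm M2" "length as = ntapes M1 - 2"
  shows "(astep (Run2 (nstates M2)) (comp_delta M1 M2) ^^ t) (emb2 a0 x as (init_config M2 w))
     = emb2 a0 x as ((tm_step M2 ^^ t) (init_config M2 w))"
  by (induction t) (simp_all add: emb2_step[OF assms(1) good_config_run[OF assms(1)] assms(2)])

theorem polytime_on_comp: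
  assumes "polytime_on D enc mid" "polytime_on D mid out"
  shows "polytime_on D enc out"
proof -
  obtain M1 p1 where M1: "wf_tm M1" "\<And>a. a \<in> D \<Longrightarrow> tm_outputs_within M1 (enc a) (poly p1 (length (enc a))) (mid a)"
    using assms(1) unfolding polytime_on_def by blast
  obtain M2 p2 where M2: "wf_tm M2" "\<And>a. a \<in> D \<Longrightarrow> tm_outputs_within M2 (mid a) (poly p2 (length (mid a))) (out a)"
    using assms(2) unfolding polytime_on_def by blast
  have k: "2 \<le> ntapes M1" "2 \<le> ntapes M2" "3 \<le> nsyms M1" "3 \<le> nsyms M2" using M1 M2 by (auto simp: wf_tm_def)
  define Q where "Q = insert Start ((\<lambda>(p, b). Run1 p b) ` ({..nstates M1} \<times> UNIV) \<union> Run2 ` {..nstates M2})"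
  let ?qh = "Run2 (nstates M2)"
  let ?st = "astep ?qh (comp_delta M1 M2)"
  let ?K = "ntapes M1 + ntapes M2"
  have Q: "finite Q" "Start \<in> Q" "?qh \<in> Q" "Start \<noteq> ?qh" "2 \<le> ?K" "3 \<le> max (nsyms M1) (nsyms M2)"
    using k unfolding Q_def by auto
  obtain M where M: "wf_tm M"
    "\<And>w t ts v. (?st ^^ t) (Start, init_tapes ?K w) = (?qh, ts) \<Longrightarrow> fst (ts ! 1) = contents v \<Longrightarrow> tm_outputs_within M w t v"
    by (rule finite_state_machine_to_tm[OF Q, of "comp_delta M1 M2"])
      (use comp_delta_wf[OF M1(1) M2(1), folded Q_def] in blast)+
  let ?e = "(contents [], 0) :: tape"
  let ?as = "replicate (ntapes M1 - 2) ?e" and ?bs = "replicate (ntapes M2 - 2) ?e"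
  \<comment> \<open>One starting step, at most \<open>p1\<close> steps of the first machine, at most
    \<open>p1 + 1\<close> steps to rewind, and a second run on a word of length at most
    \<open>p1\<close>.\<close>
  define p where "p = 2 * p1 + 2 + pcompose p2 p1"
  have start: "?st (Start, init_tapes ?K w) = emb1 True ?e ?bs (init_config M1 w)" for w
  proof -
    have "replicate (?K - 1) ?e = ?e # ?e # ?e # ?as @ ?bs"
    proof -
      have "?K - 1 = Suc (Suc (Suc (ntapes M1 - 2 + (ntapes M2 - 2))))" using k by simp
      then show ?thesis by (simp only: replicate_Suc replicate_add)
    qed
    then have it: "init_tapes ?K w = (contents w, 0) # ?e # ?e # ?e # ?as @ ?bs" unfolding init_tapes_def by simp
    have "replicate (ntapes M1 - 1) ?e = ?e # ?as" using k by (metis Suc_diff_Suc Suc_1 Suc_le_lessD replicate_Suc)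
    then have ic: "init_config M1 w = (0, (contents w, 0) # ?e # ?as)" unfolding init_config_def by simp
    have mark: "act (Suc 0, Stay) ?e = (contents [False], 0)"
      by (auto simp: act_def contents_def fun_eq_iff)
    have "astep (Run2 n) (comp_delta M1 M2) (Start, a # b # c # d # R)
        = (Run1 0 True, a # b # c # act (Suc 0, Stay) d # R)" for n a b c d R
    proof -
      have "comp_delta M1 M2 Start (map sym (a # b # c # d # R)) = (Run1 0 True,
         [(sym a, Stay), (sym b, Stay), (sym c, Stay), (1, Stay)] @ keep (map sym R))"
        by (simp add: comp_delta_def Let_def)
      then show ?thesis unfolding astep_def by simp
    qed
    then show ?thesis unfolding it by (simp add: emb1_def ic mark)
  qed
  have "tm_outputs_within M (enc a) (poly p (length (enc a))) (out a)" if a: "a \<in> D" for a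
  proof -
    define w where "w = enc a"
    define T1 where "T1 = poly p1 (length w)"
    define T2 where "T2 = poly p2 (length (mid a))"
    let ?r = "\<lambda>t. (tm_step M1 ^^ t) (init_config M1 w)"
    have o1: "tm_outputs_within M1 w T1 (mid a)" using M1(2)[OF a] by (simp add: w_def T1_def)
    \<comment> \<open>The rewinding begins as soon as the first machine halts, which may be earlier
      than its time bound.\<close>
    define t1 where "t1 = (LEAST t. fst (?r t) = nstates M1)"
    have halted: "fst (?r T1) = nstates M1" using o1 by (simp add: tm_outputs_within_def Let_def)
    have t1: "fst (?r t1) = nstates M1" unfolding t1_def by (rule LeastI[of _ T1]) (rule halted)
    have t1le: "t1 \<le> T1" unfolding t1_def by (rule Least_le) (rule halted)
    have "tm_outputs_within M1 w t1 (mid a)"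
    proof -
      have "?r T1 = (tm_step M1 ^^ (T1 - t1)) (?r t1)"
        using t1le by (metis comp_apply funpow_add le_add_diff_inverse2)
      then have "?r T1 = ?r t1" using tm_halted[OF t1] by simp
      then show ?thesis using o1 by (simp add: tm_outputs_within_def Let_def)
    qed
    then have mid: "fst (snd (?r t1) ! 1) = contents (mid a)" by (simp add: tm_outputs_within_def Let_def)
    have "fst (?r t) < nstates M1" if "t < t1" for t
    proof -
      have "fst (?r t) \<noteq> nstates M1" using that not_less_Least unfolding t1_def by blast
      moreover have "fst (?r t) \<le> nstates M1" using good_config_run[OF M1(1)] by (simp add: good_config_def)
      ultimately show ?thesis by simp
    qed
    from comp_run1[OF M1(1) this, of t1 "nstates M2" M2 ?e ?bs]
    obtain b where b: "(?st ^^ t1) (emb1 True ?e ?bs (init_config M1 w)) = emb1 b ?e ?bs (?r t1)"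
      "snd (snd (?r t1) ! 1) \<noteq> 0 \<Longrightarrow> b = (0 < snd (snd (?r t1) ! 1))" by blast
    define z where "z = nat \<bar>snd (snd (?r t1) ! 1)\<bar>"
    have z: "z \<le> T1" using run_tape1_bounds[OF M1(1), where w = w and t = t1] t1le unfolding z_def by linarith
    define a0 as where "a0 = snd (?r t1) ! 0" and "as = drop 2 (snd (?r t1))"
    have las: "length as = ntapes M1 - 2" using good_config_run[OF M1(1), of t1 w] unfolding as_def good_config_def by simp
    have "(?st ^^ Suc z) (emb1 b ?e ?bs (?r t1)) = (Run2 0, a0 # ?e # (contents (mid a), 0) # (contents [False], 0) # as @ ?bs)"
      unfolding emb1_def t1 z_def a0_def as_def mid[symmetric] by (rule comp_rewind) (rule b(2))
    also have "\<dots> = emb2 a0 (contents [False], 0) as (init_config M2 (mid a))"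
    proof -
      have "replicate (ntapes M2 - 1) ?e = ?e # ?bs" using k by (metis Suc_diff_Suc Suc_1 Suc_le_lessD replicate_Suc)
      then show ?thesis unfolding init_config_def emb2_def by simp
    qed
    finally have rew: "(?st ^^ Suc z) (emb1 b ?e ?bs (?r t1)) = emb2 a0 (contents [False], 0) as (init_config M2 (mid a))" .
    let ?f = "(tm_step M2 ^^ T2) (init_config M2 (mid a))"
    have o2: "fst ?f = nstates M2" "fst (snd ?f ! 1) = contents (out a)"
      using M2(2)[OF a] by (simp_all add: tm_outputs_within_def Let_def T2_def)
    have "(?st ^^ (T2 + (Suc z + (t1 + 1)))) (Start, init_tapes ?K w) = emb2 a0 (contents [False], 0) as ?f"
      unfolding funpow_add comp_apply
      by (simp only: One_nat_def funpow_Suc_right funpow_0 funpow.simps(1) id_apply comp_apply start b(1) rew[unfolded funpow_Suc_right comp_apply] comp_run2[OF M2(1) las])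
    also have "\<dots> = (?qh, a0 # snd ?f ! 1 # snd ?f ! 0 # (contents [False], 0) # as @ drop 2 (snd ?f))"
      unfolding emb2_def o2 ..
    finally have "tm_outputs_within M w (T2 + (Suc z + (t1 + 1))) (out a)"
      by (rule M(2)) (use o2 in simp)
    moreover have "T2 + (Suc z + (t1 + 1)) \<le> poly p (length w)"
    proof -
      have "length (mid a) \<le> T1" using output_length_le[OF M1(1) o1] .
      then have "T2 \<le> poly p2 T1" unfolding T2_def by (rule poly_nat_mono)
      then show ?thesis using z t1le unfolding p_def T1_def by (simp add: poly_pcompose)
    qed
    ultimately show ?thesis unfolding w_def by (rule tm_outputs_within_mono)
  qed
  then show ?thesis using M(1) unfolding polytime_on_def by blast
qed

lemma polytime_on_reindex:
  assumes "polytime_on D enc out" "\<And>a. a \<in> D' \<Longrightarrow> h a \<in> D"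
  shows "polytime_on D' (\<lambda>a. enc (h a)) (\<lambda>a. out (h a))"
  using assms unfolding polytime_on_def by blast

section \<open>Counter programs\<close>

datatype cond = NZ nat | OneC | NonBlank

datatype com = Skip | Inc nat | Dec nat | Emit bool | Seq com com (infixr ";;" 60) | If cond com com | While cond com

fun holds :: "bool list \<Rightarrow> (nat \<Rightarrow> nat) \<Rightarrow> cond \<Rightarrow> bool" where
  "holds w s (NZ r) = (s r \<noteq> 0)"
| "holds w s OneC = (contents w (int (s 0)) = 2)"
| "holds w s NonBlank = (contents w (int (s 0)) \<noteq> 0)"

fun cstep :: "bool list \<Rightarrow> com list \<times> (nat \<Rightarrow> nat) \<times> bool list \<Rightarrow> com list \<times> (nat \<Rightarrow> nat) \<times> bool list" where
  "cstep w ([], s, z) = ([], s, z)"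
| "cstep w (Skip # K, s, z) = (K, s, z)"
| "cstep w (Inc r # K, s, z) = (K, s(r := s r + 1), z)"
| "cstep w (Dec r # K, s, z) = (K, s(r := s r - 1), z)"
| "cstep w (Emit b # K, s, z) = (K, s, z @ [b])"
| "cstep w ((p ;; q) # K, s, z) = (p # q # K, s, z)"
| "cstep w (If c p q # K, s, z) = ((if holds w s c then p else q) # K, s, z)"
| "cstep w (While c p # K, s, z) = (if holds w s c then p # While c p # K else K, s, z)"

text \<open>
  Register \<open>r\<close> is the head position on tape \<open>r + 2\<close>, which carries a mark at the origin and nothing else;
  register \<open>0\<close> is moreover the position of the input head. The states are the continuations.
\<close>

fun conts :: "com \<Rightarrow> com list \<Rightarrow> com list set" where
  "conts (p ;; q) K = insert ((p ;; q) # K) (conts p (q # K) \<union> conts q K)"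
| "conts (If c p q) K = insert (If c p q # K) (conts p K \<union> conts q K)"
| "conts (While c p) K = insert (While c p # K) (conts p (While c p # K))"
| "conts p K = {p # K}"

lemma finite_conts: "finite (conts p K)"
  by (induction p K rule: conts.induct) auto

lemma conts_self: "p # K \<in> conts p K"
  by (cases p) auto

fun succs :: "com list \<Rightarrow> com list set" where
  "succs [] = {[]}"
| "succs ((p ;; q) # K) = {p # q # K}"
| "succs (If c p q # K) = {p # K, q # K}"
| "succs (While c p # K) = {p # While c p # K, K}"
| "succs (p # K) = {K}"

text \<open>This closure keeps the control finite: a loop puts itself behind its body, so unfolding
  it again yields no new continuation.\<close>

lemma conts_closed: "L \<in> conts p K \<Longrightarrow> succs L \<subseteq> insert K (conts p K)"
proof (induction p K arbitrary: L rule: conts.induct)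
  case (1 p q K)
  consider "L = (p ;; q) # K" | "L \<in> conts p (q # K)" | "L \<in> conts q K" using "1.prems" by auto
  then show ?case
  proof cases
    case 2
    from "1.IH"(1)[OF this] show ?thesis using conts_self[of q K] by auto
  next
    case 3
    from "1.IH"(2)[OF this] show ?thesis by auto
  qed (simp add: conts_self)
next
  case (2 c p q K)
  consider "L = If c p q # K" | "L \<in> conts p K" | "L \<in> conts q K" using "2.prems" by auto
  then show ?case
  proof cases
    case 2
    from "2.IH"(1)[OF this] show ?thesis by auto
  next
    case 3
    from "2.IH"(2)[OF this] show ?thesis by auto
  qed (simp add: conts_self)
next
  case (3 c p K)
  consider "L = While c p # K" | "L \<in> conts p (While c p # K)" using "3.prems" by auto
  then show ?case
  proof cases
    case 2
    from "3.IH"[OF this] show ?thesis by auto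
  qed (simp add: conts_self)
qed auto

fun cregs :: "com \<Rightarrow> nat set" where
  "cregs Skip = {}"
| "cregs (Inc r) = {r}"
| "cregs (Dec r) = {r}"
| "cregs (Emit b) = {}"
| "cregs (p ;; q) = cregs p \<union> cregs q"
| "cregs (If c p q) = (case c of NZ r \<Rightarrow> {r} | _ \<Rightarrow> {}) \<union> cregs p \<union> cregs q"
| "cregs (While c p) = (case c of NZ r \<Rightarrow> {r} | _ \<Rightarrow> {}) \<union> cregs p"

lemma finite_cregs: "finite (cregs p)"
  by (induction p) (auto split: cond.split)

definition move :: "nat list \<Rightarrow> nat \<Rightarrow> direction \<Rightarrow> (nat \<times> direction) list" where
  "move ss r d = map (\<lambda>j. (ss ! j, if j = r + 2 \<or> j = 0 \<and> r = 0 then d else Stay)) [0..<length ss]"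

fun reads_hold :: "nat list \<Rightarrow> cond \<Rightarrow> bool" where
  "reads_hold ss (NZ r) = (ss ! (r + 2) \<noteq> 1)"
| "reads_hold ss OneC = (ss ! 0 = 2)"
| "reads_hold ss NonBlank = (ss ! 0 \<noteq> 0)"

fun com_delta :: "com list \<Rightarrow> nat list \<Rightarrow> com list \<times> (nat \<times> direction) list" where
  "com_delta [] ss = ([], keep ss)"
| "com_delta (Skip # K) ss = (K, keep ss)"
| "com_delta (Inc r # K) ss = (K, move ss r Rgt)"
| "com_delta (Dec r # K) ss = (K, if ss ! (r + 2) = 1 then keep ss else move ss r Lft)"
| "com_delta (Emit b # K) ss = (K, (keep ss)[1 := (if b then 2 else 1, Rgt)])"
| "com_delta ((p ;; q) # K) ss = (p # q # K, keep ss)"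
| "com_delta (If c p q # K) ss = ((if reads_hold ss c then p else q) # K, keep ss)"
| "com_delta (While c p # K) ss = (if reads_hold ss c then p # While c p # K else K, keep ss)"

text \<open>The extra state \<open>None\<close> spends the first step on writing the marks at the
  origins of the register tapes.\<close>

definition prog_delta :: "com \<Rightarrow> com list option \<Rightarrow> nat list \<Rightarrow> com list option \<times> (nat \<times> direction) list" where
  "prog_delta p q ss = (case q of
     None \<Rightarrow> (Some [p], map (\<lambda>j. (if 2 \<le> j then 1 else ss ! j, Stay)) [0..<length ss])
   | Some L \<Rightarrow> (Some (fst (com_delta L ss)), snd (com_delta L ss)))"

lemma com_delta_wf:
  assumes "set ss \<subseteq> {..<3}"
  shows "fst (com_delta L ss) \<in> succs L \<and> length (snd (com_delta L ss)) = length ss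
    \<and> fst ` set (snd (com_delta L ss)) \<subseteq> {..<3}"
proof (cases "\<exists>b K. L = Emit b # K")
  case True
  then obtain b K where L: "L = Emit b # K" by blast
  have "fst ` set ((keep ss)[1 := (if b then 2 else 1, Rgt)]) \<subseteq> fst ` insert (if b then 2 else 1, Rgt) (set (keep ss))"
    by (intro image_mono set_update_subset_insert)
  also have "\<dots> = insert (if b then 2 else 1) (set ss)" by simp
  also have "\<dots> \<subseteq> {..<3}" using assms by auto
  finally show ?thesis unfolding L by simp
next
  case False
  have "fst ` set (move ss r d) \<subseteq> {..<3}" for r d
  proof
    fix x assume "x \<in> fst ` set (move ss r d)"
    then obtain j where "j < length ss" "x = ss ! j" by (auto simp: move_def)
    then show "x \<in> {..<3}" using assms nth_mem by blast
  qed
  moreover have "length (move ss r d) = length ss" for r d by (simp add: move_def)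
  ultimately show ?thesis using assms False by (cases "(L, ss)" rule: com_delta.cases) auto
qed

section \<open>Simulation of programs on tapes\<close>

definition reg_tape :: "bool list \<Rightarrow> (nat \<Rightarrow> nat) \<Rightarrow> bool list \<Rightarrow> nat \<Rightarrow> tape" where
  "reg_tape w s z j = (if j = 0 then (contents w, int (s 0)) else if j = 1 then (contents z, int (length z))
     else (contents [False], int (s (j - 2))))"

definition reg_tapes :: "nat \<Rightarrow> bool list \<Rightarrow> (nat \<Rightarrow> nat) \<Rightarrow> bool list \<Rightarrow> tape list" where
  "reg_tapes m w s z = map (reg_tape w s z) [0..<m + 2]"

lemma map2_map_upt: "map2 f (map g [0..<n]) (map h [0..<n]) = map (\<lambda>j. f (g j) (h j)) [0..<n]"
  by (simp add: map2_map_map)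

lemma act_eq: "act (fst t (snd t), d) t = (fst t, snd t + shift d)"
  by (simp add: act_def)

lemma contents_snoc: "(contents z)(int (length z) := (if b then 2 else 1)) = contents (z @ [b])"
  by (auto simp: contents_def fun_eq_iff nth_append)

lemma prog_step:
  assumes L: "L \<noteq> []" "\<forall>p\<in>set L. cregs p \<subseteq> {..<m}" and m: "0 < m"
  shows "astep (Some []) (prog_delta p0) (Some L, reg_tapes m w s z)
    = (case cstep w (L, s, z) of (L', s', z') \<Rightarrow> (Some L', reg_tapes m w s' z'))"
proof -
  define ss where "ss = map sym (reg_tapes m w s z)"
  have ss: "length ss = m + 2" "\<And>j. j < m + 2 \<Longrightarrow> ss ! j = sym (reg_tape w s z j)"
    by (simp_all add: ss_def reg_tapes_def del: upt_Suc)
  have st: "astep (Some []) (prog_delta p0) (Some L, reg_tapes m w s z)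
      = (Some (fst (com_delta L ss)), map2 act (snd (com_delta L ss)) (reg_tapes m w s z))"
    using L(1) by (simp add: astep_def prog_delta_def ss_def)
  have kp: "map2 act (keep ss) (reg_tapes m w s z) = reg_tapes m w s z"
    unfolding ss_def by (rule map2_act_keep')
  have mv: "map2 act (move ss r d) (reg_tapes m w s z) = reg_tapes m w (s(r := k)) z"
    if "r < m" "int k = int (s r) + shift d" for r d k
    unfolding move_def ss(1) reg_tapes_def map2_map_upt
  proof (rule map_cong[OF refl])
    fix j assume j: "j \<in> set [0..<m + 2]"
    then have "ss ! j = sym (reg_tape w s z j)" using ss(2) by auto
    then show "act (ss ! j, if j = r + 2 \<or> j = 0 \<and> r = 0 then d else Stay) (reg_tape w s z j) = reg_tape w (s(r := k)) z j"
      using that by (auto simp: act_eq reg_tape_def)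
  qed
  have em: "map2 act ((keep ss)[1 := (if b then 2 else 1, Rgt)]) (reg_tapes m w s z) = reg_tapes m w s (z @ [b])" for b
  proof -
    have "(keep ss)[1 := (if b then 2 else 1, Rgt)] = map (\<lambda>j. if j = 1 then (if b then 2 else 1, Rgt) else (ss ! j, Stay)) [0..<m + 2]"
      by (rule nth_equalityI) (auto simp: keep_def ss(1) nth_list_update simp del: upt_Suc)
    moreover have "map2 act \<dots> (reg_tapes m w s z) = reg_tapes m w s (z @ [b])"
      unfolding reg_tapes_def map2_map_upt
    proof (rule map_cong[OF refl])
      fix j assume j: "j \<in> set [0..<m + 2]"
      then have "ss ! j = sym (reg_tape w s z j)" using ss(2) by auto
      then show "act (if j = 1 then (if b then 2 else 1, Rgt) else (ss ! j, Stay)) (reg_tape w s z j) = reg_tape w s (z @ [b]) j"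
        using contents_snoc[of z b] by (auto simp: act_eq reg_tape_def) (auto simp: act_def)
    qed
    ultimately show ?thesis by simp
  qed
  have zero: "ss ! (r + 2) = (if s r = 0 then 1 else 0)" if "r < m" for r
    using ss(2)[of "r + 2"] that by (simp add: reg_tape_def contents_mark)
  have inp: "ss ! 0 = contents w (int (s 0))" using ss(2)[of 0] by (simp add: reg_tape_def)
  have hold: "reads_hold ss c = holds w s c" if "case c of NZ r \<Rightarrow> r < m | _ \<Rightarrow> True" for c
    using that zero inp by (cases c) auto
  obtain p K where LK: "L = p # K" using L(1) by (cases L) auto
  have rp: "cregs p \<subseteq> {..<m}" using L(2) LK by simp
  show ?thesis
  proof (cases p)
    case (Inc r)
    then show ?thesis unfolding st unfolding LK using rp mv[of r "s r + 1" Rgt] by simp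
  next
    case (Dec r)
    show ?thesis
    proof (cases "s r = 0")
      case True
      then have "s(r := s r - 1) = s" by (auto simp: fun_eq_iff)
      then show ?thesis unfolding st unfolding LK using Dec rp kp zero[of r] True by (simp del: One_nat_def)
    next
      case False
      then show ?thesis unfolding st unfolding LK using Dec rp zero[of r] mv[of r "s r - 1" Lft] by (simp add: of_nat_diff del: One_nat_def)
    qed
  next
    case (Emit b)
    then show ?thesis unfolding st unfolding LK using em[of b] by simp
  next
    case (If c p1 p2)
    then have "reads_hold ss c = holds w s c" using rp by (intro hold) (auto split: cond.splits)
    then show ?thesis unfolding st unfolding LK using If kp by simp
  next
    case (While c p1)
    then have "reads_hold ss c = holds w s c" using rp by (intro hold) (auto split: cond.splits)
    then show ?thesis unfolding st unfolding LK using While kp by simp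
  next
    case Skip
    then show ?thesis unfolding st unfolding LK using kp by simp
  next
    case (Seq p1 p2)
    then show ?thesis unfolding st unfolding LK using kp by simp
  qed
qed

text \<open>One step count must serve all continuations \<open>K\<close>, so that runs can be
  composed in any context.\<close>

definition runs :: "bool list \<Rightarrow> com \<Rightarrow> nat \<Rightarrow> (nat \<Rightarrow> nat) \<times> bool list \<Rightarrow> (nat \<Rightarrow> nat) \<times> bool list \<Rightarrow> bool" where
  "runs w p T c c' \<longleftrightarrow> (\<exists>t\<le>T. \<forall>K. (cstep w ^^ t) (p # K, c) = (K, c'))"

theorem counter_program_polytime:
  assumes "\<And>a. a \<in> D \<Longrightarrow> \<exists>s'. runs (enc a) p (poly P (length (enc a))) (\<lambda>_. 0, []) (s', out a)"
  shows "polytime_on D enc out"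
proof -
  define m where "m = Suc (Max (insert 0 (cregs p)))"
  have m: "0 < m" "cregs p \<subseteq> {..<m}" unfolding m_def using finite_cregs[of p] by (auto simp: less_Suc_eq_le)
  define Q where "Q = insert None (Some ` insert [] (conts p []))"
  have Q: "finite Q" "None \<in> Q" "Some [] \<in> Q" "None \<noteq> Some ([] :: com list)" "2 \<le> m + 2" "3 \<le> (3::nat)"
    unfolding Q_def by (auto simp: finite_conts)
  have wf: "fst (prog_delta p q ss) \<in> Q \<and> length (snd (prog_delta p q ss)) = m + 2 \<and> fst ` set (snd (prog_delta p q ss)) \<subseteq> {..<3}"
    if "q \<in> Q" "q \<noteq> Some []" "length ss = m + 2" "set ss \<subseteq> {..<3}" for q ss
  proof (cases q)
    case None
    have "fst ` set (map (\<lambda>j. (if 2 \<le> j then 1 else ss ! j, Stay)) [0..<length ss]) \<subseteq> {..<3}"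
      using that(4) nth_mem by fastforce
    then show ?thesis using None that by (simp add: prog_delta_def Q_def conts_self)
  next
    case (Some L)
    then have "L \<in> conts p []" using that unfolding Q_def by auto
    then have "succs L \<subseteq> insert [] (conts p [])" by (rule conts_closed)
    then show ?thesis using com_delta_wf[OF that(4), of L] Some that unfolding Q_def prog_delta_def by auto
  qed
  obtain M where M: "wf_tm M"
    "\<And>w t ts v. (astep (Some []) (prog_delta p) ^^ t) (None, init_tapes (m + 2) w) = (Some [], ts) \<Longrightarrow>
      fst (ts ! 1) = contents v \<Longrightarrow> tm_outputs_within M w t v"
    by (rule finite_state_machine_to_tm[OF Q, of "prog_delta p"]) (use wf in blast)+
  let ?st = "astep (Some []) (prog_delta p)"
  have start: "?st (None, init_tapes (m + 2) w) = (Some [p], reg_tapes m w (\<lambda>_. 0) [])" for w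
  proof -
    define ss where "ss = map sym (init_tapes (m + 2) w)"
    have it: "init_tapes (m + 2) w = map (\<lambda>j. if j = 0 then (contents w, 0) else (contents [], 0)) [0..<m + 2]"
      by (rule nth_equalityI) (auto simp: init_tapes_def nth_Cons' simp del: upt_Suc)
    have ss: "length ss = m + 2" "\<And>j. j < m + 2 \<Longrightarrow> ss ! j = sym (if j = 0 then (contents w, 0) else (contents [], 0))"
      unfolding ss_def it by (simp_all del: upt_Suc)
    have "?st (None, init_tapes (m + 2) w) = (Some [p], map2 act (map (\<lambda>j. (if 2 \<le> j then 1 else ss ! j, Stay)) [0..<m + 2]) (init_tapes (m + 2) w))"
      by (simp only: astep_def prog_delta_def fst_conv snd_conv option.case option.distinct if_False ss_def[symmetric] ss(1))
    also have "map2 act (map (\<lambda>j. (if 2 \<le> j then 1 else ss ! j, Stay)) [0..<m + 2]) (init_tapes (m + 2) w) = reg_tapes m w (\<lambda>_. 0) []"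
      unfolding it map2_map_upt reg_tapes_def
    proof (rule map_cong[OF refl])
      fix j assume "j \<in> set [0..<m + 2]"
      then have "ss ! j = sym (if j = 0 then (contents w, 0) else (contents [], 0))" using ss(2) by auto
      then show "act (if 2 \<le> j then 1 else ss ! j, Stay) (if j = 0 then (contents w, 0) else (contents [], 0)) = reg_tape w (\<lambda>_. 0) [] j"
        by (cases "j = 0"; cases "j = 1") (auto simp: act_def reg_tape_def contents_def fun_eq_iff)
    qed
    finally show ?thesis .
  qed
  have inv: "\<forall>q\<in>set (fst (cstep w c)). cregs q \<subseteq> {..<m}" if "\<forall>q\<in>set (fst c). cregs q \<subseteq> {..<m}" for w c
    using that by (cases "(w, c)" rule: cstep.cases) auto
  have inv_run: "\<forall>q\<in>set (fst ((cstep w ^^ t) ([p], s, z))). cregs q \<subseteq> {..<m}" for t w s z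
    by (induction t) (simp_all add: m inv)
  have sim: "(?st ^^ t) (Some [p], reg_tapes m w s z)
      = (case (cstep w ^^ t) ([p], s, z) of (L', s', z') \<Rightarrow> (Some L', reg_tapes m w s' z'))" for t w s z
  proof (induction t)
    case (Suc t)
    obtain L' s' z' where c: "(cstep w ^^ t) ([p], s, z) = (L', s', z')" by (metis prod_cases3)
    show ?case
    proof (cases "L' = []")
      case True
      then show ?thesis using Suc c by (simp add: astep_def)
    next
      case False
      have "\<forall>q\<in>set L'. cregs q \<subseteq> {..<m}" using inv_run[of t w s z] c by simp
      then show ?thesis using Suc c prog_step[OF False _ m(1)] by simp
    qed
  qed simp
  \<comment> \<open>The additional step is the one that writes the marks.\<close>
  have "tm_outputs_within M (enc a) (poly (P + 1) (length (enc a))) (out a)" if a: "a \<in> D" for a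
  proof -
    obtain s' t where t: "t \<le> poly P (length (enc a))" "(cstep (enc a) ^^ t) ([p], \<lambda>_. 0, []) = ([], s', out a)"
      using assms[OF a] unfolding runs_def by blast
    have "(?st ^^ (t + 1)) (None, init_tapes (m + 2) (enc a)) = (Some [], reg_tapes m (enc a) s' (out a))"
      unfolding funpow_add comp_apply using t(2) start sim[of t] by simp
    then have "tm_outputs_within M (enc a) (t + 1) (out a)"
      by (rule M(2)) (simp add: reg_tapes_def reg_tape_def del: upt_Suc)
    then show ?thesis by (rule tm_outputs_within_mono) (use t in simp)
  qed
  then show ?thesis using M(1) unfolding polytime_on_def by blast
qed

section \<open>Rules for running times\<close>

lemma runs_mono: "runs w p T c c' \<Longrightarrow> T \<le> T' \<Longrightarrow> runs w p T' c c'"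
  unfolding runs_def by (meson le_trans)

text \<open>The equations allow a composed rule to be applied as it is; the resulting register
  updates are compared afterwards.\<close>

lemma runs_weaken:
  "runs w p T c c' \<Longrightarrow> T \<le> T' \<Longrightarrow> d = c \<Longrightarrow> d' = c' \<Longrightarrow> runs w p T' d d'"
  using runs_mono by blast

lemma runs_1: "(\<And>K. cstep w (p # K, c) = (K, c')) \<Longrightarrow> runs w p 1 c c'"
  unfolding runs_def by (intro exI[of _ 1]) simp

lemma runs_Skip: "runs w Skip 1 c c"
  by (rule runs_1) (cases c, simp)

lemma runs_Inc: "runs w (Inc r) 1 (s, z) (s(r := s r + 1), z)"
  by (rule runs_1) simp

lemma runs_Dec: "runs w (Dec r) 1 (s, z) (s(r := s r - 1), z)"
  by (rule runs_1) simp

lemma runs_Emit: "runs w (Emit b) 1 (s, z) (s, z @ [b])"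
  by (rule runs_1) simp

lemma runs_Seq:
  assumes "runs w p T1 c c1" "runs w q T2 c1 c2"
  shows "runs w (p ;; q) (T1 + T2 + 1) c c2"
proof -
  obtain t1 where t1: "t1 \<le> T1" "\<And>K. (cstep w ^^ t1) (p # K, c) = (K, c1)" using assms(1) unfolding runs_def by blast
  obtain t2 where t2: "t2 \<le> T2" "\<And>K. (cstep w ^^ t2) (q # K, c1) = (K, c2)" using assms(2) unfolding runs_def by blast
  have "(cstep w ^^ (t2 + t1 + 1)) ((p ;; q) # K, c) = (K, c2)" for K
    unfolding funpow_add comp_apply using t1 t2 by (cases c) simp
  then show ?thesis unfolding runs_def using t1 t2 by (intro exI[of _ "t2 + t1 + 1"]) simp
qed

lemma runs_If:
  assumes "runs w (if holds w (fst c) b then p else q) T c c'"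
  shows "runs w (If b p q) (T + 1) c c'"
proof -
  obtain t where t: "t \<le> T" "\<And>K. (cstep w ^^ t) ((if holds w (fst c) b then p else q) # K, c) = (K, c')"
    using assms unfolding runs_def by blast
  have "(cstep w ^^ (t + 1)) (If b p q # K, c) = (K, c')" for K
    unfolding funpow_add comp_apply using t by (cases c) simp
  then show ?thesis unfolding runs_def using t by (intro exI[of _ "t + 1"]) simp
qed

lemma runs_While_step:
  assumes "holds w (fst c) b" "runs w p T1 c c1" "runs w (While b p) T2 c1 c2"
  shows "runs w (While b p) (T1 + T2 + 1) c c2"
proof -
  obtain t1 where t1: "t1 \<le> T1" "\<And>K. (cstep w ^^ t1) (p # K, c) = (K, c1)" using assms unfolding runs_def by blast
  obtain t2 where t2: "t2 \<le> T2" "\<And>K. (cstep w ^^ t2) (While b p # K, c1) = (K, c2)" using assms unfolding runs_def by blast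
  have "(cstep w ^^ (t2 + t1 + 1)) (While b p # K, c) = (K, c2)" for K
    unfolding funpow_add comp_apply using t1 t2 assms(1) by (cases c) simp
  then show ?thesis unfolding runs_def using t1 t2 by (intro exI[of _ "t2 + t1 + 1"]) simp
qed

lemma runs_While_end: "\<not> holds w (fst c) b \<Longrightarrow> runs w (While b p) 1 c c"
  by (rule runs_1) (cases c, simp)

text \<open>Instead of an invariant, the state \<open>\<sigma> i\<close> before round
  \<open>i\<close> is given explicitly, which fixes the number of rounds as well.\<close>

lemma runs_While:
  assumes "\<And>i. i < n \<Longrightarrow> holds w (fst (\<sigma> i)) b" "\<And>i. i < n \<Longrightarrow> runs w p T (\<sigma> i) (\<sigma> (Suc i))"
    and "\<not> holds w (fst (\<sigma> n)) b"
  shows "runs w (While b p) (n * (T + 1) + 1) (\<sigma> 0) (\<sigma> n)"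
  using assms
proof (induction n arbitrary: \<sigma>)
  case 0
  then show ?case using runs_While_end by simp
next
  case (Suc n)
  have "runs w (While b p) (n * (T + 1) + 1) (\<sigma> (Suc 0)) (\<sigma> (Suc n))"
    using Suc.prems by (intro Suc.IH[of "\<lambda>i. \<sigma> (Suc i)"]) auto
  then have "runs w (While b p) (T + (n * (T + 1) + 1) + 1) (\<sigma> 0) (\<sigma> (Suc n))"
    using Suc.prems by (intro runs_While_step) auto
  then show ?case by (simp add: algebra_simps)
qed

lemma runs_clear: "runs w (While (NZ r) (Dec r)) (s r * 2 + 1) (s, z) (s(r := 0), z)"
proof -
  have "runs w (While (NZ r) (Dec r)) (s r * (1 + 1) + 1) (s(r := s r - 0), z) (s(r := s r - s r), z)"
  proof (rule runs_While[where \<sigma> = "\<lambda>i. (s(r := s r - i), z)"])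
    fix i assume "i < s r"
    show "runs w (Dec r) 1 (s(r := s r - i), z) (s(r := s r - Suc i), z)"
      by (rule runs_weaken[OF runs_Dec]) auto
  qed auto
  then show ?thesis by (rule runs_weaken) auto
qed

lemma runs_transfer:
  assumes "a \<noteq> b"
  shows "runs w (While (NZ a) (Dec a ;; Inc b)) (s a * 4 + 1) (s, z) (s(a := 0, b := s b + s a), z)"
proof -
  let ?\<sigma> = "\<lambda>i. (s(a := s a - i, b := s b + i), z)"
  have "runs w (While (NZ a) (Dec a ;; Inc b)) (s a * (3 + 1) + 1) (?\<sigma> 0) (?\<sigma> (s a))"
  proof (rule runs_While[where \<sigma> = ?\<sigma>])
    fix i assume "i < s a"
    then show "runs w (Dec a ;; Inc b) 3 (?\<sigma> i) (?\<sigma> (Suc i))"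
      using assms by (intro runs_weaken[OF runs_Seq[OF runs_Dec[of w a "fst (?\<sigma> i)" z] runs_Inc[of w b]]]) (auto simp: fun_eq_iff)
  qed (use assms in auto)
  then show ?thesis by (rule runs_weaken) auto
qed

section \<open>Bounded arithmetic expressions\<close>

text \<open>Bounded sums are the only iteration. Quantifiers, division, counting and decoding reduce
  to them, and as their ranges are values of expressions, all values and times stay
  polynomial.\<close>

datatype expr = EV nat | EN nat | EAdd expr expr | EMul expr expr | ESub expr expr | EBit expr | ELen
  | ESum nat expr expr

fun eval :: "bool list \<Rightarrow> (nat \<Rightarrow> nat) \<Rightarrow> expr \<Rightarrow> nat" where
  "eval w env (EV y) = env y"
| "eval w env (EN c) = c"
| "eval w env (EAdd a b) = eval w env a + eval w env b"
| "eval w env (EMul a b) = eval w env a * eval w env b"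
| "eval w env (ESub a b) = eval w env a - eval w env b"
| "eval w env (EBit a) = of_bool (eval w env a < length w \<and> w ! eval w env a)"
| "eval w env ELen = length w"
| "eval w env (ESum x a b) = (\<Sum>i<eval w env a. eval w (env(x := i)) b)"

fun fv :: "expr \<Rightarrow> nat set" where
  "fv (EV y) = {y}"
| "fv (EN c) = {}"
| "fv (EAdd a b) = fv a \<union> fv b"
| "fv (EMul a b) = fv a \<union> fv b"
| "fv (ESub a b) = fv a \<union> fv b"
| "fv (EBit a) = fv a"
| "fv ELen = {}"
| "fv (ESum x a b) = fv a \<union> (fv b - {x})"

lemma finite_fv: "finite (fv e)"
  by (induction e) auto

text \<open>The argument of the polynomial bounds the word length and all variables at once. In the
  body of a sum it grows by the bound on the range, hence the composition.\<close>

fun val_bound :: "expr \<Rightarrow> nat poly" where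
  "val_bound (EV y) = [:0, 1:]"
| "val_bound (EN c) = [:c:]"
| "val_bound (EAdd a b) = val_bound a + val_bound b"
| "val_bound (EMul a b) = val_bound a * val_bound b"
| "val_bound (ESub a b) = val_bound a"
| "val_bound (EBit a) = 1"
| "val_bound ELen = [:0, 1:]"
| "val_bound (ESum x a b) = val_bound a * pcompose (val_bound b) ([:0, 1:] + val_bound a)"

lemma eval_le_val_bound:
  assumes "length w \<le> B" "\<And>y. y \<in> fv e \<Longrightarrow> env y \<le> B"
  shows "eval w env e \<le> poly (val_bound e) B"
  using assms
proof (induction e arbitrary: env B)
  case (EMul a b)
  then show ?case by (simp add: mult_mono)
next
  case (ESub a b)
  then show ?case by (simp add: le_trans[OF diff_le_self])
next
  case (ESum x a b)
  let ?n = "eval w env a" and ?B = "B + poly (val_bound a) B"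
  have n: "?n \<le> poly (val_bound a) B" using ESum by simp
  have "eval w (env(x := i)) b \<le> poly (val_bound b) ?B" if i: "i < ?n" for i
    using ESum.prems n i by (intro ESum.IH(2)) (auto intro: trans_le_add1)
  then have "(\<Sum>i<?n. eval w (env(x := i)) b) \<le> ?n * poly (val_bound b) ?B"
    using sum_bounded_above[of "{..<?n}" "\<lambda>i. eval w (env(x := i)) b" "poly (val_bound b) ?B"] by simp
  also have "\<dots> \<le> poly (val_bound a) B * poly (val_bound b) ?B" using n by (rule mult_right_mono) simp
  finally show ?case by (simp add: poly_pcompose)
qed (auto simp: add_mono)

fun incs :: "nat \<Rightarrow> nat \<Rightarrow> com" where
  "incs t 0 = Skip"
| "incs t (Suc c) = Inc t ;; incs t c"

text \<open>
  \<open>compile \<rho> e t m\<close> adds the value of \<open>e\<close> to register \<open>t\<close>, reading the variable \<open>y\<close> from register \<open>\<rho> y\<close> and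
  using the registers from \<open>m\<close> on as scratch space, which is clean before and after.
\<close>

fun compile :: "(nat \<Rightarrow> nat) \<Rightarrow> expr \<Rightarrow> nat \<Rightarrow> nat \<Rightarrow> com" where
  "compile \<rho> (EV y) t m =
     While (NZ (\<rho> y)) (Dec (\<rho> y) ;; Inc t ;; Inc m) ;; While (NZ m) (Dec m ;; Inc (\<rho> y))"
| "compile \<rho> (EN c) t m = incs t c"
| "compile \<rho> (EAdd a b) t m = compile \<rho> a t m ;; compile \<rho> b t m"
| "compile \<rho> (EMul a b) t m = compile \<rho> a m (m + 1) ;; While (NZ m) (Dec m ;; compile \<rho> b t (m + 1))"
| "compile \<rho> (ESub a b) t m = compile \<rho> a m (m + 1) ;; compile \<rho> b (m + 1) (m + 2) ;;
     While (NZ (m + 1)) (Dec (m + 1) ;; Dec m) ;; While (NZ m) (Dec m ;; Inc t)"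
| "compile \<rho> (EBit a) t m = compile \<rho> a m (m + 1) ;; While (NZ m) (Dec m ;; Inc 0) ;;
     If OneC (Inc t) Skip ;; While (NZ 0) (Dec 0)"
| "compile \<rho> ELen t m = While NonBlank (Inc 0 ;; Inc t) ;; While (NZ 0) (Dec 0)"
| "compile \<rho> (ESum x a b) t m = compile \<rho> a m (m + 1) ;;
     While (NZ m) (Dec m ;; compile (\<rho>(x := m + 1)) b t (m + 2) ;; Inc (m + 1)) ;;
     While (NZ (m + 1)) (Dec (m + 1))"

fun time_bound :: "expr \<Rightarrow> nat poly" where
  "time_bound (EV y) = [:3, 10:]"
| "time_bound (EN c) = [:2 * c + 1:]"
| "time_bound (EAdd a b) = time_bound a + time_bound b + 1"
| "time_bound (EMul a b) = time_bound a + val_bound a * (time_bound b + 3) + 2"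
| "time_bound (ESub a b) = time_bound a + time_bound b + 4 * val_bound b + 4 * val_bound a + 5"
| "time_bound (EBit a) = time_bound a + 6 * val_bound a + 7"
| "time_bound ELen = [:3, 6:]"
| "time_bound (ESum x a b) = time_bound a
     + val_bound a * (pcompose (time_bound b) ([:0, 1:] + val_bound a) + 7) + 4"

lemma runs_incs: "runs w (incs t c) (2 * c + 1) (s, z) (s(t := s t + c), z)"
proof (induction c arbitrary: s)
  case 0
  then show ?case using runs_Skip[of w "(s, z)"] by simp
next
  case (Suc c)
  show ?case
    by (rule runs_weaken[OF runs_Seq[OF runs_Inc[of w t s z] Suc[of "s(t := s t + 1)"]], folded incs.simps]) (auto simp: fun_eq_iff)
qed

definition scratch_ok :: "(nat \<Rightarrow> nat) \<Rightarrow> nat set \<Rightarrow> (nat \<Rightarrow> nat) \<Rightarrow> nat \<Rightarrow> nat \<Rightarrow> (nat \<Rightarrow> nat) \<Rightarrow> bool" where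
  "scratch_ok \<rho> X env t m s \<longleftrightarrow> (\<forall>y\<in>X. 1 \<le> \<rho> y \<and> \<rho> y < m \<and> \<rho> y \<noteq> t \<and> s (\<rho> y) = env y) \<and>
     s 0 = 0 \<and> (\<forall>r\<ge>m. s r = 0) \<and> 1 \<le> t \<and> t < m"

text \<open>Adding to \<open>t\<close> instead of assigning lets the rounds of a loop accumulate
  their contributions in place.\<close>

lemma runs_compile:
  assumes "length w \<le> B" "\<And>y. y \<in> fv e \<Longrightarrow> env y \<le> B" "scratch_ok \<rho> (fv e) env t m s"
  shows "runs w (compile \<rho> e t m) (poly (time_bound e) B) (s, z) (s(t := s t + eval w env e), z)"
  using assms
proof (induction e arbitrary: \<rho> env t m s B)
  \<comment> \<open>A register can only be read by emptying it: its value goes to \<open>t\<close>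
    and \<open>m\<close>, and then back from \<open>m\<close>.\<close>
  case (EV y)
  let ?n = "env y"
  have ok: "\<rho> y < m" "\<rho> y \<noteq> t" "s (\<rho> y) = ?n" "s m = 0" "t < m" using EV.prems by (auto simp: scratch_ok_def)
  let ?\<sigma> = "\<lambda>i. (s(\<rho> y := ?n - i, t := s t + i, m := i), z)"
  have 1: "runs w (While (NZ (\<rho> y)) (Dec (\<rho> y) ;; Inc t ;; Inc m)) (?n * (5 + 1) + 1) (?\<sigma> 0) (?\<sigma> ?n)"
  proof (rule runs_While[where \<sigma> = ?\<sigma>])
    fix i assume i: "i < ?n"
    let ?s = "fst (?\<sigma> i)"
    let ?s1 = "?s(\<rho> y := ?s (\<rho> y) - 1)"
    let ?s2 = "?s1(t := ?s1 t + 1)"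
    show "runs w (Dec (\<rho> y) ;; Inc t ;; Inc m) 5 (?\<sigma> i) (?\<sigma> (Suc i))"
      by (rule runs_weaken[OF runs_Seq[OF runs_Dec[of w "\<rho> y" ?s z] runs_Seq[OF runs_Inc[of w t ?s1 z] runs_Inc[of w m ?s2 z]]]]) (use ok i in \<open>auto simp: fun_eq_iff\<close>)
  qed (use ok in auto)
  have 0: "?\<sigma> 0 = (s, z)" using ok by (auto simp: fun_eq_iff)
  have e: "(fst (?\<sigma> ?n))(m := 0, \<rho> y := fst (?\<sigma> ?n) (\<rho> y) + fst (?\<sigma> ?n) m) = s(t := s t + ?n)"
    using ok by (auto simp: fun_eq_iff)
  have 2: "runs w (While (NZ m) (Dec m ;; Inc (\<rho> y))) (?n * 4 + 1) (?\<sigma> ?n) (s(t := s t + ?n), z)"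
    by (rule runs_weaken[OF runs_transfer[of m "\<rho> y" w "fst (?\<sigma> ?n)" z], unfolded e]) (use ok in auto)
  have "?n \<le> B" using EV.prems by simp
  then show ?case unfolding compile.simps by (intro runs_weaken[OF runs_Seq[OF 1[unfolded 0] 2]]) auto
next
  case (EN c)
  show ?case unfolding compile.simps by (rule runs_weaken[OF runs_incs]) auto
next
  case (EAdd a b)
  let ?s1 = "s(t := s t + eval w env a)"
  have 1: "runs w (compile \<rho> a t m) (poly (time_bound a) B) (s, z) (?s1, z)"
    using EAdd.prems by (intro EAdd.IH(1)) (auto simp: scratch_ok_def)
  have 2: "runs w (compile \<rho> b t m) (poly (time_bound b) B) (?s1, z) (?s1(t := ?s1 t + eval w env b), z)"
    using EAdd.prems by (intro EAdd.IH(2)) (auto simp: scratch_ok_def)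
  show ?case unfolding compile.simps by (rule runs_weaken[OF runs_Seq[OF 1 2]]) auto
next
  case (EMul a b)
  let ?n = "eval w env a" and ?v = "eval w env b"
  have ok: "s m = 0" "t < m" using EMul.prems by (auto simp: scratch_ok_def)
  have 1: "runs w (compile \<rho> a m (m + 1)) (poly (time_bound a) B) (s, z) (s(m := s m + ?n), z)"
    using EMul.prems by (intro EMul.IH(1)) (auto simp: scratch_ok_def less_Suc_eq)
  let ?\<sigma> = "\<lambda>i. (s(m := ?n - i, t := s t + i * ?v), z)"
  have 2: "runs w (While (NZ m) (Dec m ;; compile \<rho> b t (m + 1))) (?n * ((1 + poly (time_bound b) B + 1) + 1) + 1) (?\<sigma> 0) (?\<sigma> ?n)"
  proof (rule runs_While[where \<sigma> = ?\<sigma>])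
    fix i assume i: "i < ?n"
    let ?s = "fst (?\<sigma> i)"
    let ?s1 = "?s(m := ?s m - 1)"
    have r: "runs w (compile \<rho> b t (m + 1)) (poly (time_bound b) B) (?s1, z) (?s1(t := ?s1 t + ?v), z)"
      using EMul.prems by (intro EMul.IH(2)) (auto simp: scratch_ok_def less_Suc_eq)
    show "runs w (Dec m ;; compile \<rho> b t (m + 1)) (1 + poly (time_bound b) B + 1) (?\<sigma> i) (?\<sigma> (Suc i))"
      by (rule runs_weaken[OF runs_Seq[OF runs_Dec[of w m ?s z] r]]) (use ok i in \<open>auto simp: fun_eq_iff\<close>)
  qed (use ok in auto)
  have 0: "?\<sigma> 0 = (s(m := s m + ?n), z)" using ok by (auto simp: fun_eq_iff)
  have e: "?\<sigma> ?n = (s(t := s t + ?n * ?v), z)" using ok by (auto simp: fun_eq_iff)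
  have n: "?n \<le> poly (val_bound a) B" using EMul.prems by (intro eval_le_val_bound) auto
  have "?n * (poly (time_bound b) B + 3) \<le> poly (val_bound a) B * (poly (time_bound b) B + 3)"
    using n by (rule mult_right_mono) simp
  then show ?case
    unfolding compile.simps by (intro runs_weaken[OF runs_Seq[OF 1 2[unfolded 0 e]]]) (auto simp: algebra_simps)
next
  case (ESub a b)
  let ?n = "eval w env a" and ?k = "eval w env b"
  have ok: "s m = 0" "s (m + 1) = 0" "t < m" using ESub.prems by (auto simp: scratch_ok_def)
  have lt: "y \<in> fv b \<Longrightarrow> \<rho> y < m" for y using ESub.prems by (auto simp: scratch_ok_def)
  let ?s1 = "s(m := s m + ?n)"
  let ?s2 = "?s1(m + 1 := ?s1 (m + 1) + ?k)"
  have 1: "runs w (compile \<rho> a m (m + 1)) (poly (time_bound a) B) (s, z) (?s1, z)"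
    using ESub.prems by (intro ESub.IH(1)) (auto simp: scratch_ok_def less_Suc_eq)
  have 2: "runs w (compile \<rho> b (m + 1) (m + 2)) (poly (time_bound b) B) (?s1, z) (?s2, z)"
    using ESub.prems by (intro ESub.IH(2)) (auto simp: scratch_ok_def less_Suc_eq dest: lt)
  let ?\<sigma> = "\<lambda>i. (s(m := ?n - i, m + 1 := ?k - i), z)"
  have 3: "runs w (While (NZ (m + 1)) (Dec (m + 1) ;; Dec m)) (?k * (3 + 1) + 1) (?\<sigma> 0) (?\<sigma> ?k)"
  proof (rule runs_While[where \<sigma> = ?\<sigma>])
    fix i assume i: "i < ?k"
    let ?s = "fst (?\<sigma> i)"
    let ?t1 = "?s(m + 1 := ?s (m + 1) - 1)"
    show "runs w (Dec (m + 1) ;; Dec m) 3 (?\<sigma> i) (?\<sigma> (Suc i))"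
      by (rule runs_weaken[OF runs_Seq[OF runs_Dec[of w "m + 1" ?s z] runs_Dec[of w m ?t1 z]]]) (use ok i in \<open>auto simp: fun_eq_iff\<close>)
  qed auto
  have 0: "?\<sigma> 0 = (?s2, z)" using ok by (auto simp: fun_eq_iff)
  let ?s3 = "fst (?\<sigma> ?k)"
  have e: "?s3(m := 0, t := ?s3 t + ?s3 m) = s(t := s t + (?n - ?k))" using ok by (auto simp: fun_eq_iff)
  have 4: "runs w (While (NZ m) (Dec m ;; Inc t)) ((?n - ?k) * 4 + 1) (?\<sigma> ?k) (s(t := s t + (?n - ?k)), z)"
    by (rule runs_weaken[OF runs_transfer[of m t w ?s3 z], unfolded e]) (use ok in auto)
  have n: "?n \<le> poly (val_bound a) B" using ESub.prems by (intro eval_le_val_bound) auto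
  have k: "?k \<le> poly (val_bound b) B" using ESub.prems by (intro eval_le_val_bound) auto
  show ?case
    unfolding compile.simps
    by (rule runs_weaken[OF runs_Seq[OF 1 runs_Seq[OF 2 runs_Seq[OF 3[unfolded 0] 4]]]]) (use n k in auto)
next
  \<comment> \<open>Register \<open>0\<close> acts as the input head: it is moved to the position
    \<open>a\<close>, the bit is read, and it is moved back.\<close>
  case (EBit a)
  let ?n = "eval w env a"
  have ok: "s m = 0" "s 0 = 0" "t < m" "1 \<le> t" using EBit.prems by (auto simp: scratch_ok_def)
  let ?s1 = "s(m := s m + ?n)"
  let ?s2 = "s(0 := ?n)"
  let ?s3 = "?s2(t := s t + eval w env (EBit a))"
  have 1: "runs w (compile \<rho> a m (m + 1)) (poly (time_bound a) B) (s, z) (?s1, z)"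
    using EBit.prems by (intro EBit.IH) (auto simp: scratch_ok_def less_Suc_eq)
  have e: "?s1(m := 0, 0 := ?s1 0 + ?s1 m) = ?s2" using ok by (auto simp: fun_eq_iff)
  have 2: "runs w (While (NZ m) (Dec m ;; Inc 0)) (?n * 4 + 1) (?s1, z) (?s2, z)"
    by (rule runs_weaken[OF runs_transfer[of m 0 w ?s1 z], unfolded e]) (use ok in auto)
  have 3: "runs w (If OneC (Inc t) Skip) (1 + 1) (?s2, z) (?s3, z)"
  proof (rule runs_If)
    have h: "holds w (fst (?s2, z)) OneC = (?n < length w \<and> w ! ?n)" by (simp add: contents_def)
    show "runs w (if holds w (fst (?s2, z)) OneC then Inc t else Skip) 1 (?s2, z) (?s3, z)"
    proof (cases "?n < length w \<and> w ! ?n")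
      case True
      have "runs w (Inc t) 1 (?s2, z) (?s3, z)"
        by (rule runs_weaken[OF runs_Inc]) (use ok True in auto)
      then show ?thesis unfolding h if_P[OF True] .
    next
      case False
      have "runs w Skip 1 (?s2, z) (?s3, z)"
        by (rule runs_weaken[OF runs_Skip]) (use ok False in \<open>auto simp: fun_eq_iff\<close>)
      then show ?thesis unfolding h if_not_P[OF False] .
    qed
  qed
  have e2: "?s3(0 := 0) = s(t := s t + eval w env (EBit a))" using ok by (auto simp: fun_eq_iff)
  have 4: "runs w (While (NZ 0) (Dec 0)) (?n * 2 + 1) (?s3, z) (s(t := s t + eval w env (EBit a)), z)"
    by (rule runs_weaken[OF runs_clear[of w 0 ?s3 z], unfolded e2]) (use ok in auto)
  have n: "?n \<le> poly (val_bound a) B" using EBit.prems by (intro eval_le_val_bound) auto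
  show ?case
    unfolding compile.simps
    by (rule runs_weaken[OF runs_Seq[OF 1 runs_Seq[OF 2 runs_Seq[OF 3 4]]]]) (use n in auto)
next
  case ELen
  let ?n = "length w"
  have ok: "s 0 = 0" "t < m" "1 \<le> t" using ELen.prems by (auto simp: scratch_ok_def)
  let ?\<sigma> = "\<lambda>i. (s(0 := i, t := s t + i), z)"
  have 1: "runs w (While NonBlank (Inc 0 ;; Inc t)) (?n * (3 + 1) + 1) (?\<sigma> 0) (?\<sigma> ?n)"
  proof (rule runs_While[where \<sigma> = ?\<sigma>])
    fix i assume i: "i < ?n"
    let ?s = "fst (?\<sigma> i)"
    let ?s1 = "?s(0 := ?s 0 + 1)"
    show "runs w (Inc 0 ;; Inc t) 3 (?\<sigma> i) (?\<sigma> (Suc i))"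
      by (rule runs_weaken[OF runs_Seq[OF runs_Inc[of w 0 ?s z] runs_Inc[of w t ?s1 z]]]) (use ok in \<open>auto simp: fun_eq_iff\<close>)
    show "holds w (fst (?\<sigma> i)) NonBlank" using i ok by (simp add: contents_def)
  qed (use ok in \<open>simp add: contents_def\<close>)
  have 0: "?\<sigma> 0 = (s, z)" using ok by (auto simp: fun_eq_iff)
  have e: "(fst (?\<sigma> ?n))(0 := 0) = s(t := s t + ?n)" using ok by (auto simp: fun_eq_iff)
  have 2: "runs w (While (NZ 0) (Dec 0)) (?n * 2 + 1) (?\<sigma> ?n) (s(t := s t + ?n), z)"
    by (rule runs_weaken[OF runs_clear[of w 0 "fst (?\<sigma> ?n)" z], unfolded e]) (use ok in auto)
  show ?case unfolding compile.simps by (rule runs_weaken[OF runs_Seq[OF 1[unfolded 0] 2]]) (use ELen.prems in auto)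
next
  case (ESum x a b)
  let ?n = "eval w env a" and ?v = "\<lambda>i. eval w (env(x := i)) b"
  let ?B = "B + poly (val_bound a) B"
  let ?T = "poly (time_bound b) ?B"
  have n: "?n \<le> poly (val_bound a) B" using ESum.prems by (intro eval_le_val_bound) auto
  have ok: "s m = 0" "s (m + 1) = 0" "t < m" using ESum.prems by (auto simp: scratch_ok_def)
  have lt: "y \<in> fv b \<Longrightarrow> y \<noteq> x \<Longrightarrow> \<rho> y < m" for y using ESum.prems(3) by (auto simp: scratch_ok_def)
  have 1: "runs w (compile \<rho> a m (m + 1)) (poly (time_bound a) B) (s, z) (s(m := s m + ?n), z)"
    using ESum.prems by (intro ESum.IH(1)) (auto simp: scratch_ok_def less_Suc_eq)
  let ?\<sigma> = "\<lambda>i. (s(m := ?n - i, t := s t + (\<Sum>j<i. ?v j), m + 1 := i), z)"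
  have 2: "runs w (While (NZ m) (Dec m ;; compile (\<rho>(x := m + 1)) b t (m + 2) ;; Inc (m + 1)))
      (?n * ((1 + (?T + 1 + 1) + 1) + 1) + 1) (?\<sigma> 0) (?\<sigma> ?n)"
  proof (rule runs_While[where \<sigma> = ?\<sigma>])
    fix i assume i: "i < ?n"
    let ?s = "fst (?\<sigma> i)"
    let ?s1 = "?s(m := ?s m - 1)"
    let ?s2 = "?s1(t := ?s1 t + ?v i)"
    have r: "runs w (compile (\<rho>(x := m + 1)) b t (m + 2)) ?T (?s1, z) (?s2, z)"
    proof (rule ESum.IH(2))
      show "length w \<le> ?B" using ESum.prems by simp
      show "(env(x := i)) y \<le> ?B" if "y \<in> fv b" for y
        using that ESum.prems(2)[of y] i n by auto
      show "scratch_ok (\<rho>(x := m + 1)) (fv b) (env(x := i)) t (m + 2) ?s1"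
        using ESum.prems ok unfolding scratch_ok_def by (auto simp: less_Suc_eq dest: lt)
    qed
    show "runs w (Dec m ;; compile (\<rho>(x := m + 1)) b t (m + 2) ;; Inc (m + 1)) (1 + (?T + 1 + 1) + 1) (?\<sigma> i) (?\<sigma> (Suc i))"
      by (rule runs_weaken[OF runs_Seq[OF runs_Dec[of w m ?s z] runs_Seq[OF r runs_Inc[of w "m + 1" ?s2 z]]]]) (use ok i in \<open>auto simp: fun_eq_iff\<close>)
  qed (use ok in auto)
  have 0: "?\<sigma> 0 = (s(m := s m + ?n), z)" using ok by (auto simp: fun_eq_iff)
  let ?s3 = "fst (?\<sigma> ?n)"
  have e: "?s3(m + 1 := 0) = s(t := s t + (\<Sum>j<?n. ?v j))" using ok by (auto simp: fun_eq_iff)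
  have 3: "runs w (While (NZ (m + 1)) (Dec (m + 1))) (?n * 2 + 1) (?\<sigma> ?n) (s(t := s t + (\<Sum>j<?n. ?v j)), z)"
    by (rule runs_weaken[OF runs_clear[of w "m + 1" ?s3 z], unfolded e]) (use ok in auto)
  have "?n * (?T + 7) \<le> poly (val_bound a) B * (?T + 7)" using n by (rule mult_right_mono) simp
  then show ?case
    unfolding compile.simps
    by (intro runs_weaken[OF runs_Seq[OF 1 runs_Seq[OF 2[unfolded 0] 3]]]) (auto simp: poly_pcompose algebra_simps)
qed

section \<open>Expressions that generate words\<close>

datatype gen = GOut expr | GCat gen gen | GFor nat expr gen

fun gout :: "bool list \<Rightarrow> (nat \<Rightarrow> nat) \<Rightarrow> gen \<Rightarrow> bool list" where
  "gout w env (GOut e) = [eval w env e \<noteq> 0]"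
| "gout w env (GCat g h) = gout w env g @ gout w env h"
| "gout w env (GFor x e g) = concat (map (\<lambda>i. gout w (env(x := i)) g) [0..<eval w env e])"

fun gfv :: "gen \<Rightarrow> nat set" where
  "gfv (GOut e) = fv e"
| "gfv (GCat g h) = gfv g \<union> gfv h"
| "gfv (GFor x e g) = fv e \<union> (gfv g - {x})"

lemma finite_gfv: "finite (gfv g)"
  by (induction g) (auto simp: finite_fv)

fun gcompile :: "(nat \<Rightarrow> nat) \<Rightarrow> gen \<Rightarrow> nat \<Rightarrow> com" where
  "gcompile \<rho> (GOut e) m = compile \<rho> e m (m + 1) ;; If (NZ m) (Emit True) (Emit False) ;; While (NZ m) (Dec m)"
| "gcompile \<rho> (GCat g h) m = gcompile \<rho> g m ;; gcompile \<rho> h m"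
| "gcompile \<rho> (GFor x e g) m = compile \<rho> e m (m + 1) ;;
     While (NZ m) (Dec m ;; gcompile (\<rho>(x := m + 1)) g (m + 2) ;; Inc (m + 1)) ;;
     While (NZ (m + 1)) (Dec (m + 1))"

fun gtime :: "gen \<Rightarrow> nat poly" where
  "gtime (GOut e) = time_bound e + 2 * val_bound e + 5"
| "gtime (GCat g h) = gtime g + gtime h + 1"
| "gtime (GFor x e g) = time_bound e
     + val_bound e * (pcompose (gtime g) ([:0, 1:] + val_bound e) + 7) + 4"

lemma runs_gcompile:
  assumes "length w \<le> B" "\<And>y. y \<in> gfv g \<Longrightarrow> env y \<le> B"
    and "\<forall>y\<in>gfv g. 1 \<le> \<rho> y \<and> \<rho> y < m \<and> s (\<rho> y) = env y" "s 0 = 0" "\<forall>r\<ge>m. s r = 0" "1 \<le> m"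
  shows "runs w (gcompile \<rho> g m) (poly (gtime g) B) (s, z) (s, z @ gout w env g)"
  using assms
proof (induction g arbitrary: \<rho> env m s B z)
  case (GOut e)
  let ?n = "eval w env e"
  let ?s1 = "s(m := s m + ?n)"
  have 1: "runs w (compile \<rho> e m (m + 1)) (poly (time_bound e) B) (s, z) (?s1, z)"
    using GOut.prems by (intro runs_compile) (auto simp: scratch_ok_def less_Suc_eq)
  have 2: "runs w (If (NZ m) (Emit True) (Emit False)) (1 + 1) (?s1, z) (?s1, z @ [?n \<noteq> 0])"
  proof (rule runs_If)
    show "runs w (if holds w (fst (?s1, z)) (NZ m) then Emit True else Emit False) 1 (?s1, z) (?s1, z @ [?n \<noteq> 0])"
      using runs_Emit[of w "?n \<noteq> 0" ?s1 z] GOut.prems by (cases "?n = 0") auto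
  qed
  have 3: "runs w (While (NZ m) (Dec m)) (?n * 2 + 1) (?s1, z @ [?n \<noteq> 0]) (s, z @ [?n \<noteq> 0])"
    by (rule runs_weaken[OF runs_clear[of w m ?s1]]) (use GOut.prems in \<open>auto simp: fun_eq_iff\<close>)
  have "?n \<le> poly (val_bound e) B" using GOut.prems by (intro eval_le_val_bound) auto
  then show ?case unfolding gcompile.simps
    by (intro runs_weaken[OF runs_Seq[OF 1 runs_Seq[OF 2 3]]]) auto
next
  case (GCat g h)
  have 1: "runs w (gcompile \<rho> g m) (poly (gtime g) B) (s, z) (s, z @ gout w env g)"
    using GCat.prems by (intro GCat.IH(1)) auto
  have 2: "runs w (gcompile \<rho> h m) (poly (gtime h) B) (s, z @ gout w env g) (s, (z @ gout w env g) @ gout w env h)"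
    using GCat.prems by (intro GCat.IH(2)) auto
  show ?case unfolding gcompile.simps by (rule runs_weaken[OF runs_Seq[OF 1 2]]) auto
next
  case (GFor x a g)
  let ?n = "eval w env a" and ?v = "\<lambda>i. gout w (env(x := i)) g"
  let ?B = "B + poly (val_bound a) B"
  let ?T = "poly (gtime g) ?B"
  have n: "?n \<le> poly (val_bound a) B" using GFor.prems by (intro eval_le_val_bound) auto
  have ok: "s m = 0" "s (m + 1) = 0" using GFor.prems by auto
  have lt: "y \<in> gfv g \<Longrightarrow> y \<noteq> x \<Longrightarrow> \<rho> y < m" for y using GFor.prems(3) by auto
  have 1: "runs w (compile \<rho> a m (m + 1)) (poly (time_bound a) B) (s, z) (s(m := s m + ?n), z)"
    using GFor.prems by (intro runs_compile) (auto simp: scratch_ok_def less_Suc_eq)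
  let ?\<sigma> = "\<lambda>i. (s(m := ?n - i, m + 1 := i), z @ concat (map ?v [0..<i]))"
  have 2: "runs w (While (NZ m) (Dec m ;; gcompile (\<rho>(x := m + 1)) g (m + 2) ;; Inc (m + 1)))
      (?n * ((1 + (?T + 1 + 1) + 1) + 1) + 1) (?\<sigma> 0) (?\<sigma> ?n)"
  proof (rule runs_While[where \<sigma> = ?\<sigma>])
    fix i assume i: "i < ?n"
    let ?s = "fst (?\<sigma> i)" and ?z = "snd (?\<sigma> i)"
    let ?s1 = "?s(m := ?s m - 1)"
    have r: "runs w (gcompile (\<rho>(x := m + 1)) g (m + 2)) ?T (?s1, ?z) (?s1, ?z @ ?v i)"
    proof (rule GFor.IH)
      show "length w \<le> ?B" using GFor.prems by simp
      show "(env(x := i)) y \<le> ?B" if "y \<in> gfv g" for y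
        using that GFor.prems(2)[of y] i n by auto
      show "\<forall>y\<in>gfv g. 1 \<le> (\<rho>(x := m + 1)) y \<and> (\<rho>(x := m + 1)) y < m + 2 \<and> ?s1 ((\<rho>(x := m + 1)) y) = (env(x := i)) y"
        using GFor.prems ok by (auto simp: less_Suc_eq dest: lt)
    qed (use GFor.prems in auto)
    show "runs w (Dec m ;; gcompile (\<rho>(x := m + 1)) g (m + 2) ;; Inc (m + 1)) (1 + (?T + 1 + 1) + 1) (?\<sigma> i) (?\<sigma> (Suc i))"
      by (rule runs_weaken[OF runs_Seq[OF runs_Dec[of w m ?s ?z] runs_Seq[OF r runs_Inc[of w "m + 1" ?s1]]]])
        (use ok i in \<open>auto simp: fun_eq_iff\<close>)
  qed (use ok in auto)
  have 0: "?\<sigma> 0 = (s(m := s m + ?n), z)" using ok by (auto simp: fun_eq_iff)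
  have 3: "runs w (While (NZ (m + 1)) (Dec (m + 1))) (?n * 2 + 1) (?\<sigma> ?n) (s, z @ concat (map ?v [0..<?n]))"
    by (rule runs_weaken[OF runs_clear[of w "m + 1" "fst (?\<sigma> ?n)"]]) (use ok in \<open>auto simp: fun_eq_iff\<close>)
  have "?n * (?T + 7) \<le> poly (val_bound a) B * (?T + 7)" using n by (rule mult_right_mono) simp
  then show ?case unfolding gcompile.simps
    by (intro runs_weaken[OF runs_Seq[OF 1 runs_Seq[OF 2[unfolded 0] 3]]]) (auto simp: poly_pcompose algebra_simps)
qed

text \<open>Variable \<open>y\<close> lives in register \<open>y + 1\<close>, as register
  \<open>0\<close> is the input head. All variables start at \<open>0\<close>, so the length of the
  word is an admissible bound \<open>B\<close>.\<close>

theorem gen_polytime: "polytime_on D enc (\<lambda>a. gout (enc a) (\<lambda>_. 0) g)"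
proof (rule counter_program_polytime)
  fix a assume "a \<in> D"
  define m where "m = Suc (Suc (Max (insert 0 (gfv g))))"
  have m1: "1 \<le> m" unfolding m_def by simp
  have "y + 1 < m" if "y \<in> gfv g" for y
    using that finite_gfv[of g] unfolding m_def by (simp add: less_Suc_eq_le)
  then have "runs (enc a) (gcompile (\<lambda>y. y + 1) g m) (poly (gtime g) (length (enc a))) (\<lambda>_. 0, []) (\<lambda>_. 0, [] @ gout (enc a) (\<lambda>_. 0) g)"
    by (intro runs_gcompile) (use m1 in auto)
  then show "\<exists>s'. runs (enc a) (gcompile (\<lambda>y. y + 1) g (Suc (Suc (Max (insert 0 (gfv g)))))) (poly (gtime g) (length (enc a))) (\<lambda>_. 0, []) (s', gout (enc a) (\<lambda>_. 0) g)"
    unfolding m_def append_Nil by blast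
qed

lemma eval_cong: "(\<And>y. y \<in> fv e \<Longrightarrow> env y = env' y) \<Longrightarrow> eval w env e = eval w env' e"
proof (induction e arbitrary: env env')
  case (ESum x a b)
  have "eval w env a = eval w env' a" using ESum.prems by (intro ESum.IH(1)) auto
  moreover have "eval w (env(x := i)) b = eval w (env'(x := i)) b" for i
    using ESum.prems by (intro ESum.IH(2)) auto
  ultimately show ?case by simp
next
  case (EAdd a b)
  have "eval w env a = eval w env' a" by (rule EAdd.IH(1)) (simp add: EAdd.prems)
  moreover have "eval w env b = eval w env' b" by (rule EAdd.IH(2)) (simp add: EAdd.prems)
  ultimately show ?case by simp
next
  case (EMul a b)
  have "eval w env a = eval w env' a" by (rule EMul.IH(1)) (simp add: EMul.prems)
  moreover have "eval w env b = eval w env' b" by (rule EMul.IH(2)) (simp add: EMul.prems)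
  ultimately show ?case by simp
next
  case (ESub a b)
  have "eval w env a = eval w env' a" by (rule ESub.IH(1)) (simp add: ESub.prems)
  moreover have "eval w env b = eval w env' b" by (rule ESub.IH(2)) (simp add: ESub.prems)
  ultimately show ?case by simp
next
  case (EBit a)
  have "eval w env a = eval w env' a" by (rule EBit.IH) (simp add: EBit.prems)
  then show ?case by simp
qed simp_all

text \<open>Supplies the variables that the derived expressions below may bind without
  capture.\<close>

fun fresh :: "expr \<Rightarrow> nat" where
  "fresh (EV y) = Suc y"
| "fresh (EN c) = 0"
| "fresh (EAdd a b) = max (fresh a) (fresh b)"
| "fresh (EMul a b) = max (fresh a) (fresh b)"
| "fresh (ESub a b) = max (fresh a) (fresh b)"
| "fresh (EBit a) = fresh a"
| "fresh ELen = 0"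
| "fresh (ESum x a b) = max (fresh a) (fresh b)"

lemma fv_lt_fresh: "y \<in> fv e \<Longrightarrow> y < fresh e"
  by (induction e) (auto simp: less_max_iff_disj)

lemma eval_fresh [simp]: "fresh e \<le> x \<Longrightarrow> eval w (env(x := i)) e = eval w env e"
  using fv_lt_fresh[of _ e] by (intro eval_cong) fastforce

section \<open>Derived arithmetic and logic\<close>

definition eNot :: "expr \<Rightarrow> expr" where "eNot a = ESub (EN 1) a"
definition eTrue :: "expr \<Rightarrow> expr" where "eTrue a = eNot (eNot a)"
definition eLe :: "expr \<Rightarrow> expr \<Rightarrow> expr" where "eLe a b = eNot (ESub a b)"
definition eLt :: "expr \<Rightarrow> expr \<Rightarrow> expr" where "eLt a b = eLe (EAdd a (EN 1)) b"
definition eEq :: "expr \<Rightarrow> expr \<Rightarrow> expr" where "eEq a b = eNot (EAdd (ESub a b) (ESub b a))"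
definition eDiv :: "expr \<Rightarrow> expr \<Rightarrow> expr" where
  "eDiv a b = (let x = max (fresh a) (fresh b) in ESum x a (eLe (EMul (EAdd (EV x) (EN 1)) b) a))"
definition eMod :: "expr \<Rightarrow> expr \<Rightarrow> expr" where "eMod a b = ESub a (EMul b (eDiv a b))"
definition eEx :: "nat \<Rightarrow> expr \<Rightarrow> expr \<Rightarrow> expr" where "eEx x a b = eTrue (ESum x a b)"
definition eAll :: "nat \<Rightarrow> expr \<Rightarrow> expr \<Rightarrow> expr" where "eAll x a b = eNot (ESum x a (eNot b))"
definition eOr :: "expr \<Rightarrow> expr \<Rightarrow> expr" where "eOr a b = eTrue (EAdd a b)"
fun eOrs :: "expr list \<Rightarrow> expr" where "eOrs [] = EN 0" | "eOrs (a # as) = eOr a (eOrs as)"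
fun ePow :: "expr \<Rightarrow> nat \<Rightarrow> expr" where "ePow a 0 = EN 1" | "ePow a (Suc n) = EMul a (ePow a n)"

lemma eval_eNot [simp]: "eval w env (eNot a) = of_bool (eval w env a = 0)"
  by (auto simp: eNot_def)

lemma eval_eTrue [simp]: "eval w env (eTrue a) = of_bool (eval w env a \<noteq> 0)"
  by (auto simp: eTrue_def)

lemma eval_eLe [simp]: "eval w env (eLe a b) = of_bool (eval w env a \<le> eval w env b)"
  by (auto simp: eLe_def)

lemma eval_eLt [simp]: "eval w env (eLt a b) = of_bool (eval w env a < eval w env b)"
  by (auto simp: eLt_def)

lemma eval_eEq [simp]: "eval w env (eEq a b) = of_bool (eval w env a = eval w env b)"
  by (auto simp: eEq_def)

lemma eval_eEx [simp]: "eval w env (eEx x a b) = of_bool (\<exists>i<eval w env a. eval w (env(x := i)) b \<noteq> 0)"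
  by (auto simp: eEx_def)

lemma eval_eAll [simp]: "eval w env (eAll x a b) = of_bool (\<forall>i<eval w env a. eval w (env(x := i)) b \<noteq> 0)"
  by (auto simp: eAll_def)

lemma eval_eOr [simp]: "eval w env (eOr a b) = of_bool (eval w env a \<noteq> 0 \<or> eval w env b \<noteq> 0)"
  by (auto simp: eOr_def)

lemma eval_eOrs [simp]: "eval w env (eOrs as) = of_bool (\<exists>a\<in>set as. eval w env a \<noteq> 0)"
  by (induction as) auto

lemma eval_ePow [simp]: "eval w env (ePow a n) = eval w env a ^ n"
  by (induction n) auto

lemma sum_of_bool_lessThan: "(\<Sum>i<n. of_bool (P i)) = card {i. i < n \<and> P i}" for n :: nat
proof -
  have "{..<n} \<inter> {i. P i} = {i. i < n \<and> P i}" by auto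
  then show ?thesis by simp
qed

lemma eval_eDiv [simp]:
  assumes "0 < eval w env b"
  shows "eval w env (eDiv a b) = eval w env a div eval w env b"
proof -
  let ?a = "eval w env a" and ?b = "eval w env b"
  have "eval w env (eDiv a b) = (\<Sum>i<?a. of_bool ((i + 1) * ?b \<le> ?a))"
    by (simp add: eDiv_def Let_def)
  also have "\<dots> = card {i. i < ?a \<and> (i + 1) * ?b \<le> ?a}" by (rule sum_of_bool_lessThan)
  also have "{i. i < ?a \<and> (i + 1) * ?b \<le> ?a} = {..<?a div ?b}"
  proof -
    have "(i + 1) * ?b \<le> ?a \<longleftrightarrow> i < ?a div ?b" for i
      using less_eq_div_iff_mult_less_eq[OF assms, of "i + 1" ?a] by auto
    then have "i < ?a \<and> (i + 1) * ?b \<le> ?a \<longleftrightarrow> i \<in> {..<?a div ?b}" for i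
      using div_le_dividend[of ?a ?b] by (metis lessThan_iff less_le_trans)
    then show ?thesis by blast
  qed
  finally show ?thesis by simp
qed

lemma eval_eMod [simp]:
  "0 < eval w env b \<Longrightarrow> eval w env (eMod a b) = eval w env a mod eval w env b"
  by (simp add: eMod_def minus_mult_div_eq_mod)

section \<open>Decoding unique games\<close>

text \<open>The reduction yields one inclusion between the classes, and this is the other one. The
  certificate is empty: \<open>enc_pair w []\<close> has length \<open>2 * length w + 1\<close>, so
  \<open>w\<close> is its last half, which an expression can extract before deciding
  \<open>L\<close>.\<close>

lemma class_P_subset_class_NP: "class_P \<subseteq> class_NP"
proof
  fix L assume L: "L \<in> class_P"
  define half where "half = (\<lambda>z :: bool list. map (\<lambda>i. z ! (i + (length z + 1) div 2)) [0..<length z div 2])"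
  define g where "g = GFor 0 (eDiv ELen (EN 2)) (GOut (EBit (EAdd (EV 0) (eDiv (EAdd ELen (EN 1)) (EN 2)))))"
  have "gout z (\<lambda>_. 0) g = half z" for z
    unfolding g_def half_def by (auto simp: concat_map_singleton)
  then have "polytime_on UNIV (\<lambda>z. z) half"
    using gen_polytime[of UNIV "\<lambda>z. z" g] by (simp add: fun_eq_iff[symmetric])
  moreover have "polytime_on UNIV half (\<lambda>z. [half z \<in> L])"
    using polytime_on_reindex[of UNIV "\<lambda>w. w" "\<lambda>w. [w \<in> L]" UNIV half] L by (simp add: class_P_def)
  ultimately have V: "{z. half z \<in> L} \<in> class_P"
    using polytime_on_comp unfolding class_P_def by auto
  have half: "half (enc_pair w []) = w" for w
    by (rule nth_equalityI) (auto simp: half_def enc_pair_def enc_nat_def nth_append)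
  have "\<forall>w. w \<in> L \<longleftrightarrow> (\<exists>u. length u \<le> poly 0 (length w) \<and> enc_pair w u \<in> {z. half z \<in> L})"
    using half by auto
  then show "L \<in> class_NP" unfolding class_NP_def using V by blast
qed

text \<open>Applied to a characteristic vector this compares the size of a vertex set with the
  rational multiple \<open>K2 / K1\<close> of the order of the graph.\<close>

lemma polytime_compare_ones:
  "polytime_on D enc (\<lambda>a. [K2 * length (enc a) \<le> K1 * card {i. i < length (enc a) \<and> enc a ! i}])"
proof -
  define g where "g = GOut (eLe (EMul (EN K2) ELen) (EMul (EN K1) (ESum 0 ELen (EBit (EV 0)))))"
  have "{..<length w} \<inter> Collect ((!) w) = {i. i < length w \<and> w ! i}" for w by auto
  then have "gout w (\<lambda>_. 0) g = [K2 * length w \<le> K1 * card {i. i < length w \<and> w ! i}]" for w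
    unfolding g_def by simp
  then show ?thesis using gen_polytime[of D enc g] by simp
qed

text \<open>Entry \<open>a\<close> of a sequence of unary codes. Each code ends in its only zero, so
  the ones of entry \<open>a\<close> are those preceded by exactly \<open>a\<close> zeros.\<close>

definition eNum :: "expr \<Rightarrow> expr" where
  "eNum a = ESum (fresh a) ELen (EMul (EBit (EV (fresh a)))
     (eEq (ESum (Suc (fresh a)) (EV (fresh a)) (eNot (EBit (EV (Suc (fresh a)))))) a))"

lemma sum_lessThan_add: "(\<Sum>i<a + b. g i) = (\<Sum>i<a. g i) + (\<Sum>i<b. g (a + i))" for g :: "nat \<Rightarrow> nat"
  by (induction b) (auto simp: add.assoc)

text \<open>The first code contributes its ones at zero count \<open>0\<close>; its terminating zero
  shifts the counts of all later codes by one.\<close>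

lemma num_concat_enc_nat:
  assumes "j < length ns"
  defines "w \<equiv> concat (map enc_nat ns)"
  shows "(\<Sum>p<length w. of_bool (w ! p) * of_bool ((\<Sum>q<p. of_bool (\<not> w ! q)) = j)) = ns ! j"
  using assms(1) unfolding w_def
proof (induction ns arbitrary: j)
  case (Cons n ns)
  define v where "v = concat (map enc_nat ns)"
  define u where "u = replicate n True @ False # v"
  have u: "concat (map enc_nat (n # ns)) = u" by (simp add: u_def v_def enc_nat_def)
  have len: "length u = Suc n + length v" by (simp add: u_def)
  have hi: "u ! (Suc n + p) = v ! p" for p by (simp add: u_def nth_append)
  have lo: "p < n \<Longrightarrow> u ! p" for p by (simp add: u_def nth_append)
  have mid: "\<not> u ! n" by (simp add: u_def nth_append)
  define Z where "Z = (\<lambda>u p. \<Sum>q<p. of_bool (\<not> u ! q) :: nat)"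
  have Zlo: "Z u p = 0" if "p \<le> n" for p using that lo unfolding Z_def by auto
  have Zhi: "Z u (Suc n + p) = 1 + Z v p" for p
    unfolding Z_def sum_lessThan_add hi using Zlo[of n] mid by (simp add: Z_def)
  have "(\<Sum>p<length u. of_bool (u ! p) * (of_bool (Z u p = j) :: nat))
      = (\<Sum>p<Suc n. of_bool (u ! p) * (of_bool (Z u p = j) :: nat)) + (\<Sum>p<length v. of_bool (u ! (Suc n + p)) * (of_bool (Z u (Suc n + p) = j) :: nat))"
    unfolding len by (rule sum_lessThan_add)
  also have "(\<Sum>p<Suc n. of_bool (u ! p) * (of_bool (Z u p = j) :: nat)) = (\<Sum>p<n. of_bool (j = 0))"
    using lo Zlo mid by (auto intro!: sum.cong)
  also have "\<dots> = n * of_bool (j = 0)" by simp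
  also have "(\<Sum>p<length v. of_bool (u ! (Suc n + p)) * (of_bool (Z u (Suc n + p) = j) :: nat))
      = (if j = 0 then 0 else ns ! (j - 1))"
  proof (cases j)
    case (Suc i)
    then have "(\<Sum>p<length v. of_bool (v ! p) * (of_bool (Z v p = i) :: nat)) = ns ! i"
      using Cons.IH[of i] Cons.prems unfolding v_def Z_def by simp
    then show ?thesis unfolding hi Zhi using Suc by simp
  qed (unfold hi Zhi, simp)
  finally show ?case unfolding u using Cons.prems by (cases j) (simp_all add: Z_def)
qed simp

lemma eval_eNum:
  assumes "w = concat (map enc_nat ns)" "eval w env a < length ns"
  shows "eval w env (eNum a) = ns ! eval w env a"
proof -
  have in1: "(\<Sum>q<p. of_bool (\<not> (q < length w \<and> w ! q))) = (\<Sum>q<p. of_bool (\<not> w ! q) :: nat)" if "p < length w" for p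
    using that by (intro sum.cong refl) auto
  have "eval w env (eNum a) = (\<Sum>p<length w. of_bool (p < length w \<and> w ! p) * of_bool ((\<Sum>q<p. of_bool (\<not> (q < length w \<and> w ! q))) = eval w env a))"
    unfolding eNum_def by (simp add: eval_fresh[of _ "Suc (fresh a)"] del: sum_of_bool_eq de_Morgan_conj)
  also have "\<dots> = (\<Sum>p<length w. of_bool (w ! p) * of_bool ((\<Sum>q<p. of_bool (\<not> w ! q)) = eval w env a))"
    using in1 by (intro sum.cong refl) (simp del: sum_of_bool_eq)
  also have "\<dots> = ns ! eval w env a" using num_concat_enc_nat[OF assms(2)] assms(1) by simp
  finally show ?thesis .
qed

section \<open>A game as a list of numbers\<close>

definition game_nums :: "unique_game \<Rightarrow> nat list" where
  "game_nums I = [nleft I, nright I, nlabels I, length (edges I)] @ concat (map (\<lambda>(u, v, \<pi>). u # v # \<pi>) (edges I))"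

lemma enc_unique_game_eq: "enc_unique_game I = concat (map enc_nat (game_nums I))"
proof -
  have "concat (map enc_nat (concat (map (\<lambda>(u, v, \<pi>). u # v # \<pi>) es)))
      = concat (map (\<lambda>(u, v, \<pi>). enc_nat u @ enc_nat v @ concat (map enc_nat \<pi>)) es)" for es
    by (induction es) auto
  then show ?thesis by (simp add: enc_unique_game_def game_nums_def)
qed

lemma nth_concat_uniform:
  assumes "\<And>x. x \<in> set xs \<Longrightarrow> length (f x) = c" "e < length xs" "i < c"
  shows "e * c + i < length (concat (map f xs)) \<and> concat (map f xs) ! (e * c + i) = f (xs ! e) ! i"
  using assms
proof (induction xs arbitrary: e)
  case (Cons x xs)
  show ?case
  proof (cases e)
    case 0
    then show ?thesis using Cons.prems by (simp add: nth_append)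
  next
    case (Suc e')
    have "e' * c + i < length (concat (map f xs)) \<and> concat (map f xs) ! (e' * c + i) = f (xs ! e') ! i"
      using Cons.prems Suc by (intro Cons.IH) auto
    then show ?thesis using Cons.prems Suc by (simp add: nth_append algebra_simps)
  qed
qed simp

definition uE :: "unique_game \<Rightarrow> nat \<Rightarrow> nat" where "uE I e = fst (edges I ! e)"
definition vE :: "unique_game \<Rightarrow> nat \<Rightarrow> nat" where "vE I e = fst (snd (edges I ! e))"
definition pE :: "unique_game \<Rightarrow> nat \<Rightarrow> nat \<Rightarrow> nat" where "pE I e a = snd (snd (edges I ! e)) ! a"

lemma wf_edge:
  assumes "wf_unique_game I" "e < length (edges I)"
  shows "uE I e < nleft I" "vE I e < nright I" "distinct (snd (snd (edges I ! e)))"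
    "set (snd (snd (edges I ! e))) = {..<nlabels I}" "length (snd (snd (edges I ! e))) = nlabels I"
proof -
  obtain u v \<pi> where e: "edges I ! e = (u, v, \<pi>)" by (metis prod_cases3)
  then have "(u, v, \<pi>) \<in> set (edges I)" using assms(2) by (metis nth_mem)
  then have "u < nleft I \<and> v < nright I \<and> distinct \<pi> \<and> set \<pi> = {..<nlabels I}"
    using assms(1) unfolding wf_unique_game_def by blast
  moreover from this have "length \<pi> = nlabels I" by (metis card_lessThan distinct_card)
  ultimately show "uE I e < nleft I" "vE I e < nright I" "distinct (snd (snd (edges I ! e)))"
    "set (snd (snd (edges I ! e))) = {..<nlabels I}" "length (snd (snd (edges I ! e))) = nlabels I"
    by (simp_all add: uE_def vE_def e)
qed

text \<open>After four header entries every edge occupies a block of \<open>nlabels I + 2\<close>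
  numbers, so random access to edges is arithmetic with a constant block length.\<close>

lemma game_nums_nth:
  assumes wf: "wf_unique_game I"
  shows "3 < length (game_nums I)" "game_nums I ! 3 = length (edges I)"
    and "e < length (edges I) \<Longrightarrow> 4 + e * (nlabels I + 2) < length (game_nums I) \<and> game_nums I ! (4 + e * (nlabels I + 2)) = uE I e"
    and "e < length (edges I) \<Longrightarrow> 5 + e * (nlabels I + 2) < length (game_nums I) \<and> game_nums I ! (5 + e * (nlabels I + 2)) = vE I e"
    and "e < length (edges I) \<Longrightarrow> a < nlabels I \<Longrightarrow> 6 + (e * (nlabels I + 2) + a) < length (game_nums I) \<and> game_nums I ! (6 + (e * (nlabels I + 2) + a)) = pE I e a"
proof -
  let ?f = "\<lambda>(u :: nat, v, \<pi>). u # v # \<pi>"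
  let ?c = "nlabels I + 2"
  have c: "length (?f x) = ?c" if "x \<in> set (edges I)" for x
    using that wf_edge(5)[OF wf] by (auto simp: in_set_conv_nth split: prod.splits) (metis snd_conv)
  have shift: "game_nums I ! (4 + n) = concat (map ?f (edges I)) ! n"
    "length (game_nums I) = 4 + length (concat (map ?f (edges I)))" for n
    by (simp_all add: game_nums_def numeral_eq_Suc)
  have nth: "4 + (e * ?c + i) < length (game_nums I) \<and> game_nums I ! (4 + (e * ?c + i)) = ?f (edges I ! e) ! i"
    if "e < length (edges I)" "i < ?c" for e i
    using nth_concat_uniform[of "edges I" ?f ?c e i, OF c that] shift(1)[of "e * ?c + i"] shift(2) by simp
  show "3 < length (game_nums I)" "game_nums I ! 3 = length (edges I)" by (simp_all add: game_nums_def)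
  show "4 + e * ?c < length (game_nums I) \<and> game_nums I ! (4 + e * ?c) = uE I e" if "e < length (edges I)"
    using nth[OF that, of 0] by (simp add: uE_def case_prod_beta)
  show "5 + e * ?c < length (game_nums I) \<and> game_nums I ! (5 + e * ?c) = vE I e" if "e < length (edges I)"
    using nth[OF that, of 1] by (simp add: vE_def case_prod_beta add_ac)
  show "6 + (e * ?c + a) < length (game_nums I) \<and> game_nums I ! (6 + (e * ?c + a)) = pE I e a"
    if "e < length (edges I)" "a < nlabels I"
    using nth[OF that(1), of "2 + a"] that(2) by (simp add: pE_def case_prod_beta add_ac)
qed

section \<open>Counting and independent sets\<close>

lemma infl_image:
  assumes "finite I" "inj_on \<pi> I" "a \<in> I"
  shows "infl s I (\<lambda>F. P (\<pi> ` F)) a = infl s (\<pi> ` I) P (\<pi> a)"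
proof -
  have "\<pi> ` I - {\<pi> a} = \<pi> ` (I - {a})" using assms(2,3) by (auto simp: inj_on_def)
  then show ?thesis unfolding infl_def
    using bexp_image[of "I - {a}" \<pi> s "\<lambda>F. of_bool (P (insert (\<pi> a) F)) - of_bool (P F)"] assms
    by (simp add: inj_on_diff)
qed

section \<open>Counting in products and residue classes\<close>

lemma sum_PiE_pick:
  assumes "x \<in> A"
  shows "(\<Sum>\<phi>\<in>PiE A (\<lambda>_. S). h \<phi>) = (\<Sum>v\<in>S. \<Sum>\<phi>\<in>PiE (A - {x}) (\<lambda>_. S). h (\<phi>(x := v)))"
proof -
  have A: "insert x (A - {x}) = A" using assms by auto
  have inj: "inj_on (\<lambda>(y, g). g(x := y)) (S \<times> PiE (A - {x}) (\<lambda>_. S))"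
  proof (rule inj_onI, clarsimp)
    fix u g v g' assume g: "g \<in> PiE (A - {x}) (\<lambda>_. S)" "g' \<in> PiE (A - {x}) (\<lambda>_. S)" and eq: "g(x := u) = g'(x := v)"
    have "u = v" using fun_cong[OF eq, of x] by simp
    moreover have "g y = g' y" for y
      using fun_cong[OF eq, of y] PiE_arb[OF g(1), of x] PiE_arb[OF g(2), of x] by (cases "y = x") auto
    ultimately show "u = v \<and> g = g'" by auto
  qed
  have "PiE A (\<lambda>_. S) = (\<lambda>(y, g). g(x := y)) ` (S \<times> PiE (A - {x}) (\<lambda>_. S))"
    using PiE_insert_eq[of x "A - {x}" "\<lambda>_. S"] A by simp
  then show ?thesis
    by (simp only: sum.reindex[OF inj] sum.cartesian_product comp_def case_prod_beta)
      (simp add: case_prod_beta)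
qed

text \<open>Uniform digits below \<open>m\<close>, cut at \<open>c\<close>, realise the rational
  bias \<open>c / m\<close>; numbers of vertices thereby become biased expectations.\<close>

lemma sum_PiE_bexp:
  assumes "finite I" "c \<le> m" "0 < m"
  shows "(\<Sum>\<xi>\<in>PiE I (\<lambda>_. {..<m}). g {i\<in>I. \<xi> i < c}) = real m ^ card I * bexp (real c / real m) I g"
  using assms(1)
proof (induction I arbitrary: g rule: finite_induct)
  case empty
  then show ?case by simp
next
  case (insert i I)
  let ?S = "PiE I (\<lambda>_. {..<m})"
  have Ii: "insert i I - {i} = I" using insert.hyps by auto
  have "(\<Sum>\<xi>\<in>PiE (insert i I) (\<lambda>_. {..<m}). g {j\<in>insert i I. \<xi> j < c})
     = (\<Sum>v<m. \<Sum>\<xi>\<in>?S. g {j\<in>insert i I. (\<xi>(i := v)) j < c})"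
    using sum_PiE_pick[of i "insert i I" "\<lambda>\<xi>. g {j\<in>insert i I. \<xi> j < c}" "{..<m}"] Ii by simp
  also have "\<dots> = (\<Sum>v<m. if v < c then (\<Sum>\<xi>\<in>?S. g (insert i {j\<in>I. \<xi> j < c})) else (\<Sum>\<xi>\<in>?S. g {j\<in>I. \<xi> j < c}))"
  proof (rule sum.cong[OF refl])
    fix v
    have "{j\<in>insert i I. (\<xi>(i := v)) j < c} = (if v < c then insert i {j\<in>I. \<xi> j < c} else {j\<in>I. \<xi> j < c})" for \<xi>
      using insert.hyps by auto
    then show "(\<Sum>\<xi>\<in>?S. g {j\<in>insert i I. (\<xi>(i := v)) j < c})
       = (if v < c then (\<Sum>\<xi>\<in>?S. g (insert i {j\<in>I. \<xi> j < c})) else (\<Sum>\<xi>\<in>?S. g {j\<in>I. \<xi> j < c}))" by simp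
  qed
  also have "\<dots> = real c * (\<Sum>\<xi>\<in>?S. g (insert i {j\<in>I. \<xi> j < c})) + real (m - c) * (\<Sum>\<xi>\<in>?S. g {j\<in>I. \<xi> j < c})"
  proof -
    have "{..<m} \<inter> {v. v < c} = {..<c}" "{..<m} \<inter> - {v. v < c} = {c..<m}" using assms(2) by auto
    then show ?thesis by (simp add: sum.If_cases)
  qed
  also have "\<dots> = real m ^ card (insert i I) * bexp (real c / real m) (insert i I) g"
    using insert.hyps insert.IH[of "\<lambda>F. g (insert i F)"] insert.IH[of g] assms(2,3)
    by (simp add: bexp_insert field_simps of_nat_diff)
  finally show ?case .
qed

lemma digits_unique:
  fixes x y b :: nat
  assumes "x < b ^ n" "y < b ^ n" "\<And>i. i < n \<Longrightarrow> x div b ^ i mod b = y div b ^ i mod b"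
  shows "x = y"
  using assms
proof (induction n arbitrary: x y)
  case (Suc n)
  have b: "0 < b" using Suc.prems(1) by (cases "b = 0") auto
  have "x div b = y div b"
  proof (rule Suc.IH)
    show "x div b < b ^ n" "y div b < b ^ n"
      using Suc.prems by (simp_all add: less_mult_imp_div_less mult.commute)
    show "x div b div b ^ i mod b = y div b div b ^ i mod b" if "i < n" for i
      using Suc.prems(3)[of "Suc i"] that by (simp add: div_mult2_eq)
  qed
  moreover have "x mod b = y mod b" using Suc.prems(3)[of 0] by simp
  ultimately show ?case by (metis div_mult_mod_eq)
qed simp

lemma bij_betw_digits:
  fixes b :: nat
  assumes "0 < b"
  shows "bij_betw (\<lambda>x. \<lambda>i\<in>{..<n}. x div b ^ i mod b) {..<b ^ n} (PiE {..<n} (\<lambda>_. {..<b}))"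
proof -
  let ?f = "\<lambda>x. \<lambda>i\<in>{..<n}. x div b ^ i mod b"
  have inj: "inj_on ?f {..<b ^ n}"
  proof (rule inj_onI)
    fix x y assume xy: "x \<in> {..<b ^ n}" "y \<in> {..<b ^ n}" "?f x = ?f y"
    show "x = y"
    proof (rule digits_unique)
      fix i assume "i < n"
      then show "x div b ^ i mod b = y div b ^ i mod b" using fun_cong[OF xy(3), of i] by simp
    qed (use xy in auto)
  qed
  have "?f ` {..<b ^ n} \<subseteq> PiE {..<n} (\<lambda>_. {..<b})"
    using assms by (intro image_subsetI restrict_PiE_iff[THEN iffD2]) auto
  moreover have "card (?f ` {..<b ^ n}) = card (PiE {..<n} (\<lambda>_. {..<b}))"
    by (simp add: card_image[OF inj] card_PiE)
  ultimately have "?f ` {..<b ^ n} = PiE {..<n} (\<lambda>_. {..<b})"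
    by (intro card_subset_eq finite_PiE) auto
  then show ?thesis using inj by (simp add: bij_betw_def)
qed

lemma bij_betw_div_mod:
  fixes a b :: nat
  assumes "0 < b"
  shows "bij_betw (\<lambda>x. (x div b, x mod b)) {..<a * b} ({..<a} \<times> {..<b})"
proof (rule bij_betw_byWitness[where f' = "\<lambda>(i, j). i * b + j"])
  show "(\<lambda>x. (x div b, x mod b)) ` {..<a * b} \<subseteq> {..<a} \<times> {..<b}"
    using assms by (auto simp: less_mult_imp_div_less)
  have "i * b + j < a * b" if "i < a" "j < b" for i j
  proof -
    have "i * b + j < Suc i * b" using that by simp
    also have "\<dots> \<le> a * b" using that by (intro mult_right_mono) auto
    finally show ?thesis .
  qed
  then show "(\<lambda>(i, j). i * b + j) ` ({..<a} \<times> {..<b}) \<subseteq> {..<a * b}" by auto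
qed (use assms in auto)

text \<open>The price of selecting by a remainder: as \<open>d \<le> n\<close>, a residue class has
  at most twice its average size.\<close>

lemma card_congruent_le:
  fixes d r n :: nat
  assumes "0 < d" "d \<le> n"
  shows "card {b. b < n \<and> b mod d = r} * d \<le> 2 * n"
proof -
  have "card {b. b < n \<and> b mod d = r} \<le> card {..n div d}"
  proof (rule card_inj_on_le[where f = "\<lambda>b. b div d"])
    show "inj_on (\<lambda>b. b div d) {b. b < n \<and> b mod d = r}"
      by (rule inj_onI) (metis (mono_tags, lifting) div_mult_mod_eq mem_Collect_eq)
  qed (auto intro: div_le_mono)
  then have "card {b. b < n \<and> b mod d = r} * d \<le> (n div d + 1) * d" by (intro mult_right_mono) auto
  also have "\<dots> \<le> n + d" by (simp add: algebra_simps)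
  finally show ?thesis using assms by simp
qed

lemma rank_surj:
  fixes S :: "nat set"
  assumes "finite S" "r < card S"
  shows "\<exists>e\<in>S. card {x\<in>S. x < e} = r"
  using assms
proof (induction S rule: finite_linorder_max_induct)
  case (insert b A)
  show ?case
  proof (cases "r < card A")
    case True
    then obtain e where e: "e \<in> A" "card {x\<in>A. x < e} = r" using insert by blast
    have "{x\<in>insert b A. x < e} = {x\<in>A. x < e}" using e(1) insert.hyps by auto
    then show ?thesis using e by (metis insertI2)
  next
    case False
    have "b \<notin> A" using insert.hyps by auto
    then have "r = card A" using False insert.prems insert.hyps by simp
    moreover have "{x\<in>insert b A. x < b} = A" using insert.hyps by auto
    ultimately show ?thesis by (metis insertI1)
  qed
qed simp

section \<open>Optima of graphs and values of games\<close>

lemma finite_independent_sets: "finite {S. independent_set G S}"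
  by (rule finite_subset[of _ "Pow (verts G)"]) (auto simp: independent_set_def verts_def)

lemma independent_empty: "independent_set G {}"
  by (simp add: independent_set_def)

lemma card_le_OPT: "independent_set G S \<Longrightarrow> card S \<le> OPT G"
  unfolding OPT_def using finite_independent_sets by (intro Max_ge) auto

lemma maximum_independent_set_exists: obtains S where "maximum_independent_set G S"
proof -
  have "OPT G \<in> card ` {S. independent_set G S}"
    unfolding OPT_def using finite_independent_sets independent_empty by (intro Max_in) auto
  then show ?thesis using that unfolding maximum_independent_set_def by auto
qed

lemma OPT_eqI:
  assumes "independent_set G S" "\<And>T. independent_set G T \<Longrightarrow> card T \<le> card S"
  shows "OPT G = card S"
  unfolding OPT_def using assms finite_independent_sets by (intro Max_eqI) auto

definition labeling :: "unique_game \<Rightarrow> (nat \<Rightarrow> nat) \<Rightarrow> (nat \<Rightarrow> nat) \<Rightarrow> bool" where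
  "labeling I a b \<longleftrightarrow> (\<forall>u < nleft I. a u < nlabels I) \<and> (\<forall>v < nright I. b v < nlabels I)"

lemma satisfied_fraction_eq:
  "satisfied_fraction I a b =
     real (card {e. e < length (edges I) \<and> pE I e (a (uE I e)) = b (vE I e)}) / real (length (edges I))"
  unfolding satisfied_fraction_def length_filter_conv_card uE_def vE_def pE_def by (simp add: case_prod_beta)

text \<open>Labelings are total functions and hence infinite in number, but the fraction takes at
  most \<open>length (edges I) + 1\<close> values.\<close>

lemma finite_satisfied_fractions: "finite {satisfied_fraction I a b | a b. labeling I a b}"
proof (rule finite_subset)
  show "{satisfied_fraction I a b | a b. labeling I a b} \<subseteq> (\<lambda>j. real j / real (length (edges I))) ` {..length (edges I)}"
    unfolding satisfied_fraction_def by (auto intro!: imageI length_filter_le)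
qed simp

lemma game_value_ge: "labeling I a b \<Longrightarrow> satisfied_fraction I a b \<le> game_value I"
  unfolding game_value_def labeling_def[symmetric] using finite_satisfied_fractions[of I] by (intro Max_ge) auto

lemma game_value_attained:
  assumes "wf_unique_game I"
  obtains a b where "labeling I a b" "satisfied_fraction I a b = game_value I"
proof -
  have "labeling I (\<lambda>_. 0) (\<lambda>_. 0)" using assms by (simp add: labeling_def wf_unique_game_def)
  then have "{satisfied_fraction I a b | a b. labeling I a b} \<noteq> {}" by blast
  then have "game_value I \<in> {satisfied_fraction I a b | a b. labeling I a b}"
    unfolding game_value_def labeling_def[symmetric] using finite_satisfied_fractions[of I] by (intro Max_in) auto
  then show ?thesis using that by auto
qed

section \<open>The gadget graph\<close>

locale gadget =
  fixes I :: unique_game and c D :: nat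
  assumes wf: "wf_unique_game I" and c: "1 \<le> c" and D: "1 \<le> D"
begin

abbreviation E where "E \<equiv> length (edges I)"
abbreviation k where "k \<equiv> nlabels I"
text \<open>The bias \<open>c / m\<close> tends to \<open>1/2\<close> from below. As
  \<open>m - 1\<close> is odd and at least \<open>2 * c\<close>, reflecting a digit \<open>i\<close>
  to \<open>m - 1 - i\<close> has no fixed point and never maps a digit below \<open>c\<close> to
  another one.\<close>

abbreviation m where "m \<equiv> 2 * c + 2"
abbreviation v where "v \<equiv> vE I"
abbreviation u where "u \<equiv> uE I"
abbreviation \<pi> where "\<pi> \<equiv> pE I"

definition deg where "deg a = card {e. e < E \<and> v e = v a}"
definition rank where "rank a e = card {e'. e' < e \<and> v e' = v a}"
text \<open>An arbitrary edge number \<open>b\<close> becomes an edge at the right vertex of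
  \<open>a\<close> by reduction modulo the degree. This keeps every coordinate of a tuple in the
  same range, whatever the degrees are.\<close>

definition sel where "sel a b e \<longleftrightarrow> e < E \<and> v e = v a \<and> rank a e = b mod deg a"

text \<open>Coordinate \<open>0\<close> of a tuple fixes a right vertex, with probability
  proportional to its degree; coordinates \<open>1\<close> to \<open>D\<close> select edges
  there.\<close>

definition PhiS :: "(nat \<Rightarrow> nat) set" where "PhiS = PiE {..<Suc D} (\<lambda>_. {..<E})"
definition XiS :: "(nat \<Rightarrow> nat) set" where "XiS = PiE {..<k} (\<lambda>_. {..<m})"

text \<open>In the last line \<open>a\<close> is a label of the common left vertex, and
  \<open>snd x (\<pi> e a) < c\<close> says that it lies in the preimage of the label set of
  \<open>x\<close>. So the two preimages are required to be disjoint.\<close>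

definition adj0 :: "(nat \<Rightarrow> nat) \<times> (nat \<Rightarrow> nat) \<Rightarrow> (nat \<Rightarrow> nat) \<times> (nat \<Rightarrow> nat) \<Rightarrow> bool" where
  "adj0 x y \<longleftrightarrow> (\<exists>i\<in>{1..D}. \<exists>j\<in>{1..D}. \<exists>e<E. \<exists>e'<E.
     sel (fst x 0) (fst x i) e \<and> sel (fst y 0) (fst y j) e' \<and> u e = u e' \<and>
     (\<forall>a<k. \<not> (snd x (\<pi> e a) < c \<and> snd y (\<pi> e' a) < c)))"

text \<open>Vertices that would carry a loop are instead joined to all others.\<close>

definition adj where "adj x y \<longleftrightarrow> x \<noteq> y \<and> (adj0 x y \<or> adj0 x x \<or> adj0 y y)"

lemma E_pos: "0 < E" using wf by (simp add: wf_unique_game_def)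
lemma k_pos: "0 < k" using wf by (simp add: wf_unique_game_def)

lemma adj0_sym: "adj0 x y \<Longrightarrow> adj0 y x"
  unfolding adj0_def by metis

lemma adj_sym: "adj x y \<Longrightarrow> adj y x"
  unfolding adj_def using adj0_sym by blast

lemma deg_pos: "a < E \<Longrightarrow> 0 < deg a"
  unfolding deg_def by (subst card_gt_0_iff) auto

lemma deg_le: "deg a \<le> E"
proof -
  have "card {e. e < E \<and> v e = v a} \<le> card {..<E}" by (intro card_mono) auto
  then show ?thesis by (simp add: deg_def)
qed

lemma deg_cong: "v a = v b \<Longrightarrow> deg a = deg b"
  by (simp add: deg_def)

lemma sel_exists: "a < E \<Longrightarrow> \<exists>e. sel a b e"
proof -
  assume a: "a < E"
  let ?S = "{e. e < E \<and> v e = v a}"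
  have "b mod deg a < card ?S" using deg_pos[OF a] by (simp add: deg_def)
  then obtain e where e: "e \<in> ?S" "card {x\<in>?S. x < e} = b mod deg a" using rank_surj[of ?S "b mod deg a"] by auto
  have "{x\<in>?S. x < e} = {e'. e' < e \<and> v e' = v a}" using e(1) by auto
  then show ?thesis using e unfolding sel_def rank_def by auto
qed

lemma sel_count: "a < E \<Longrightarrow> real (card {b. b < E \<and> sel a b e}) \<le> 2 * real E / real (deg a)"
proof -
  assume a: "a < E"
  have "card {b. b < E \<and> sel a b e} \<le> card {b. b < E \<and> b mod deg a = rank a e}"
    by (intro card_mono) (auto simp: sel_def)
  then have "card {b. b < E \<and> sel a b e} * deg a \<le> 2 * E"
    using card_congruent_le[OF deg_pos[OF a] deg_le] by (meson le_trans mult_le_mono1)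
  then have "real (card {b. b < E \<and> sel a b e}) * real (deg a) \<le> 2 * real E"
    by (metis of_nat_le_iff of_nat_mult of_nat_numeral)
  then show ?thesis using deg_pos[OF a] by (simp add: field_simps)
qed

lemma pi_bij:
  assumes "e < E"
  shows "bij_betw (\<pi> e) {..<k} {..<k}"
proof -
  have "\<pi> e = (!) (snd (snd (edges I ! e)))" by (simp add: pE_def fun_eq_iff)
  moreover have "bij_betw ((!) (snd (snd (edges I ! e)))) {..<k} {..<k}"
    by (rule bij_betw_nth) (simp_all only: wf_edge[OF wf assms])
  ultimately show ?thesis by simp
qed

lemma finite_PhiS: "finite PhiS" and finite_XiS: "finite XiS"
  unfolding PhiS_def XiS_def by (auto intro: finite_PiE)

lemma card_PhiS: "card PhiS = E ^ Suc D" and card_XiS: "card XiS = m ^ k"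
  unfolding PhiS_def XiS_def by (simp_all add: card_PiE)

lemma PhiS_lt: "\<phi> \<in> PhiS \<Longrightarrow> i \<le> D \<Longrightarrow> \<phi> i < E"
  unfolding PhiS_def by (auto simp: PiE_iff)

text \<open>Double counting: a uniform edge at the right vertex of a uniform edge is again a uniform
  edge.\<close>

lemma sum_average_degree:
  "(\<Sum>a<E. real (card {e. e < E \<and> v e = v a \<and> G e}) / real (deg a)) = real (card {e. e < E \<and> G e})"
proof -
  have ct: "real (card {e. e < E \<and> P e}) = (\<Sum>e<E. of_bool (P e))" for P
  proof -
    have "{e. e < E \<and> P e} = {..<E} \<inter> {e. P e}" by auto
    then show ?thesis by simp
  qed
  have "(\<Sum>a<E. real (card {e. e < E \<and> v e = v a \<and> G e}) / real (deg a))
      = (\<Sum>a<E. \<Sum>e<E. of_bool (v e = v a \<and> G e) / real (deg a))"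
    unfolding ct sum_divide_distrib ..
  also have "\<dots> = (\<Sum>e<E. \<Sum>a<E. of_bool (v e = v a \<and> G e) / real (deg a))" by (rule sum.swap)
  also have "\<dots> = (\<Sum>e<E. of_bool (G e))"
  proof (rule sum.cong[OF refl])
    fix e assume e: "e \<in> {..<E}"
    have "(\<Sum>a<E. of_bool (v e = v a \<and> G e) / real (deg a)) = (\<Sum>a<E. of_bool (v a = v e) * (of_bool (G e) / real (deg e)))"
    proof (rule sum.cong[OF refl])
      fix a
      show "of_bool (v e = v a \<and> G e) / real (deg a) = of_bool (v a = v e) * (of_bool (G e) / real (deg e))"
        using deg_cong[of a e] by (cases "v a = v e") auto
    qed
    also have "\<dots> = real (deg e) * (of_bool (G e) / real (deg e))"
      unfolding sum_distrib_right[symmetric] ct[symmetric] deg_def ..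
    also have "\<dots> = of_bool (G e)" using e deg_pos[of e] by simp
    finally show "(\<Sum>a<E. of_bool (v e = v a \<and> G e) / real (deg a)) = of_bool (G e)" .
  qed
  also have "\<dots> = real (card {e. e < E \<and> G e})" using ct[of G] by simp
  finally show ?thesis .
qed

text \<open>Colliding label sets can be turned into a labeling by two greedy choices.\<close>

lemma labeling_from_collisions:
  fixes \<Lambda> :: "nat \<Rightarrow> nat set"
  assumes \<Lambda>: "\<And>x. \<Lambda> x \<subseteq> {..<k}" "\<And>x. card (\<Lambda> x) \<le> N"
  defines "S \<equiv> \<lambda>e. \<pi> e ` \<Lambda> (u e)"
  defines "Co \<equiv> \<lambda>a. {(e, e'). e < E \<and> e' < E \<and> v e = v a \<and> v e' = v a \<and> S e \<inter> S e' \<noteq> {}}"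
  obtains al bl where "labeling I al bl"
    "(\<Sum>a<E. real (card (Co a)) / (real (deg a))\<^sup>2)
       \<le> real N * real N * real (card {e. e < E \<and> \<pi> e (al (u e)) = bl (v e)})"
proof -
  have finL: "finite (\<Lambda> x)" for x using \<Lambda>(1) by (meson finite_lessThan finite_subset)
  have Sk: "S e \<subseteq> {..<k}" if "e < E" for e
    unfolding S_def using pi_bij[OF that] \<Lambda>(1)[of "u e"] by (auto simp: bij_betw_def)
  have cS: "card (S e) \<le> N" for e
    unfolding S_def using card_image_le[OF finL, of "\<pi> e" "u e"] \<Lambda>(2)[of "u e"] by linarith
  \<comment> \<open>The first greedy choice: \<open>bl x\<close> is the label offered by most edges
    at the right vertex \<open>x\<close>.\<close>
  define cnt where "cnt = (\<lambda>x b. card {e. e < E \<and> v e = x \<and> b \<in> S e})"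
  have "\<exists>b<k. \<forall>b'<k. cnt x b' \<le> cnt x b" for x
  proof -
    have "Max (cnt x ` {..<k}) \<in> cnt x ` {..<k}" using k_pos by (intro Max_in) auto
    then obtain b where b: "b < k" "cnt x b = Max (cnt x ` {..<k})" by auto
    have "cnt x b' \<le> cnt x b" if "b' < k" for b' unfolding b(2) using that by (intro Max_ge) auto
    then show ?thesis using b(1) by blast
  qed
  then obtain bl where bl: "\<And>x. bl x < k" "\<And>x b. b < k \<Longrightarrow> cnt x b \<le> cnt x (bl x)" by metis
  define G where "G = (\<lambda>e. bl (v e) \<in> S e)"
  have Co_le: "real (card (Co a)) / (real (deg a))\<^sup>2 \<le> real N * (real (card {e. e < E \<and> v e = v a \<and> G e}) / real (deg a))"
    if a: "a < E" for a
  proof -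
    let ?x = "v a"
    let ?A = "{e. e < E \<and> v e = ?x}"
    \<comment> \<open>A colliding pair is charged to its second edge \<open>e'\<close> and to one of
      the at most \<open>N\<close> labels that \<open>e'\<close> offers.\<close>
    have "Co a \<subseteq> (\<Union>e'\<in>?A. \<Union>b\<in>S e'. {e. e < E \<and> v e = ?x \<and> b \<in> S e} \<times> {e'})"
      unfolding Co_def by auto
    then have "card (Co a) \<le> card (\<Union>e'\<in>?A. \<Union>b\<in>S e'. {e. e < E \<and> v e = ?x \<and> b \<in> S e} \<times> {e'})"
      using finL by (intro card_mono) (auto simp: S_def)
    also have "\<dots> \<le> (\<Sum>e'\<in>?A. card (\<Union>b\<in>S e'. {e. e < E \<and> v e = ?x \<and> b \<in> S e} \<times> {e'}))"
      by (intro card_UN_le) auto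
    also have "\<dots> \<le> (\<Sum>e'\<in>?A. N * cnt ?x (bl ?x))"
    proof (rule sum_mono)
      fix e' assume e': "e' \<in> ?A"
      have "card (\<Union>b\<in>S e'. {e. e < E \<and> v e = ?x \<and> b \<in> S e} \<times> {e'})
         \<le> (\<Sum>b\<in>S e'. card ({e. e < E \<and> v e = ?x \<and> b \<in> S e} \<times> {e'}))"
        using finL by (intro card_UN_le) (simp add: S_def)
      also have "\<dots> = (\<Sum>b\<in>S e'. cnt ?x b)" by (simp add: cnt_def card_cartesian_product)
      also have "\<dots> \<le> (\<Sum>b\<in>S e'. cnt ?x (bl ?x))"
        using Sk[of e'] e' by (intro sum_mono bl(2)) auto
      also have "\<dots> \<le> N * cnt ?x (bl ?x)" using cS[of e'] by simp
      finally show "card (\<Union>b\<in>S e'. {e. e < E \<and> v e = ?x \<and> b \<in> S e} \<times> {e'}) \<le> N * cnt ?x (bl ?x)" .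
    qed
    also have "\<dots> = deg a * (N * cnt ?x (bl ?x))" by (simp add: deg_def)
    also have "cnt ?x (bl ?x) = card {e. e < E \<and> v e = v a \<and> G e}"
      unfolding cnt_def G_def by (rule arg_cong[where f = card]) auto
    finally have "card (Co a) \<le> deg a * (N * card {e. e < E \<and> v e = v a \<and> G e})" .
    from of_nat_mono[OF this, where 'a = real]
    have "real (card (Co a)) \<le> real (deg a) * (real N * real (card {e. e < E \<and> v e = v a \<and> G e}))"
      by (simp only: of_nat_mult)
    then show ?thesis using deg_pos[OF a] by (simp add: field_simps power2_eq_square)
  qed
  have W: "(\<Sum>a<E. real (card (Co a)) / (real (deg a))\<^sup>2) \<le> real N * real (card {e. e < E \<and> G e})"
  proof -
    have "(\<Sum>a<E. real (card (Co a)) / (real (deg a))\<^sup>2)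
       \<le> (\<Sum>a<E. real N * (real (card {e. e < E \<and> v e = v a \<and> G e}) / real (deg a)))"
      using Co_le by (intro sum_mono) auto
    then show ?thesis unfolding sum_distrib_left[symmetric] sum_average_degree .
  qed
  \<comment> \<open>The second greedy choice: among the at most \<open>N\<close> candidates at a
    left vertex, \<open>al\<close> takes the one matching \<open>bl\<close> on most edges. This
    costs the second factor \<open>N\<close>.\<close>
  define sat where "sat = (\<lambda>x a. card {e. e < E \<and> u e = x \<and> \<pi> e a = bl (v e)})"
  have "\<exists>a<k. \<forall>a'\<in>\<Lambda> x. sat x a' \<le> sat x a" for x
  proof (cases "\<Lambda> x = {}")
    case True
    then show ?thesis using k_pos by auto
  next
    case False
    have "Max (sat x ` \<Lambda> x) \<in> sat x ` \<Lambda> x" using finL False by (intro Max_in) auto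
    then obtain a where a: "a \<in> \<Lambda> x" "sat x a = Max (sat x ` \<Lambda> x)" by auto
    have "sat x a' \<le> sat x a" if "a' \<in> \<Lambda> x" for a' unfolding a(2) using that finL by (intro Max_ge) auto
    then show ?thesis using a(1) \<Lambda>(1)[of x] by blast
  qed
  then obtain al where al: "\<And>x. al x < k" "\<And>x a. a \<in> \<Lambda> x \<Longrightarrow> sat x a \<le> sat x (al x)" by metis
  let ?U = "u ` {..<E}"
  have split: "card {e. e < E \<and> P e} = (\<Sum>x\<in>?U. card {e. e < E \<and> u e = x \<and> P e})" for P
  proof -
    have "{e. e < E \<and> P e} = (\<Union>x\<in>?U. {e. e < E \<and> u e = x \<and> P e})" by auto
    then have "card {e. e < E \<and> P e} = card (\<Union>x\<in>?U. {e. e < E \<and> u e = x \<and> P e})" by (rule arg_cong)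
    also have "\<dots> = (\<Sum>x\<in>?U. card {e. e < E \<and> u e = x \<and> P e})" by (rule card_UN_disjoint) auto
    finally show ?thesis .
  qed
  have "card {e. e < E \<and> G e} \<le> (\<Sum>x\<in>?U. N * sat x (al x))"
    unfolding split[of G]
  proof (rule sum_mono)
    fix x
    have "{e. e < E \<and> u e = x \<and> G e} \<subseteq> (\<Union>a\<in>\<Lambda> x. {e. e < E \<and> u e = x \<and> \<pi> e a = bl (v e)})"
      unfolding G_def S_def by auto
    then have "card {e. e < E \<and> u e = x \<and> G e} \<le> card (\<Union>a\<in>\<Lambda> x. {e. e < E \<and> u e = x \<and> \<pi> e a = bl (v e)})"
      using finL by (intro card_mono) auto
    also have "\<dots> \<le> (\<Sum>a\<in>\<Lambda> x. sat x a)" unfolding sat_def using finL by (intro card_UN_le)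
    also have "\<dots> \<le> (\<Sum>a\<in>\<Lambda> x. sat x (al x))" by (intro sum_mono al(2))
    also have "\<dots> \<le> N * sat x (al x)" using \<Lambda>(2)[of x] by simp
    finally show "card {e. e < E \<and> u e = x \<and> G e} \<le> N * sat x (al x)" .
  qed
  also have "\<dots> = N * card {e. e < E \<and> \<pi> e (al (u e)) = bl (v e)}"
  proof -
    have "sat x (al x) = card {e. e < E \<and> u e = x \<and> \<pi> e (al (u e)) = bl (v e)}" for x
      unfolding sat_def by (rule arg_cong[where f = card]) auto
    then show ?thesis
      by (subst split[of "\<lambda>e. \<pi> e (al (u e)) = bl (v e)"]) (simp only: sum_distrib_left)
  qed
  finally have "card {e. e < E \<and> G e} \<le> N * card {e. e < E \<and> \<pi> e (al (u e)) = bl (v e)}" .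
  from of_nat_mono[OF this, where 'a = real]
  have "real (card {e. e < E \<and> G e}) \<le> real N * real (card {e. e < E \<and> \<pi> e (al (u e)) = bl (v e)})"
    by (simp only: of_nat_mult)
  then have "real N * real (card {e. e < E \<and> G e}) \<le> real N * (real N * real (card {e. e < E \<and> \<pi> e (al (u e)) = bl (v e)}))"
    by (intro mult_left_mono) auto
  moreover have "labeling I al bl" unfolding labeling_def using al(1) bl(1) by blast
  ultimately show ?thesis using that[of al bl] W by (simp add: mult.assoc)
qed

end

section \<open>Soundness of the gadget\<close>

lemma sum_PiE_three:
  fixes g :: "nat \<Rightarrow> nat \<Rightarrow> nat \<Rightarrow> real"
  assumes "finite A" "x \<in> A" "y \<in> A" "z \<in> A" "x \<noteq> y" "x \<noteq> z" "y \<noteq> z"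
  shows "(\<Sum>\<phi>\<in>PiE A (\<lambda>_. S). g (\<phi> x) (\<phi> y) (\<phi> z)) = real (card S) ^ (card A - 3) * (\<Sum>a\<in>S. \<Sum>b\<in>S. \<Sum>b'\<in>S. g a b b')"
proof -
  have c: "card (A - {x} - {y} - {z}) = card A - 3"
    using assms by (simp add: card_Diff_singleton)
  have "(\<Sum>\<phi>\<in>PiE A (\<lambda>_. S). g (\<phi> x) (\<phi> y) (\<phi> z))
     = (\<Sum>a\<in>S. \<Sum>b\<in>S. \<Sum>b'\<in>S. \<Sum>\<phi>\<in>PiE (A - {x} - {y} - {z}) (\<lambda>_. S). g a b b')"
    using assms
    by (subst sum_PiE_pick[of x]; simp; subst sum_PiE_pick[of y]; simp; subst sum_PiE_pick[of z]; simp)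
  also have "\<dots> = (\<Sum>a\<in>S. \<Sum>b\<in>S. \<Sum>b'\<in>S. real (card S) ^ (card A - 3) * g a b b')"
    using assms(1) c by (simp add: card_PiE)
  finally show ?thesis by (simp add: sum_distrib_left)
qed

context gadget
begin

definition ones :: "(nat \<Rightarrow> nat) \<Rightarrow> nat set" where "ones \<xi> = {i\<in>{..<k}. \<xi> i < c}"

lemma sum_XiS: "(\<Sum>\<xi>\<in>XiS. g (ones \<xi>)) = real m ^ k * bexp (real c / real m) {..<k} g"
  unfolding XiS_def ones_def using sum_PiE_bexp[of "{..<k}" c m g] by simp

text \<open>A union bound over the pairs of selections. For a fixed pair only three coordinates of
  the tuple matter, and each edge is selected by at most \<open>2 * E / deg a\<close> numbers, which
  gives the factor \<open>4\<close> and the squared degree.\<close>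

lemma good_tuples_collide:
  assumes sub: "good \<subseteq> PhiS"
    and coll: "\<And>\<phi>. \<phi> \<in> good \<Longrightarrow> \<exists>i\<in>{1..D}. \<exists>j\<in>{1..D}. i \<noteq> j \<and>
       (\<exists>e e'. sel (\<phi> 0) (\<phi> i) e \<and> sel (\<phi> 0) (\<phi> j) e' \<and> C e e')"
  shows "real (card good) \<le> (real D)\<^sup>2 * (real E ^ (Suc D - 3) * (4 * (real E)\<^sup>2 *
     (\<Sum>a<E. real (card {(e, e'). e < E \<and> e' < E \<and> v e = v a \<and> v e' = v a \<and> C e e'}) / (real (deg a))\<^sup>2)))"
proof -
  define Co where "Co = (\<lambda>a. {(e, e'). e < E \<and> e' < E \<and> v e = v a \<and> v e' = v a \<and> C e e'})"
  define Q where "Q = (\<lambda>a b b'. \<exists>e e'. sel a b e \<and> sel a b' e' \<and> C e e')"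
  define T where "T = (\<Sum>a<E. \<Sum>b<E. \<Sum>b'<E. of_bool (Q a b b') :: real)"
  have finCo: "finite (Co a)" for a
    by (rule finite_subset[of _ "{..<E} \<times> {..<E}"]) (auto simp: Co_def)
  have row: "(\<Sum>b<E. \<Sum>b'<E. of_bool (Q a b b') :: real) \<le> 4 * (real E)\<^sup>2 * (real (card (Co a)) / (real (deg a))\<^sup>2)"
    if a: "a < E" for a
  proof -
    have "(\<Sum>b<E. \<Sum>b'<E. of_bool (Q a b b') :: real)
       \<le> (\<Sum>b<E. \<Sum>b'<E. \<Sum>x\<in>Co a. of_bool (sel a b (fst x)) * of_bool (sel a b' (snd x)))"
    proof (intro sum_mono)
      fix b b'
      show "of_bool (Q a b b') \<le> (\<Sum>x\<in>Co a. of_bool (sel a b (fst x)) * of_bool (sel a b' (snd x)) :: real)"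
      proof (cases "Q a b b'")
        case True
        then obtain e e' where e: "sel a b e" "sel a b' e'" "C e e'" unfolding Q_def by blast
        then have mem: "(e, e') \<in> Co a" unfolding Co_def sel_def by auto
        have "of_bool (sel a b (fst (e, e'))) * of_bool (sel a b' (snd (e, e'))) \<le> (\<Sum>x\<in>Co a. of_bool (sel a b (fst x)) * of_bool (sel a b' (snd x)) :: real)"
          using finCo by (intro member_le_sum[OF mem]) auto
        then show ?thesis using True e by simp
      qed (simp add: sum_nonneg)
    qed
    also have "\<dots> = (\<Sum>b<E. \<Sum>x\<in>Co a. \<Sum>b'<E. of_bool (sel a b (fst x)) * of_bool (sel a b' (snd x)))"
      by (intro sum.cong refl sum.swap)
    also have "\<dots> = (\<Sum>x\<in>Co a. \<Sum>b<E. \<Sum>b'<E. of_bool (sel a b (fst x)) * of_bool (sel a b' (snd x)))"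
      by (rule sum.swap)
    also have "\<dots> = (\<Sum>x\<in>Co a. (\<Sum>b<E. of_bool (sel a b (fst x))) * (\<Sum>b'<E. of_bool (sel a b' (snd x))))"
      by (simp only: sum_product)
    also have "\<dots> \<le> (\<Sum>x\<in>Co a. (2 * real E / real (deg a)) * (2 * real E / real (deg a)))"
    proof (rule sum_mono)
      fix x
      have ct: "(\<Sum>b<E. of_bool (sel a b e)) = real (card {b. b < E \<and> sel a b e})" for e
      proof -
        have "{b. b < E \<and> sel a b e} = {..<E} \<inter> {b. sel a b e}" by auto
        then show ?thesis by simp
      qed
      show "(\<Sum>b<E. of_bool (sel a b (fst x))) * (\<Sum>b'<E. of_bool (sel a b' (snd x))) \<le> (2 * real E / real (deg a)) * (2 * real E / real (deg a))"
        unfolding ct using sel_count[OF a] by (intro mult_mono) auto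
    qed
    also have "\<dots> = 4 * (real E)\<^sup>2 * (real (card (Co a)) / (real (deg a))\<^sup>2)"
      by (simp add: power2_eq_square)
    finally show ?thesis .
  qed
  have T: "T \<le> 4 * (real E)\<^sup>2 * (\<Sum>a<E. real (card (Co a)) / (real (deg a))\<^sup>2)"
    unfolding T_def sum_distrib_left using row by (intro sum_mono) auto
  have pair: "real (card {\<phi>\<in>PhiS. Q (\<phi> 0) (\<phi> i) (\<phi> j)}) = real E ^ (Suc D - 3) * T" if "i \<in> {1..D}" "j \<in> {1..D}" "i \<noteq> j" for i j
  proof -
    have "{\<phi>\<in>PhiS. Q (\<phi> 0) (\<phi> i) (\<phi> j)} = PhiS \<inter> {\<phi>. Q (\<phi> 0) (\<phi> i) (\<phi> j)}" by auto
    then have "real (card {\<phi>\<in>PhiS. Q (\<phi> 0) (\<phi> i) (\<phi> j)}) = (\<Sum>\<phi>\<in>PhiS. of_bool (Q (\<phi> 0) (\<phi> i) (\<phi> j)))"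
      using finite_PhiS by simp
    also have "\<dots> = real E ^ (Suc D - 3) * T"
      unfolding PhiS_def T_def using that sum_PiE_three[of "{..<Suc D}" 0 i j "\<lambda>a b b'. of_bool (Q a b b')" "{..<E}"]
      by (simp del: sum_of_bool_eq)
    finally show ?thesis .
  qed
  let ?IJ = "{(i, j). i \<in> {1..D} \<and> j \<in> {1..D} \<and> i \<noteq> j}"
  have finIJ: "finite ?IJ" by (rule finite_subset[of _ "{1..D} \<times> {1..D}"]) auto
  have cIJ: "card ?IJ \<le> D * D"
  proof -
    have "card ?IJ \<le> card ({1..D} \<times> {1..D})" by (intro card_mono) auto
    then show ?thesis by (simp add: card_cartesian_product)
  qed
  have "good \<subseteq> (\<Union>x\<in>?IJ. {\<phi>\<in>PhiS. Q (\<phi> 0) (\<phi> (fst x)) (\<phi> (snd x))})"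
  proof
    fix \<phi> assume g: "\<phi> \<in> good"
    then obtain i j where "i \<in> {1..D}" "j \<in> {1..D}" "i \<noteq> j" "Q (\<phi> 0) (\<phi> i) (\<phi> j)"
      using coll[OF g] unfolding Q_def by blast
    then show "\<phi> \<in> (\<Union>x\<in>?IJ. {\<phi>\<in>PhiS. Q (\<phi> 0) (\<phi> (fst x)) (\<phi> (snd x))})" using sub g by force
  qed
  then have "card good \<le> card (\<Union>x\<in>?IJ. {\<phi>\<in>PhiS. Q (\<phi> 0) (\<phi> (fst x)) (\<phi> (snd x))})"
    using finIJ finite_PhiS by (intro card_mono) auto
  also have "\<dots> \<le> (\<Sum>x\<in>?IJ. card {\<phi>\<in>PhiS. Q (\<phi> 0) (\<phi> (fst x)) (\<phi> (snd x))})"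
    by (rule card_UN_le[OF finIJ])
  finally have "real (card good) \<le> (\<Sum>x\<in>?IJ. real (card {\<phi>\<in>PhiS. Q (\<phi> 0) (\<phi> (fst x)) (\<phi> (snd x))}))"
    unfolding of_nat_sum[symmetric] by (simp only: of_nat_le_iff)
  also have "\<dots> = (\<Sum>x\<in>?IJ. real E ^ (Suc D - 3) * T)" by (intro sum.cong refl) (auto simp: pair)
  also have "\<dots> \<le> (real D)\<^sup>2 * (real E ^ (Suc D - 3) * T)"
  proof -
    have "real (card ?IJ) \<le> real (D * D)" using cIJ by (simp only: of_nat_le_iff)
    moreover have "0 \<le> T" unfolding T_def by (intro sum_nonneg) auto
    ultimately show ?thesis by (simp only: sum_constant power2_eq_square of_nat_mult) (intro mult_right_mono, auto)
  qed
  also have "\<dots> \<le> (real D)\<^sup>2 * (real E ^ (Suc D - 3) * (4 * (real E)\<^sup>2 * (\<Sum>a<E. real (card (Co a)) / (real (deg a))\<^sup>2)))"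
    using T by (intro mult_left_mono) auto
  finally show ?thesis unfolding Co_def by simp
qed

text \<open>The overlap property enters as a hypothesis because \<open>\<tau>\<close> determines
  \<open>N\<close> and \<open>D\<close>, which define the graph; all three must be fixed before the
  game is known.\<close>

lemma soundness:
  assumes J: "J \<subseteq> PhiS \<times> XiS" and ind: "\<And>x y. x \<in> J \<Longrightarrow> y \<in> J \<Longrightarrow> \<not> adj x y"
    and two: "2 \<le> card J" and \<gamma>: "0 < \<gamma>"
    and large: "\<gamma> * (real E ^ Suc D * real m ^ k) < real (card J)"
    and \<tau>: "0 < \<tau>"
    and overlap: "\<And>(A :: nat set) P Q s1 s2. finite A \<Longrightarrow> mono P \<Longrightarrow> mono Q \<Longrightarrow>
      real c / real m \<le> s1 \<Longrightarrow> s1 \<le> 1/2 \<Longrightarrow> real c / real m \<le> s2 \<Longrightarrow> s2 \<le> 1/2 \<Longrightarrow>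
      \<gamma> / 2 \<le> bexp (real c / real m) A (\<lambda>F. of_bool (P F)) \<Longrightarrow> \<gamma> / 2 \<le> bexp (real c / real m) A (\<lambda>F. of_bool (Q F)) \<Longrightarrow>
      (\<Sum>i\<in>A. infl s1 A P i) \<le> 1 / (1/2 - real c / real m) \<Longrightarrow>
      (\<And>F G. F \<subseteq> A \<Longrightarrow> G \<subseteq> A \<Longrightarrow> P F \<Longrightarrow> Q G \<Longrightarrow> F \<inter> G \<noteq> {}) \<Longrightarrow>
      \<exists>i\<in>A. \<tau> \<le> infl s1 A P i \<and> \<tau> \<le> infl s2 A Q i"
    and N: "1 / (1/2 - real c / real m) / \<tau> \<le> real N" and DN: "D = Suc N" "1 \<le> N"
  obtains al bl where "labeling I al bl"
    "\<gamma> * real E \<le> 8 * (real D)\<^sup>2 * (real N)\<^sup>2 * real (card {e. e < E \<and> \<pi> e (al (u e)) = bl (v e)})"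
proof -
  define p where "p = real c / real m"
  define A where "A = {..<k}"
  \<comment> \<open>The upward closure of the label sets that occur in \<open>J\<close> together
    with the tuple \<open>\<phi>\<close>.\<close>
  define P where "P = (\<lambda>\<phi> F. \<exists>\<xi>. (\<phi>, \<xi>) \<in> J \<and> ones \<xi> \<subseteq> F)"
  define \<mu> where "\<mu> = (\<lambda>\<phi>. bexp p A (\<lambda>F. of_bool (P \<phi> F)))"
  have p: "0 < p" "p < 1/2" "0 \<le> p" "p \<le> 1" unfolding p_def using c by (auto simp: field_simps)
  have monoP: "mono (P \<phi>)" for \<phi> unfolding P_def by (intro monoI le_boolI) blast
  have finA: "finite A" by (simp add: A_def)
  have finJ: "finite J" using J finite_PhiS finite_XiS by (meson finite_SigmaI finite_subset)
  \<comment> \<open>A vertex with a loop is adjacent to all others, so none occurs in an independent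
    set of at least two vertices.\<close>
  have noloop: "\<not> adj0 x y" if "x \<in> J" "y \<in> J" for x y
  proof (cases "x = y")
    case True
    have "\<exists>z\<in>J. z \<noteq> x"
    proof (rule ccontr)
      assume "\<not> ?thesis"
      then have "J \<subseteq> {x}" by auto
      then have "card J \<le> card {x}" by (intro card_mono) auto
      then show False using two by simp
    qed
    then show ?thesis using ind that True unfolding adj_def by blast
  next
    case False
    then show ?thesis using ind[OF that] unfolding adj_def by blast
  qed
  have "real (card J) = (\<Sum>\<phi>\<in>PhiS. real (card {\<xi>\<in>XiS. (\<phi>, \<xi>) \<in> J}))"
  proof -
    have "J = Sigma PhiS (\<lambda>\<phi>. {\<xi>\<in>XiS. (\<phi>, \<xi>) \<in> J})" using J by auto
    then have "card J = card (Sigma PhiS (\<lambda>\<phi>. {\<xi>\<in>XiS. (\<phi>, \<xi>) \<in> J}))" by (rule arg_cong)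
    also have "\<dots> = (\<Sum>\<phi>\<in>PhiS. card {\<xi>\<in>XiS. (\<phi>, \<xi>) \<in> J})"
      using finite_PhiS finite_XiS by (intro card_SigmaI) auto
    finally show ?thesis by simp
  qed
  also have "\<dots> \<le> (\<Sum>\<phi>\<in>PhiS. real m ^ k * \<mu> \<phi>)"
  proof (rule sum_mono)
    fix \<phi>
    have "card {\<xi>\<in>XiS. (\<phi>, \<xi>) \<in> J} \<le> card (XiS \<inter> {\<xi>. P \<phi> (ones \<xi>)})"
      using finite_XiS by (intro card_mono) (auto simp: P_def)
    then have "real (card {\<xi>\<in>XiS. (\<phi>, \<xi>) \<in> J}) \<le> (\<Sum>\<xi>\<in>XiS. of_bool (P \<phi> (ones \<xi>)))"
      using finite_XiS by simp
    also have "\<dots> = real m ^ k * \<mu> \<phi>" unfolding \<mu>_def p_def A_def using sum_XiS[of "\<lambda>F. of_bool (P \<phi> F)"] .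
    finally show "real (card {\<xi>\<in>XiS. (\<phi>, \<xi>) \<in> J}) \<le> real m ^ k * \<mu> \<phi>" .
  qed
  finally have J_le: "real (card J) \<le> real m ^ k * (\<Sum>\<phi>\<in>PhiS. \<mu> \<phi>)" by (simp add: sum_distrib_left)
  \<comment> \<open>Averaging: since the mean of \<open>\<mu>\<close> exceeds
    \<open>\<gamma>\<close>, at least a fraction \<open>\<gamma> / 2\<close> of the tuples has
    measure at least \<open>\<gamma> / 2\<close>.\<close>
  define good where "good = {\<phi>\<in>PhiS. \<gamma> / 2 \<le> \<mu> \<phi>}"
  have good_sub: "good \<subseteq> PhiS" and fin_good: "finite good" using finite_PhiS by (auto simp: good_def)
  have "(\<Sum>\<phi>\<in>PhiS. \<mu> \<phi>) \<le> (\<Sum>\<phi>\<in>PhiS. of_bool (\<phi> \<in> good) + \<gamma> / 2)"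
  proof (rule sum_mono)
    fix \<phi> assume "\<phi> \<in> PhiS"
    have "\<mu> \<phi> \<le> bexp p A (\<lambda>_. 1)" unfolding \<mu>_def using p by (intro bexp_mono) auto
    then have "\<mu> \<phi> \<le> 1" using finA by (simp add: bexp_const)
    then show "\<mu> \<phi> \<le> of_bool (\<phi> \<in> good) + \<gamma> / 2" using \<gamma> \<open>\<phi> \<in> PhiS\<close> by (auto simp: good_def)
  qed
  also have "\<dots> = real (card good) + real E ^ Suc D * (\<gamma> / 2)"
  proof -
    have "PhiS \<inter> {\<phi>. \<phi> \<in> good} = good" using good_sub by auto
    then show ?thesis using finite_PhiS card_PhiS by (simp add: sum.distrib del: power_Suc)
  qed
  finally have "real m ^ k * (\<Sum>\<phi>\<in>PhiS. \<mu> \<phi>) \<le> real m ^ k * (real (card good) + real E ^ Suc D * (\<gamma> / 2))"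
    by (intro mult_left_mono) auto
  then have "real m ^ k * (\<gamma> * real E ^ Suc D) \<le> real m ^ k * (real (card good) + real E ^ Suc D * (\<gamma> / 2))"
    using J_le large by (simp only: mult_ac)
  moreover have "0 < real m ^ k" by simp
  ultimately have "\<gamma> * real E ^ Suc D \<le> real (card good) + real E ^ Suc D * (\<gamma> / 2)"
    by (simp only: mult_le_cancel_left_pos)
  then have many: "\<gamma> / 2 * real E ^ Suc D \<le> real (card good)"
    by (simp add: algebra_simps del: power_Suc)
  \<comment> \<open>The bias with bounded total influence is specific to the family, so one is
    chosen for every tuple.\<close>
  define s where "s = (\<lambda>\<phi>. SOME s. p < s \<and> s < 1/2 \<and> (\<Sum>i\<in>A. infl s A (P \<phi>) i) \<le> 1 / (1/2 - p))"
  have s: "p < s \<phi>" "s \<phi> < 1/2" "(\<Sum>i\<in>A. infl (s \<phi>) A (P \<phi>) i) \<le> 1 / (1/2 - p)" for \<phi>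
  proof -
    obtain t where "p < t \<and> t < 1/2 \<and> (\<Sum>i\<in>A. infl t A (P \<phi>) i) \<le> 1 / (1/2 - p)"
      using small_total_influence[OF finA p(1,2), of "P \<phi>"] by blast
    then have "p < s \<phi> \<and> s \<phi> < 1/2 \<and> (\<Sum>i\<in>A. infl (s \<phi>) A (P \<phi>) i) \<le> 1 / (1/2 - p)"
      unfolding s_def by (rule someI)
    then show "p < s \<phi>" "s \<phi> < 1/2" "(\<Sum>i\<in>A. infl (s \<phi>) A (P \<phi>) i) \<le> 1 / (1/2 - p)" by auto
  qed
  define L where "L = (\<lambda>\<phi>. {i\<in>A. \<tau> \<le> infl (s \<phi>) A (P \<phi>) i})"
  have L: "L \<phi> \<subseteq> A" "finite (L \<phi>)" "card (L \<phi>) \<le> N" for \<phi>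
  proof -
    show fin: "L \<phi> \<subseteq> A" "finite (L \<phi>)" using finA by (auto simp: L_def)
    have "real (card (L \<phi>)) * \<tau> = (\<Sum>i\<in>L \<phi>. \<tau>)" by simp
    also have "\<dots> \<le> (\<Sum>i\<in>L \<phi>. infl (s \<phi>) A (P \<phi>) i)" by (intro sum_mono) (auto simp: L_def)
    also have "\<dots> \<le> (\<Sum>i\<in>A. infl (s \<phi>) A (P \<phi>) i)"
      using finA fin s[of \<phi>] p by (intro sum_mono2 infl_nonneg[OF monoP]) auto
    also have "\<dots> \<le> 1 / (1/2 - p)" by (rule s(3))
    finally have "real (card (L \<phi>)) \<le> 1 / (1/2 - p) / \<tau>" using \<tau> by (simp only: pos_le_divide_eq)
    then show "card (L \<phi>) \<le> N" using N unfolding p_def by linarith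
  qed
  have pim: "\<pi> e ` A = A" "inj_on (\<pi> e) A" if "e < E" for e
    using pi_bij[OF that] unfolding A_def by (auto simp: bij_betw_def)
  \<comment> \<open>Pulled back along \<open>\<pi> e\<close> and \<open>\<pi> e'\<close>, both
    families live on the labels of the common left vertex. They cross-intersect because no two
    members of \<open>J\<close> are related by \<open>adj0\<close>.\<close>
  have cross: "\<exists>a\<in>A. \<pi> e a \<in> L \<phi> \<and> \<pi> e' a \<in> L \<phi>'"
    if g: "\<phi> \<in> good" "\<phi>' \<in> good" and ij: "i \<in> {1..D}" "j \<in> {1..D}"
      and se: "sel (\<phi> 0) (\<phi> i) e" "sel (\<phi>' 0) (\<phi>' j) e'" and ue: "u e = u e'" for \<phi> \<phi>' i j e e'
  proof -
    have e: "e < E" "e' < E" using se by (auto simp: sel_def)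
    let ?P = "\<lambda>F. P \<phi> (\<pi> e ` F)" and ?Q = "\<lambda>F. P \<phi>' (\<pi> e' ` F)"
    have infl_eq: "infl t A (\<lambda>F. P \<psi> (\<pi> f ` F)) a = infl t A (P \<psi>) (\<pi> f a)" if "a \<in> A" "f < E" for t \<psi> f a
      using infl_image[OF finA pim(2)[OF that(2)] that(1), of t "P \<psi>"] pim(1)[OF that(2)] by simp
    have bexp_eq: "bexp p A (\<lambda>F. of_bool (P \<psi> (\<pi> f ` F))) = \<mu> \<psi>" if "f < E" for \<psi> f
      using bexp_image[OF finA pim(2)[OF that], of p "\<lambda>F. of_bool (P \<psi> F)"] pim(1)[OF that] by (simp add: \<mu>_def)
    have "\<exists>a\<in>A. \<tau> \<le> infl (s \<phi>) A ?P a \<and> \<tau> \<le> infl (s \<phi>') A ?Q a"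
    proof (rule overlap[folded p_def, OF finA])
      show "mono ?P" "mono ?Q" by (intro monoI monoD[OF monoP] image_mono; assumption)+
      show "p \<le> s \<phi>" "s \<phi> \<le> 1/2" "p \<le> s \<phi>'" "s \<phi>' \<le> 1/2" using s[of \<phi>] s[of \<phi>'] by auto
      show "\<gamma> / 2 \<le> bexp p A (\<lambda>F. of_bool (?P F))" "\<gamma> / 2 \<le> bexp p A (\<lambda>F. of_bool (?Q F))"
        unfolding bexp_eq[OF e(1)] bexp_eq[OF e(2)] using g by (auto simp: good_def)
      have "(\<Sum>a\<in>A. infl (s \<phi>) A ?P a) = (\<Sum>a\<in>A. infl (s \<phi>) A (P \<phi>) (\<pi> e a))"
        by (intro sum.cong refl infl_eq e)
      also have "\<dots> = (\<Sum>i\<in>A. infl (s \<phi>) A (P \<phi>) i)"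
        using sum.reindex[OF pim(2)[OF e(1)], of "infl (s \<phi>) A (P \<phi>)"] pim(1)[OF e(1)] by simp
      finally show "(\<Sum>a\<in>A. infl (s \<phi>) A ?P a) \<le> 1 / (1/2 - p)" using s(3)[of \<phi>] by simp
    next
      fix F G assume FG: "F \<subseteq> A" "G \<subseteq> A" "?P F" "?Q G"
      obtain \<xi> \<xi>' where x: "(\<phi>, \<xi>) \<in> J" "ones \<xi> \<subseteq> \<pi> e ` F" "(\<phi>', \<xi>') \<in> J" "ones \<xi>' \<subseteq> \<pi> e' ` G"
        using FG(3,4) unfolding P_def by blast
      have "\<not> adj0 (\<phi>, \<xi>) (\<phi>', \<xi>')" using noloop x by blast
      then obtain a where a: "a < k" "\<xi> (\<pi> e a) < c" "\<xi>' (\<pi> e' a) < c"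
        using ij se ue e unfolding adj0_def fst_conv snd_conv by blast
      have aA: "a \<in> A" using a by (simp add: A_def)
      have "\<pi> e a \<in> A" "\<pi> e' a \<in> A" using pim(1)[OF e(1)] pim(1)[OF e(2)] aA by auto
      then have "\<pi> e a \<in> \<pi> e ` F" "\<pi> e' a \<in> \<pi> e' ` G" using a x unfolding ones_def A_def by auto
      then have "a \<in> F" "a \<in> G"
        using inj_on_image_mem_iff[OF pim(2)[OF e(1)] aA FG(1)] inj_on_image_mem_iff[OF pim(2)[OF e(2)] aA FG(2)] by auto
      then show "F \<inter> G \<noteq> {}" by auto
    qed
    then obtain a where a: "a \<in> A" "\<tau> \<le> infl (s \<phi>) A ?P a" "\<tau> \<le> infl (s \<phi>') A ?Q a" by blast
    have "\<pi> e a \<in> A" "\<pi> e' a \<in> A" using pim(1)[OF e(1)] pim(1)[OF e(2)] a(1) by auto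
    then show ?thesis using a infl_eq[OF a(1) e(1)] infl_eq[OF a(1) e(2)] unfolding L_def by auto
  qed
  \<comment> \<open>For every left vertex that a good tuple reaches, one witness is fixed; its
    influential labels, pulled back to that vertex, are the candidates \<open>\<Lambda>\<close>. By
    \<open>cross\<close> every other good tuple arriving there shares one of them.\<close>
  define W where "W = (\<lambda>x t. case t of (\<phi>, i, e) \<Rightarrow> \<phi> \<in> good \<and> i \<in> {1..D} \<and> sel (\<phi> 0) (\<phi> i) e \<and> u e = x)"
  define rep where "rep = (\<lambda>x. SOME t. W x t)"
  define \<Lambda> where "\<Lambda> = (\<lambda>x. if \<exists>t. W x t then {a\<in>A. \<pi> (snd (snd (rep x))) a \<in> L (fst (rep x))} else {})"
  have \<Lambda>A: "\<Lambda> x \<subseteq> {..<k}" for x unfolding \<Lambda>_def A_def by auto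
  have rep: "W x (rep x)" if "W x t" for x t unfolding rep_def using that by (rule someI)
  have \<Lambda>N: "card (\<Lambda> x) \<le> N" for x
  proof (cases "\<exists>t. W x t")
    case True
    let ?e = "snd (snd (rep x))"
    have "W x (rep x)" using True rep by blast
    then have e: "?e < E" unfolding W_def sel_def by (auto split: prod.splits)
    have "card (\<Lambda> x) \<le> card (L (fst (rep x)))"
    proof (rule card_inj_on_le[where f = "\<pi> ?e"])
      show "inj_on (\<pi> ?e) (\<Lambda> x)" using pim(2)[OF e] \<Lambda>A unfolding A_def by (rule inj_on_subset)
      show "\<pi> ?e ` \<Lambda> x \<subseteq> L (fst (rep x))" using True unfolding \<Lambda>_def by auto
    qed (rule L(2))
    then show ?thesis using L(3)[of "fst (rep x)"] by linarith
  qed (simp add: \<Lambda>_def)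
  have hit: "L \<phi> \<inter> \<pi> e ` \<Lambda> (u e) \<noteq> {}"
    if g: "\<phi> \<in> good" and i: "i \<in> {1..D}" and se: "sel (\<phi> 0) (\<phi> i) e" for \<phi> i e
  proof -
    have w: "W (u e) (\<phi>, i, e)" using that unfolding W_def by simp
    obtain \<psi> j f where r: "rep (u e) = (\<psi>, j, f)" by (metis prod_cases3)
    have "\<psi> \<in> good" "j \<in> {1..D}" "sel (\<psi> 0) (\<psi> j) f" "u f = u e" using rep[OF w] unfolding r W_def by auto
    then obtain a where "a \<in> A" "\<pi> e a \<in> L \<phi>" "\<pi> f a \<in> L \<psi>"
      using cross[OF g _ i _ se, of \<psi> j f] by auto
    then have "a \<in> \<Lambda> (u e)" using w unfolding \<Lambda>_def r by auto
    then show ?thesis using \<open>\<pi> e a \<in> L \<phi>\<close> by auto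
  qed
  define C where "C = (\<lambda>e e'. \<pi> e ` \<Lambda> (u e) \<inter> \<pi> e' ` \<Lambda> (u e') \<noteq> {})"
  have coll: "\<exists>i\<in>{1..D}. \<exists>j\<in>{1..D}. i \<noteq> j \<and> (\<exists>e e'. sel (\<phi> 0) (\<phi> i) e \<and> sel (\<phi> 0) (\<phi> j) e' \<and> C e e')"
    if g: "\<phi> \<in> good" for \<phi>
  proof -
    have "\<phi> 0 < E" using g good_sub PhiS_lt by auto
    then have ex: "\<exists>e. sel (\<phi> 0) (\<phi> i) e" for i by (rule sel_exists)
    define es where "es = (\<lambda>i. SOME e. sel (\<phi> 0) (\<phi> i) e)"
    have es: "sel (\<phi> 0) (\<phi> i) (es i)" for i unfolding es_def using ex by (rule someI_ex)
    define xs where "xs = (\<lambda>i. SOME x. x \<in> L \<phi> \<inter> \<pi> (es i) ` \<Lambda> (u (es i)))"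
    have xs: "xs i \<in> L \<phi> \<inter> \<pi> (es i) ` \<Lambda> (u (es i))" if "i \<in> {1..D}" for i
      unfolding xs_def some_in_eq by (rule hit[OF g that es])
    \<comment> \<open>Each of the \<open>D = Suc N\<close> selections yields one of at most
      \<open>N\<close> influential labels, so two of them yield the same one.\<close>
    have "\<not> inj_on xs {1..D}"
    proof
      assume "inj_on xs {1..D}"
      then have "card {1..D} \<le> card (L \<phi>)" using xs L(2) by (intro card_inj_on_le[of xs]) auto
      then show False using L(3)[of \<phi>] DN by simp
    qed
    then obtain i j where ij: "i \<in> {1..D}" "j \<in> {1..D}" "i \<noteq> j" "xs i = xs j" unfolding inj_on_def by blast
    then have "C (es i) (es j)" unfolding C_def using xs[OF ij(1)] xs[OF ij(2)] by auto
    then show ?thesis using ij es by blast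
  qed
  define WW where "WW = (\<Sum>a<E. real (card {(e, e'). e < E \<and> e' < E \<and> v e = v a \<and> v e' = v a \<and> C e e'}) / (real (deg a))\<^sup>2)"
  have "\<gamma> / 2 * real E ^ Suc D \<le> (real D)\<^sup>2 * (real E ^ (Suc D - 3) * (4 * (real E)\<^sup>2 * WW))"
    using many good_tuples_collide[OF good_sub coll] unfolding WW_def by linarith
  \<comment> \<open>As \<open>D = Suc N\<close> and \<open>1 \<le> N\<close>, the subtraction in
    \<open>Suc D - 3\<close> does not truncate.\<close>
  moreover have "real E ^ Suc D = real E ^ (Suc D - 3) * (real E)\<^sup>2 * real E"
  proof -
    obtain d where d: "Suc D = d + 3" using DN by (intro that[of "N - 1"]) simp
    show ?thesis unfolding d by (simp add: power_add power2_eq_square power3_eq_cube)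
  qed
  ultimately have "(real E ^ (Suc D - 3) * (real E)\<^sup>2) * (\<gamma> / 2 * real E) \<le> (real E ^ (Suc D - 3) * (real E)\<^sup>2) * (4 * (real D)\<^sup>2 * WW)"
    by (simp only: mult_ac)
  moreover have "0 < real E ^ (Suc D - 3) * (real E)\<^sup>2" using E_pos by simp
  ultimately have "\<gamma> / 2 * real E \<le> 4 * (real D)\<^sup>2 * WW" by (simp only: mult_le_cancel_left_pos)
  then have a: "\<gamma> * real E \<le> 8 * (real D)\<^sup>2 * WW" by simp
  show ?thesis
  proof (rule labeling_from_collisions[OF \<Lambda>A \<Lambda>N])
    fix al bl
    assume lab: "labeling I al bl" and
      "(\<Sum>a<E. real (card {(e, e'). e < E \<and> e' < E \<and> v e = v a \<and> v e' = v a \<and>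
          \<pi> e ` \<Lambda> (u e) \<inter> \<pi> e' ` \<Lambda> (u e') \<noteq> {}}) / (real (deg a))\<^sup>2)
        \<le> real N * real N * real (card {e. e < E \<and> \<pi> e (al (u e)) = bl (v e)})"
    then have ab: "WW \<le> real N * real N * real (card {e. e < E \<and> \<pi> e (al (u e)) = bl (v e)})"
      unfolding WW_def C_def by simp
    have "8 * (real D)\<^sup>2 * WW \<le> 8 * (real D)\<^sup>2 * (real N * real N * real (card {e. e < E \<and> \<pi> e (al (u e)) = bl (v e)}))"
      using ab by (intro mult_left_mono) auto
    then have "\<gamma> * real E \<le> 8 * (real D)\<^sup>2 * (real N)\<^sup>2 * real (card {e. e < E \<and> \<pi> e (al (u e)) = bl (v e)})"
      using a by (simp only: power2_eq_square mult.assoc)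
    then show thesis by (rule that[OF lab])
  qed
qed

end

section \<open>Completeness\<close>

lemma sum_PiE_two:
  fixes g :: "nat \<Rightarrow> nat \<Rightarrow> real"
  assumes "finite A" "x \<in> A" "y \<in> A" "x \<noteq> y"
  shows "(\<Sum>\<phi>\<in>PiE A (\<lambda>_. S). g (\<phi> x) (\<phi> y)) = real (card S) ^ (card A - 2) * (\<Sum>a\<in>S. \<Sum>b\<in>S. g a b)"
proof -
  have c: "card (A - {x} - {y}) = card A - 2"
    using assms by (simp add: card_Diff_singleton)
  have "(\<Sum>\<phi>\<in>PiE A (\<lambda>_. S). g (\<phi> x) (\<phi> y))
     = (\<Sum>a\<in>S. \<Sum>b\<in>S. \<Sum>\<phi>\<in>PiE (A - {x} - {y}) (\<lambda>_. S). g a b)"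
    using assms by (subst sum_PiE_pick[of x]; simp; subst sum_PiE_pick[of y]; simp)
  also have "\<dots> = (\<Sum>a\<in>S. \<Sum>b\<in>S. real (card S) ^ (card A - 2) * g a b)"
    using assms(1) c by (simp add: card_PiE)
  finally show ?thesis by (simp add: sum_distrib_left)
qed

lemma bexp_member:
  assumes "finite A" "j \<in> A"
  shows "bexp s A (\<lambda>F. of_bool (j \<in> F)) = s"
proof -
  have "bexp s (insert j (A - {j})) (\<lambda>F. of_bool (j \<in> F)) = s * bexp s (A - {j}) (\<lambda>F. 1) + (1 - s) * bexp s (A - {j}) (\<lambda>F. 0)"
    using assms by (subst bexp_insert) (auto intro!: bexp_cong arg_cong2[where f = "(+)"] arg_cong2[where f = "(*)"])
  then show ?thesis using assms by (simp add: bexp_const insert_absorb)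
qed

lemma digit_of_mod:
  fixes h m :: nat
  assumes "i < k"
  shows "h mod m ^ k div m ^ i mod m = h div m ^ i mod m"
proof (cases "m = 0")
  case False
  have "m ^ k = m ^ i * m ^ (k - i)" using assms by (simp add: power_add[symmetric])
  then have "h mod m ^ k = m ^ i * (h div m ^ i mod m ^ (k - i)) + h mod m ^ i" by (simp add: mod_mult2_eq)
  then have "h mod m ^ k div m ^ i = h div m ^ i mod m ^ (k - i)" using False by simp
  moreover have "m dvd m ^ (k - i)" using assms by (simp add: dvd_power)
  ultimately show ?thesis by (simp add: mod_mod_cancel)
qed (use assms in \<open>simp add: zero_power\<close>)

context gadget
begin

definition n where "n = E ^ Suc D * m ^ k"

text \<open>Mixed radix: the \<open>k\<close> low digits in base \<open>m\<close> are the cube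
  point, the \<open>Suc D\<close> digits in base \<open>E\<close> above them the tuple.\<close>

definition dec :: "nat \<Rightarrow> (nat \<Rightarrow> nat) \<times> (nat \<Rightarrow> nat)" where
  "dec h = (\<lambda>i\<in>{..<Suc D}. h div (m ^ k * E ^ i) mod E, \<lambda>i\<in>{..<k}. h div m ^ i mod m)"

lemma bij_dec: "bij_betw dec {..<n} (PhiS \<times> XiS)"
proof -
  let ?f = "\<lambda>x. \<lambda>i\<in>{..<Suc D}. x div E ^ i mod E" and ?g = "\<lambda>x. \<lambda>i\<in>{..<k}. x div m ^ i mod m"
  have f: "bij_betw ?f {..<E ^ Suc D} PhiS" unfolding PhiS_def using E_pos by (rule bij_betw_digits)
  have g: "bij_betw ?g {..<m ^ k} XiS" unfolding XiS_def by (rule bij_betw_digits) simp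
  have "bij_betw (map_prod ?f ?g) ({..<E ^ Suc D} \<times> {..<m ^ k}) (PhiS \<times> XiS)"
    using f g unfolding bij_betw_def by (auto intro: map_prod_inj_on simp: map_prod_surj_on)
  moreover have "bij_betw (\<lambda>x. (x div m ^ k, x mod m ^ k)) {..<n} ({..<E ^ Suc D} \<times> {..<m ^ k})"
    unfolding n_def by (rule bij_betw_div_mod) simp
  ultimately have "bij_betw (map_prod ?f ?g \<circ> (\<lambda>x. (x div m ^ k, x mod m ^ k))) {..<n} (PhiS \<times> XiS)"
    by (rule bij_betw_trans[rotated])
  moreover have "map_prod ?f ?g \<circ> (\<lambda>x. (x div m ^ k, x mod m ^ k)) = dec"
  proof
    fix h
    show "(map_prod ?f ?g \<circ> (\<lambda>x. (x div m ^ k, x mod m ^ k))) h = dec h"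
      unfolding dec_def using digit_of_mod[of _ k h m]
      by (auto simp: div_mult2_eq fun_eq_iff restrict_def)
  qed
  ultimately show ?thesis by simp
qed

definition H :: ugraph where
  "H = \<lparr>order = n, uedges = {{h, h'} | h h'. h < n \<and> h' < n \<and> adj (dec h) (dec h')}\<rparr>"

lemma H_edge: "{h, h'} \<in> uedges H \<longleftrightarrow> h < n \<and> h' < n \<and> adj (dec h) (dec h')"
  unfolding H_def using adj_sym[of "dec h" "dec h'"] adj_sym[of "dec h'" "dec h"] by (auto simp: doubleton_eq_iff)

lemma wf_H: "wf_ugraph H"
proof -
  have "card {h, h'} = 2" if "adj (dec h) (dec h')" for h h'
    using that unfolding adj_def by (cases "h = h'") auto
  then show ?thesis unfolding wf_ugraph_def verts_def H_def by auto
qed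

lemma order_H: "order H = n" by (simp add: H_def)

lemma independent_H: "independent_set H S \<longleftrightarrow> S \<subseteq> {..<n} \<and> (\<forall>x\<in>dec ` S. \<forall>y\<in>dec ` S. \<not> adj x y)"
  unfolding independent_set_def verts_def H_edge order_H by auto

lemma dec_image: "S \<subseteq> {..<n} \<Longrightarrow> dec ` S \<subseteq> PhiS \<times> XiS \<and> card (dec ` S) = card S"
  using bij_dec by (auto simp: bij_betw_def dest: inj_on_subset intro!: card_image)

lemma card_V: "card (PhiS \<times> XiS) = n"
  by (simp add: card_cartesian_product card_PhiS card_XiS n_def)

text \<open>Reflecting every digit of the cube point pairs each vertex with a neighbour: a label set
  and that of its reflection are disjoint. An independent set contains at most one vertex of each
  pair.\<close>

lemma OPT_H_le_half: "2 * OPT H \<le> n"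
proof -
  obtain S where S: "independent_set H S" "card S = OPT H"
    using maximum_independent_set_exists[of H] unfolding maximum_independent_set_def by blast
  define T where "T = dec ` S"
  have T: "T \<subseteq> PhiS \<times> XiS" "card T = card S" "\<And>x y. x \<in> T \<Longrightarrow> y \<in> T \<Longrightarrow> \<not> adj x y"
    using S(1) dec_image[of S] unfolding independent_H T_def by auto
  define \<sigma> where "\<sigma> = (\<lambda>x :: (nat \<Rightarrow> nat) \<times> (nat \<Rightarrow> nat). (fst x, \<lambda>i\<in>{..<k}. m - 1 - snd x i))"
  have \<xi>lt: "snd x i \<le> m - 1" if "x \<in> PhiS \<times> XiS" "i < k" for x i
  proof -
    have "snd x \<in> PiE {..<k} (\<lambda>_. {..<m})" using that unfolding XiS_def by (simp add: mem_Times_iff)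
    from PiE_mem[OF this, of i] have "snd x i \<in> {..<m}" using that(2) by simp
    then show ?thesis by simp
  qed
  have inv: "\<sigma> (\<sigma> x) = x" if "x \<in> PhiS \<times> XiS" for x
  proof -
    have "(\<lambda>i\<in>{..<k}. m - 1 - (\<lambda>i\<in>{..<k}. m - 1 - snd x i) i) = snd x"
    proof
      fix i
      show "(\<lambda>i\<in>{..<k}. m - 1 - (\<lambda>i\<in>{..<k}. m - 1 - snd x i) i) i = snd x i"
      proof (cases "i < k")
        case True
        then show ?thesis using \<xi>lt[OF that True] by simp
      next
        case False
        have "snd x \<in> PiE {..<k} (\<lambda>_. {..<m})" using that unfolding XiS_def by (simp add: mem_Times_iff)
        from PiE_arb[OF this, of i] show ?thesis using False by simp
      qed
    qed
    then show ?thesis by (simp add: \<sigma>_def)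
  qed
  have into: "\<sigma> x \<in> PhiS \<times> XiS" if "x \<in> PhiS \<times> XiS" for x
  proof -
    have "(\<lambda>i\<in>{..<k}. m - 1 - snd x i) \<in> PiE {..<k} (\<lambda>_. {..<m})"
      unfolding restrict_PiE_iff by auto
    then show ?thesis using that by (auto simp: \<sigma>_def XiS_def)
  qed
  have adj_\<sigma>: "adj x (\<sigma> x)" if x: "x \<in> PhiS \<times> XiS" for x
  proof -
    have "fst x 0 < E" using x PhiS_lt by auto
    then obtain e where e: "sel (fst x 0) (fst x 1) e" using sel_exists by blast
    have eE: "e < E" using e by (simp add: sel_def)
    have "\<not> (snd x (\<pi> e a) < c \<and> snd (\<sigma> x) (\<pi> e a) < c)" if "a < k" for a
    proof -
      have "\<pi> e a < k" using pi_bij[OF eE] that by (auto simp: bij_betw_def)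
      then show ?thesis using \<xi>lt[OF x, of "\<pi> e a"] by (auto simp: \<sigma>_def)
    qed
    moreover have "fst (\<sigma> x) = fst x" by (simp add: \<sigma>_def)
    ultimately have "adj0 x (\<sigma> x)" unfolding adj0_def using e eE D
      by (intro bexI[of _ 1] exI[of _ e] conjI) auto
    \<comment> \<open>A fixed digit would satisfy \<open>2 * i = 2 * c + 1\<close>.\<close>
    moreover have "snd (\<sigma> x) 0 \<noteq> snd x 0"
    proof -
      have "snd (\<sigma> x) 0 = m - 1 - snd x 0" using k_pos by (simp add: \<sigma>_def)
      moreover have "snd x 0 \<le> m - 1" using \<xi>lt[OF x k_pos] .
      moreover have "2 * y \<noteq> 2 * c + 1" for y by presburger
      moreover have "snd x 0 \<le> m - 1 \<Longrightarrow> m - 1 - snd x 0 = snd x 0 \<Longrightarrow> 2 * snd x 0 = 2 * c + 1" by simp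
      ultimately show ?thesis by auto
    qed
    ultimately show ?thesis unfolding adj_def by metis
  qed
  have "T \<inter> \<sigma> ` T = {}" using adj_\<sigma> T(1,3) by blast
  moreover have "inj_on \<sigma> T" using inv T(1) by (intro inj_on_inverseI[of _ \<sigma>]) auto
  moreover have fin: "finite (PhiS \<times> XiS)" using finite_PhiS finite_XiS by simp
  moreover have "finite T" using T(1) fin finite_subset by blast
  ultimately have "card (T \<union> \<sigma> ` T) = 2 * card T" by (simp add: card_Un_disjoint card_image)
  moreover have "card (T \<union> \<sigma> ` T) \<le> card (PhiS \<times> XiS)"
    using T(1) into by (intro card_mono fin) blast
  ultimately show ?thesis using T(2) S(2) card_V by simp
qed

text \<open>Over each tuple whose selected edges are all satisfied, take the dictator set of the
  label \<open>bl\<close> of its right vertex, of measure \<open>c / m\<close>. If two selected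
  edges share a left vertex, the label \<open>al\<close> of that vertex lies in both transported
  sets.\<close>

lemma completeness:
  assumes lab: "labeling I al bl"
    and bad: "real (card {e. e < E \<and> \<pi> e (al (u e)) \<noteq> bl (v e)}) \<le> \<epsilon> * real E"
  shows "(1 - 2 * real D * \<epsilon>) * (real c / real m) * real n \<le> real (OPT H)"
proof -
  define sat where "sat = (\<lambda>e. \<pi> e (al (u e)) = bl (v e))"
  define ok where "ok = {\<phi>\<in>PhiS. \<forall>i\<in>{1..D}. \<forall>e. sel (\<phi> 0) (\<phi> i) e \<longrightarrow> sat e}"
  define lb where "lb = (\<lambda>\<phi> :: nat \<Rightarrow> nat. bl (v (\<phi> 0)))"
  define T where "T = Sigma ok (\<lambda>\<phi>. {\<xi>\<in>XiS. \<xi> (lb \<phi>) < c})"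
  have noadj0: "\<not> adj0 x y" if xy: "x \<in> T" "y \<in> T" for x y
  proof
    assume "adj0 x y"
    then obtain i j e e' where ij: "i \<in> {1..D}" "j \<in> {1..D}" "sel (fst x 0) (fst x i) e" "sel (fst y 0) (fst y j) e'"
      and ue: "u e = u e'" and no: "\<forall>a<k. \<not> (snd x (\<pi> e a) < c \<and> snd y (\<pi> e' a) < c)"
      unfolding adj0_def by blast
    have "fst x \<in> ok" "fst y \<in> ok" "snd x (lb (fst x)) < c" "snd y (lb (fst y)) < c" using xy unfolding T_def by auto
    moreover from this have "sat e" "sat e'" using ij unfolding ok_def by auto
    moreover have "v e = v (fst x 0)" "v e' = v (fst y 0)" "e < E" using ij by (auto simp: sel_def)
    ultimately have "snd x (\<pi> e (al (u e))) < c" "snd y (\<pi> e' (al (u e))) < c"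
      using ue unfolding sat_def lb_def by auto
    moreover have "al (u e) < k" using lab wf_edge(1)[OF wf \<open>e < E\<close>] unfolding labeling_def by auto
    ultimately show False using no by blast
  qed
  have Tsub: "T \<subseteq> PhiS \<times> XiS" unfolding T_def ok_def by auto
  define S where "S = {h\<in>{..<n}. dec h \<in> T}"
  have decS: "dec ` S = T"
  proof -
    have "T \<subseteq> dec ` {..<n}" using Tsub bij_betw_imp_surj_on[OF bij_dec] by simp
    then show ?thesis unfolding S_def by blast
  qed
  have "independent_set H S" unfolding independent_H decS using noadj0 unfolding adj_def S_def by auto
  then have "card S \<le> OPT H" by (rule card_le_OPT)
  moreover have "S \<subseteq> {..<n}" unfolding S_def by auto
  then have "card S = card T" using dec_image[of S] decS by simp
  ultimately have a1: "real (card T) \<le> real (OPT H)" by simp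
  have a2: "real (card T) = real (card ok) * (real m ^ k * (real c / real m))"
  proof -
    have "real (card {\<xi>\<in>XiS. \<xi> (lb \<phi>) < c}) = real m ^ k * (real c / real m)" if "\<phi> \<in> ok" for \<phi>
    proof -
      have "\<phi> 0 < E" using that PhiS_lt unfolding ok_def by auto
      then have lk: "lb \<phi> < k" using lab wf_edge(2)[OF wf] unfolding labeling_def lb_def by auto
      have "{\<xi>\<in>XiS. \<xi> (lb \<phi>) < c} = XiS \<inter> {\<xi>. lb \<phi> \<in> ones \<xi>}" using lk by (auto simp: ones_def)
      then have "real (card {\<xi>\<in>XiS. \<xi> (lb \<phi>) < c}) = (\<Sum>\<xi>\<in>XiS. of_bool (lb \<phi> \<in> ones \<xi>))" using finite_XiS by simp
      also have "\<dots> = real m ^ k * bexp (real c / real m) {..<k} (\<lambda>F. of_bool (lb \<phi> \<in> F))"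
        by (rule sum_XiS)
      also have "\<dots> = real m ^ k * (real c / real m)" using lk by (subst bexp_member) auto
      finally show ?thesis .
    qed
    moreover have "card T = (\<Sum>\<phi>\<in>ok. card {\<xi>\<in>XiS. \<xi> (lb \<phi>) < c})"
      unfolding T_def using finite_PhiS finite_XiS by (intro card_SigmaI) (auto simp: ok_def)
    ultimately show ?thesis by simp
  qed
  \<comment> \<open>A union bound over the \<open>D\<close> selections. Each hits a violated edge
    with probability at most \<open>2 * \<epsilon>\<close>, the \<open>2\<close> being the price of
    selecting by a remainder.\<close>
  have a3: "(1 - 2 * real D * \<epsilon>) * real E ^ Suc D \<le> real (card ok)"
  proof -
    define Q where "Q = (\<lambda>a b. \<exists>e. sel a b e \<and> \<not> sat e)"
    have T2: "(\<Sum>a<E. \<Sum>b<E. of_bool (Q a b) :: real) \<le> 2 * real E * (\<epsilon> * real E)"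
    proof -
      have row: "(\<Sum>b<E. of_bool (Q a b) :: real) \<le> 2 * real E * (real (card {e. e < E \<and> v e = v a \<and> \<not> sat e}) / real (deg a))"
        if a: "a < E" for a
      proof -
        let ?B = "{e. e < E \<and> v e = v a \<and> \<not> sat e}"
        have "{..<E} \<inter> {b. Q a b} \<subseteq> (\<Union>e\<in>?B. {b. b < E \<and> sel a b e})" unfolding Q_def sel_def by auto
        then have "card ({..<E} \<inter> {b. Q a b}) \<le> card (\<Union>e\<in>?B. {b. b < E \<and> sel a b e})" by (intro card_mono) auto
        also have "\<dots> \<le> (\<Sum>e\<in>?B. card {b. b < E \<and> sel a b e})" by (intro card_UN_le) auto
        finally have "real (card ({..<E} \<inter> {b. Q a b})) \<le> (\<Sum>e\<in>?B. real (card {b. b < E \<and> sel a b e}))"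
          unfolding of_nat_sum[symmetric] by (simp only: of_nat_le_iff)
        also have "\<dots> \<le> (\<Sum>e\<in>?B. 2 * real E / real (deg a))" using sel_count[OF a] by (intro sum_mono) auto
        finally show ?thesis by (simp add: mult.commute)
      qed
      have "(\<Sum>a<E. \<Sum>b<E. of_bool (Q a b) :: real) \<le> (\<Sum>a<E. 2 * real E * (real (card {e. e < E \<and> v e = v a \<and> \<not> sat e}) / real (deg a)))"
        using row by (intro sum_mono) auto
      also have "\<dots> = 2 * real E * real (card {e. e < E \<and> \<not> sat e})"
        unfolding sum_distrib_left[symmetric] sum_average_degree ..
      also have "\<dots> \<le> 2 * real E * (\<epsilon> * real E)" using bad unfolding sat_def by (intro mult_left_mono) auto
      finally show ?thesis .
    qed
    have one: "real (card {\<phi>\<in>PhiS. Q (\<phi> 0) (\<phi> i)}) \<le> 2 * \<epsilon> * real E ^ Suc D" if i: "i \<in> {1..D}" for i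
    proof -
      have "{\<phi>\<in>PhiS. Q (\<phi> 0) (\<phi> i)} = PhiS \<inter> {\<phi>. Q (\<phi> 0) (\<phi> i)}" by auto
      then have "real (card {\<phi>\<in>PhiS. Q (\<phi> 0) (\<phi> i)}) = (\<Sum>\<phi>\<in>PhiS. of_bool (Q (\<phi> 0) (\<phi> i)))"
        using finite_PhiS by simp
      also have "\<dots> = real E ^ (Suc D - 2) * (\<Sum>a<E. \<Sum>b<E. of_bool (Q a b))"
        unfolding PhiS_def using i sum_PiE_two[of "{..<Suc D}" 0 i "\<lambda>a b. of_bool (Q a b)" "{..<E}"]
        by (simp del: sum_of_bool_eq)
      also have "\<dots> \<le> real E ^ (Suc D - 2) * (2 * real E * (\<epsilon> * real E))"
        using T2 by (intro mult_left_mono) auto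
      also have "\<dots> = 2 * \<epsilon> * real E ^ Suc D"
      proof -
        obtain d where d: "D = Suc d" using D by (cases D) auto
        show ?thesis unfolding d by (simp add: algebra_simps)
      qed
      finally show ?thesis .
    qed
    have "PhiS \<subseteq> ok \<union> (\<Union>i\<in>{1..D}. {\<phi>\<in>PhiS. Q (\<phi> 0) (\<phi> i)})" unfolding ok_def Q_def by auto
    then have "card PhiS \<le> card (ok \<union> (\<Union>i\<in>{1..D}. {\<phi>\<in>PhiS. Q (\<phi> 0) (\<phi> i)}))"
      using finite_PhiS by (intro card_mono) (auto simp: ok_def)
    also have "\<dots> \<le> card ok + card (\<Union>i\<in>{1..D}. {\<phi>\<in>PhiS. Q (\<phi> 0) (\<phi> i)})" by (rule card_Un_le)
    also have "\<dots> \<le> card ok + (\<Sum>i\<in>{1..D}. card {\<phi>\<in>PhiS. Q (\<phi> 0) (\<phi> i)})"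
      by (intro add_left_mono card_UN_le) auto
    finally have "real (card PhiS) \<le> real (card ok) + (\<Sum>i\<in>{1..D}. real (card {\<phi>\<in>PhiS. Q (\<phi> 0) (\<phi> i)}))"
      unfolding of_nat_sum[symmetric] of_nat_add[symmetric] by (simp only: of_nat_le_iff)
    also have "\<dots> \<le> real (card ok) + (\<Sum>i\<in>{1..D}. 2 * \<epsilon> * real E ^ Suc D)"
      using one by (intro add_left_mono sum_mono) auto
    finally show ?thesis unfolding card_PhiS by (simp add: algebra_simps del: power_Suc)
  qed
  have "0 \<le> real m ^ k * (real c / real m)" by simp
  from mult_right_mono[OF a3 this]
  have "(1 - 2 * real D * \<epsilon>) * real E ^ Suc D * (real m ^ k * (real c / real m)) \<le> real (OPT H)"
    using a1 a2 by linarith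
  then show ?thesis unfolding n_def by (simp add: mult_ac del: power_Suc)
qed

end

section \<open>Padding and the gap\<close>

text \<open>The residue of a vertex is the number of its copy, the quotient its place in
  \<open>H\<close>. The last \<open>r\<close> copies carry no edges, which supplies isolated
  vertices in multiples of the order of \<open>H\<close>.\<close>

definition pad :: "nat \<Rightarrow> nat \<Rightarrow> nat \<Rightarrow> ugraph \<Rightarrow> ugraph" where
  "pad a b r H = \<lparr>order = order H * (a + b + r),
     uedges = {{w, w'} | w w'. w < order H * (a + b + r) \<and> w' < order H * (a + b + r) \<and>
       w mod (a + b + r) = w' mod (a + b + r) \<and> w mod (a + b + r) < a + b \<and>
       {w div (a + b + r), w' div (a + b + r)} \<in> uedges H}\<rparr>"

definition pad_prediction :: "nat \<Rightarrow> nat \<Rightarrow> nat \<Rightarrow> ugraph \<Rightarrow> nat set" where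
  "pad_prediction a b r H = {w. w < order H * (a + b + r) \<and> (w mod (a + b + r) < a \<or> a + b \<le> w mod (a + b + r))}"

lemma card_div_mod:
  fixes n B :: nat
  assumes "0 < B"
  shows "card {w. w < n * B \<and> R (w div B) (w mod B)} = (\<Sum>j<B. card {h. h < n \<and> R h j})"
proof -
  have bij: "bij_betw (\<lambda>x. (x div B, x mod B)) {..<n * B} ({..<n} \<times> {..<B})" using bij_betw_div_mod[OF assms] .
  have "card {w. w < n * B \<and> R (w div B) (w mod B)} = card ((\<lambda>x. (x div B, x mod B)) ` {w. w < n * B \<and> R (w div B) (w mod B)})"
    using bij by (intro card_image[symmetric]) (auto simp: bij_betw_def intro: inj_on_subset)
  also have "(\<lambda>x. (x div B, x mod B)) ` {w. w < n * B \<and> R (w div B) (w mod B)} = {x \<in> {..<n} \<times> {..<B}. R (fst x) (snd x)}"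
  proof -
    have "{x \<in> (\<lambda>x. (x div B, x mod B)) ` {..<n * B}. R (fst x) (snd x)} = (\<lambda>x. (x div B, x mod B)) ` {w. w < n * B \<and> R (w div B) (w mod B)}"
      by auto
    then show ?thesis using bij_betw_imp_surj_on[OF bij] by simp
  qed
  also have "\<dots> = (\<Union>j<B. {h. h < n \<and> R h j} \<times> {j})" by auto
  also have "card \<dots> = (\<Sum>j<B. card ({h. h < n \<and> R h j} \<times> {j}))" by (intro card_UN_disjoint) auto
  finally show ?thesis by (simp add: card_cartesian_product)
qed

lemma sum_three_blocks:
  fixes a b r x y z :: nat
  shows "(\<Sum>j<a + b + r. if j < a then x else if j < a + b then y else z) = a * x + b * y + r * z"
  unfolding sum_lessThan_add by simp

lemma wf_pad: "wf_ugraph H \<Longrightarrow> wf_ugraph (pad a b r H)"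
proof -
  assume wf: "wf_ugraph H"
  have "card {w, w'} = 2" if "{w div B, w' div B} \<in> uedges H" for w w' B
    using wf that unfolding wf_ugraph_def by (cases "w = w'") force+
  then show ?thesis unfolding wf_ugraph_def verts_def pad_def by auto
qed

lemma pad_edge:
  "{w, w'} \<in> uedges (pad a b r H) \<longleftrightarrow> w < order H * (a + b + r) \<and> w' < order H * (a + b + r) \<and>
     w mod (a + b + r) = w' mod (a + b + r) \<and> w mod (a + b + r) < a + b \<and>
     {w div (a + b + r), w' div (a + b + r)} \<in> uedges H" (is "?l \<longleftrightarrow> ?r")
proof
  let ?B = "a + b + r"
  assume ?l
  then obtain x x' where "{w, w'} = {x, x'}" "x < order H * ?B" "x' < order H * ?B" "x mod ?B = x' mod ?B"
    "x mod ?B < a + b" "{x div ?B, x' div ?B} \<in> uedges H"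
    unfolding pad_def by auto
  then show ?r by (auto simp: doubleton_eq_iff insert_commute)
qed (auto simp: pad_def)

text \<open>The copies do not interact, so optima add up. False positives occur only in the first
  \<open>a\<close> copies, off \<open>Y\<close>, and false negatives only in the next
  \<open>b\<close> copies, on \<open>Y\<close>.\<close>

lemma pad_maximum:
  assumes wf: "wf_ugraph H" and B: "0 < a + b + r" and Y: "maximum_independent_set H Y"
  defines "B \<equiv> a + b + r"
  defines "S \<equiv> {w. w < order H * B \<and> (w mod B < a + b \<longrightarrow> w div B \<in> Y)}"
  shows "maximum_independent_set (pad a b r H) S" "OPT (pad a b r H) = (a + b) * OPT H + r * order H"
    "card (pad_prediction a b r H - S) = a * (order H - OPT H)" "card (S - pad_prediction a b r H) = b * OPT H"
proof -
  let ?n = "order H" and ?G = "pad a b r H"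
  have B0: "0 < B" using B by (simp add: B_def)
  have Yn: "Y \<subseteq> {..<?n}" "card Y = OPT H" "independent_set H Y"
    using Y unfolding maximum_independent_set_def independent_set_def verts_def by auto
  have cY: "card {h. h < ?n \<and> h \<in> Y} = OPT H"
    using Yn by (metis (no_types, lifting) Collect_mem_eq Collect_cong lessThan_iff subsetD)
  have cN: "card {h. h < ?n \<and> h \<notin> Y} = ?n - OPT H"
  proof -
    have "{h. h < ?n \<and> h \<notin> Y} = {..<?n} - Y" by auto
    then show ?thesis using Yn by (simp add: card_Diff_subset finite_subset)
  qed
  note edge = pad_edge[where a = a and b = b and r = r and H = H, folded B_def]
  have ord: "order ?G = ?n * B" by (simp add: pad_def B_def)
  have S_ind: "independent_set ?G S"
    using Yn(3) unfolding independent_set_def verts_def ord edge by (auto simp: S_def)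
  have cS: "card S = (a + b) * OPT H + r * ?n"
  proof -
    have "card S = (\<Sum>j<B. card {h. h < ?n \<and> (j < a + b \<longrightarrow> h \<in> Y)})" unfolding S_def by (rule card_div_mod[OF B0])
    also have "\<dots> = (\<Sum>j<a + b + r. if j < a then OPT H else if j < a + b then OPT H else ?n)"
      unfolding B_def using cY by (intro sum.cong refl) auto
    finally show ?thesis unfolding sum_three_blocks by (simp add: algebra_simps)
  qed
  have max: "card T \<le> card S" if T: "independent_set ?G T" for T
  proof -
    have Tn: "T \<subseteq> {..<?n * B}" using T unfolding independent_set_def verts_def ord by auto
    \<comment> \<open>Written through quotient and remainder, the set can be counted copy by
      copy.\<close>
    have "T = {w. w < ?n * B \<and> (w div B) * B + w mod B \<in> T}" using Tn by auto
    then have "card T = card {w. w < ?n * B \<and> (w div B) * B + w mod B \<in> T}" by simp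
    also have "\<dots> = (\<Sum>j<B. card {h. h < ?n \<and> h * B + j \<in> T})" by (rule card_div_mod[OF B0])
    also have "\<dots> \<le> (\<Sum>j<a + b + r. if j < a then OPT H else if j < a + b then OPT H else ?n)"
      unfolding B_def[symmetric]
    proof (rule sum_mono)
      fix j assume j: "j \<in> {..<B}"
      have "independent_set H {h. h < ?n \<and> h * B + j \<in> T}" if "j < a + b"
        unfolding independent_set_def verts_def
      proof (intro conjI ballI)
        fix h h' assume h: "h \<in> {h. h < ?n \<and> h * B + j \<in> T}" "h' \<in> {h. h < ?n \<and> h * B + j \<in> T}"
        then have "{h * B + j, h' * B + j} \<notin> uedges ?G" using T unfolding independent_set_def by auto
        then show "{h, h'} \<notin> uedges H" using h Tn that j B0 unfolding edge by auto
      qed auto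
      then have "card {h. h < ?n \<and> h * B + j \<in> T} \<le> OPT H" if "j < a + b" using that card_le_OPT by blast
      moreover have "card {h. h < ?n \<and> h * B + j \<in> T} \<le> ?n"
        using card_mono[of "{..<?n}" "{h. h < ?n \<and> h * B + j \<in> T}"] by auto
      ultimately show "card {h. h < ?n \<and> h * B + j \<in> T} \<le> (if j < a then OPT H else if j < a + b then OPT H else ?n)"
        by auto
    qed
    also have "\<dots> = card S" unfolding cS sum_three_blocks by (simp add: algebra_simps)
    finally show ?thesis .
  qed
  have opt: "OPT ?G = card S" using S_ind max by (rule OPT_eqI)
  then show "maximum_independent_set ?G S" unfolding maximum_independent_set_def using S_ind by simp
  show "OPT ?G = (a + b) * OPT H + r * ?n" using opt cS by simp
  have eq1: "pad_prediction a b r H - S = {w. w < ?n * B \<and> (w mod B < a \<and> w div B \<notin> Y)}"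
    unfolding pad_prediction_def S_def B_def by auto
  have "card (pad_prediction a b r H - S) = (\<Sum>j<B. card {h. h < ?n \<and> (j < a \<and> h \<notin> Y)})"
    unfolding eq1 by (rule card_div_mod[OF B0])
  also have "\<dots> = (\<Sum>j<a + b + r. if j < a then ?n - OPT H else if j < a + b then 0 else 0)"
    unfolding B_def using cN by (intro sum.cong refl) auto
  finally show "card (pad_prediction a b r H - S) = a * (?n - OPT H)" unfolding sum_three_blocks by simp
  have eq2: "S - pad_prediction a b r H = {w. w < ?n * B \<and> ((a \<le> w mod B \<and> w mod B < a + b) \<and> w div B \<in> Y)}"
    unfolding pad_prediction_def S_def B_def by auto
  have "card (S - pad_prediction a b r H) = (\<Sum>j<B. card {h. h < ?n \<and> ((a \<le> j \<and> j < a + b) \<and> h \<in> Y)})"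
    unfolding eq2 by (rule card_div_mod[OF B0])
  also have "\<dots> = (\<Sum>j<a + b + r. if j < a then 0 else if j < a + b then OPT H else 0)"
    unfolding B_def using cY by (intro sum.cong refl) auto
  finally show "card (S - pad_prediction a b r H) = b * OPT H" unfolding sum_three_blocks by simp
qed

text \<open>All constants are determined by \<open>\<gamma>\<close> and \<open>\<epsilon>\<close>
  alone, in the order \<open>c\<close>, \<open>\<tau>\<close>, \<open>N\<close>, \<open>D\<close>,
  \<open>\<epsilon>1\<close>, \<open>\<delta>\<close>, so that one gadget serves all games.\<close>

lemma gap_reduction:
  fixes \<gamma> \<epsilon> :: real
  assumes \<gamma>: "0 < \<gamma>" and \<epsilon>: "0 < \<epsilon>"
  obtains c D \<epsilon>1 \<delta> where "1 \<le> c" "1 \<le> D" "0 < \<epsilon>1" "0 < \<delta>"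
    "\<And>I. wf_unique_game I \<Longrightarrow> 1 - \<epsilon>1 \<le> game_value I \<Longrightarrow>
       (1/2 - \<epsilon>) * real (order (gadget.H I c D)) \<le> real (OPT (gadget.H I c D))"
    "\<And>I. wf_unique_game I \<Longrightarrow> game_value I \<le> \<delta> \<Longrightarrow>
       real (OPT (gadget.H I c D)) \<le> \<gamma> * real (order (gadget.H I c D))"
proof -
  \<comment> \<open>The bound \<open>1 / \<epsilon>\<close> brings the bias within
    \<open>\<epsilon> / 2\<close> of \<open>1/2\<close>; the bound \<open>1 / \<gamma>\<close>
    forces an independent set above the threshold to have at least two vertices.\<close>
  define c where "c = Suc (nat \<lceil>1 / \<epsilon>\<rceil> + nat \<lceil>1 / \<gamma>\<rceil>)"
  define p where "p = real c / real (2 * c + 2)"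
  have c1: "1 \<le> c" by (simp add: c_def)
  have ceps: "1 / \<epsilon> \<le> real c" "1 / \<gamma> \<le> real c" unfolding c_def by linarith+
  have p: "0 < p" "p < 1/2" unfolding p_def using c1 by (auto simp: field_simps)
  have "1/2 - p = 1 / (2 * (real c + 1))" unfolding p_def by (simp add: field_simps)
  also have "\<dots> \<le> \<epsilon> / 2"
    using ceps(1) \<epsilon> c1 by (simp add: field_simps)
  finally have p_eps: "1/2 - \<epsilon> / 2 \<le> p" by simp
  have \<gamma>2: "0 < \<gamma> / 2" using \<gamma> by simp
  obtain \<tau> where \<tau>: "0 < \<tau>" and overlap:
    "\<And>(A :: nat set) P Q s1 s2. finite A \<Longrightarrow> mono P \<Longrightarrow> mono Q \<Longrightarrow> p \<le> s1 \<Longrightarrow> s1 \<le> 1/2 \<Longrightarrow> p \<le> s2 \<Longrightarrow> s2 \<le> 1/2 \<Longrightarrow>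
      \<gamma> / 2 \<le> bexp p A (\<lambda>F. of_bool (P F)) \<Longrightarrow> \<gamma> / 2 \<le> bexp p A (\<lambda>F. of_bool (Q F)) \<Longrightarrow>
      (\<Sum>i\<in>A. infl s1 A P i) \<le> 1 / (1/2 - p) \<Longrightarrow>
      (\<And>F G. F \<subseteq> A \<Longrightarrow> G \<subseteq> A \<Longrightarrow> P F \<Longrightarrow> Q G \<Longrightarrow> F \<inter> G \<noteq> {}) \<Longrightarrow>
      \<exists>i\<in>A. \<tau> \<le> infl s1 A P i \<and> \<tau> \<le> infl s2 A Q i"
    using common_influential_coordinate[OF p \<gamma>2] by blast
  define N where "N = Suc (nat \<lceil>1 / (1/2 - p) / \<tau>\<rceil>)"
  define D where "D = Suc N"
  have N: "1 / (1/2 - p) / \<tau> \<le> real N" "1 \<le> N" unfolding N_def by linarith+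
  have D1: "1 \<le> D" by (simp add: D_def)
  \<comment> \<open>\<open>\<epsilon>1\<close> makes the loss \<open>2 * D * \<epsilon>1\<close> of
    the completeness case equal to \<open>\<epsilon>\<close>; \<open>\<delta>\<close> makes the
    bound of the soundness case only half of the required \<open>\<gamma> * E\<close>.\<close>
  define \<epsilon>1 where "\<epsilon>1 = \<epsilon> / (2 * real D)"
  define \<delta> where "\<delta> = \<gamma> / (16 * (real D)\<^sup>2 * (real N)\<^sup>2)"
  have pos: "0 < \<epsilon>1" "0 < \<delta>" unfolding \<epsilon>1_def \<delta>_def using \<gamma> \<epsilon> N D1 by auto
  show ?thesis
  proof (rule that[OF c1 D1 pos])
    fix I assume wf: "wf_unique_game I" and val: "1 - \<epsilon>1 \<le> game_value I"
    interpret gadget I c D using wf c1 D1 by unfold_locales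
    obtain al bl where ab: "labeling I al bl" "satisfied_fraction I al bl = game_value I"
      using game_value_attained[OF wf] by blast
    have "real (card {e. e < E \<and> \<pi> e (al (u e)) \<noteq> bl (v e)}) \<le> \<epsilon>1 * real E"
    proof -
      have "{e. e < E \<and> \<pi> e (al (u e)) \<noteq> bl (v e)} = {..<E} - {e. e < E \<and> \<pi> e (al (u e)) = bl (v e)}" by auto
      moreover have "card ({..<E} - {e. e < E \<and> \<pi> e (al (u e)) = bl (v e)}) + card {e. e < E \<and> \<pi> e (al (u e)) = bl (v e)} = E"
      proof -
        let ?Z = "{e. e < E \<and> \<pi> e (al (u e)) = bl (v e)}"
        have "card ({..<E} - ?Z) = card {..<E} - card ?Z" by (intro card_Diff_subset) auto
        moreover have "card ?Z \<le> card {..<E}" by (intro card_mono) auto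
        ultimately show ?thesis by simp
      qed
      ultimately have "card {e. e < E \<and> \<pi> e (al (u e)) \<noteq> bl (v e)} + card {e. e < E \<and> \<pi> e (al (u e)) = bl (v e)} = E"
        by (simp only:)
      from arg_cong[OF this, of real] have s: "real (card {e. e < E \<and> \<pi> e (al (u e)) \<noteq> bl (v e)}) + real (card {e. e < E \<and> \<pi> e (al (u e)) = bl (v e)}) = real E"
        by (simp only: of_nat_add)
      have "(1 - \<epsilon>1) * real E \<le> real (card {e. e < E \<and> \<pi> e (al (u e)) = bl (v e)})"
        using val ab(2) E_pos unfolding satisfied_fraction_eq by (simp add: pos_le_divide_eq[symmetric])
      then show ?thesis using s by (simp add: algebra_simps)
    qed
    from completeness[OF ab(1) this]
    have "(1 - 2 * real D * \<epsilon>1) * p * real n \<le> real (OPT H)" unfolding p_def .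
    moreover have "1/2 - \<epsilon> \<le> (1 - 2 * real D * \<epsilon>1) * p"
    proof -
      have e: "2 * real D * \<epsilon>1 = \<epsilon>" unfolding \<epsilon>1_def using D1 by simp
      have "\<epsilon> * p \<le> \<epsilon> * (1/2)" using p \<epsilon> by (intro mult_left_mono) auto
      then show ?thesis unfolding e using p_eps by (simp add: algebra_simps)
    qed
    then have "(1/2 - \<epsilon>) * real n \<le> (1 - 2 * real D * \<epsilon>1) * p * real n" by (intro mult_right_mono) auto
    ultimately show "(1/2 - \<epsilon>) * real (order H) \<le> real (OPT H)" unfolding order_H by linarith
  next
    fix I assume wf: "wf_unique_game I" and val: "game_value I \<le> \<delta>"
    interpret gadget I c D using wf c1 D1 by unfold_locales
    show "real (OPT H) \<le> \<gamma> * real (order H)"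
    proof (rule ccontr)
      assume neg: "\<not> ?thesis"
      obtain S where S: "independent_set H S" "card S = OPT H"
        using maximum_independent_set_exists[of H] unfolding maximum_independent_set_def by blast
      define J where "J = dec ` S"
      have J: "J \<subseteq> PhiS \<times> XiS" "card J = card S" "\<And>x y. x \<in> J \<Longrightarrow> y \<in> J \<Longrightarrow> \<not> adj x y"
        using S(1) dec_image[of S] unfolding independent_H J_def by auto
      have large: "\<gamma> * (real E ^ Suc D * real m ^ k) < real (card J)"
        using neg J(2) S(2) unfolding order_H n_def by (simp del: power_Suc)
      have "1 \<le> \<gamma> * (real E ^ Suc D * real m ^ k)"
      proof -
        have "1 \<le> \<gamma> * real m" using ceps(2) \<gamma> by (simp add: field_simps)
        also have "real m \<le> real m ^ k" using k_pos power_increasing[of 1 k "real m"] by simp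
        also have "\<dots> \<le> real E ^ Suc D * real m ^ k"
        proof -
          have "1 \<le> real E" using E_pos by linarith
          then have "1 \<le> real E ^ Suc D" by (rule one_le_power)
          then have "1 * real m ^ k \<le> real E ^ Suc D * real m ^ k" by (rule mult_right_mono) simp
          then show ?thesis by simp
        qed
        finally show ?thesis using \<gamma> by simp
      qed
      then have two: "2 \<le> card J" using large by linarith
      show False
      proof (rule soundness[OF J(1) J(3) two \<gamma> large \<tau>, folded p_def])
        fix A :: "nat set" and P Q s1 s2
        assume "finite A" "mono P" "mono Q" "p \<le> s1" "s1 \<le> 1/2" "p \<le> s2" "s2 \<le> 1/2"
          "\<gamma> / 2 \<le> bexp p A (\<lambda>F. of_bool (P F))" "\<gamma> / 2 \<le> bexp p A (\<lambda>F. of_bool (Q F))"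
          "(\<Sum>i\<in>A. infl s1 A P i) \<le> 1 / (1/2 - p)"
          "\<And>F G. F \<subseteq> A \<Longrightarrow> G \<subseteq> A \<Longrightarrow> P F \<Longrightarrow> Q G \<Longrightarrow> F \<inter> G \<noteq> {}"
        then show "\<exists>i\<in>A. \<tau> \<le> infl s1 A P i \<and> \<tau> \<le> infl s2 A Q i" by (rule overlap)
      next
        show "1 / (1/2 - p) / \<tau> \<le> real N" "D = Suc N" "1 \<le> N" using N D_def by auto
      next
        fix al bl assume ab: "labeling I al bl"
          "\<gamma> * real E \<le> 8 * (real D)\<^sup>2 * (real N)\<^sup>2 * real (card {e. e < E \<and> \<pi> e (al (u e)) = bl (v e)})"
        have "satisfied_fraction I al bl \<le> \<delta>" using game_value_ge[OF ab(1)] val by simp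
        then have "real (card {e. e < E \<and> \<pi> e (al (u e)) = bl (v e)}) \<le> \<delta> * real E"
          unfolding satisfied_fraction_eq using E_pos by (simp add: pos_divide_le_eq)
        then have "8 * (real D)\<^sup>2 * (real N)\<^sup>2 * real (card {e. e < E \<and> \<pi> e (al (u e)) = bl (v e)})
            \<le> 8 * (real D)\<^sup>2 * (real N)\<^sup>2 * (\<delta> * real E)" by (intro mult_left_mono) auto
        also have "\<dots> = \<gamma> / 2 * real E" unfolding \<delta>_def using N(2) D1 by (simp add: field_simps)
        finally have "\<gamma> * real E \<le> \<gamma> / 2 * real E" using ab(2) by linarith
        then show False using \<gamma> E_pos by simp
      qed
    qed
  qed
qed

section \<open>Computing the reduction\<close>

definition eE :: expr where "eE = eNum (EN 3)"
definition eU :: "nat \<Rightarrow> expr \<Rightarrow> expr" where "eU k e = eNum (EAdd (EN 4) (EMul e (EN (k + 2))))"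
definition eVt :: "nat \<Rightarrow> expr \<Rightarrow> expr" where "eVt k e = eNum (EAdd (EN 5) (EMul e (EN (k + 2))))"
definition ePi :: "nat \<Rightarrow> expr \<Rightarrow> expr \<Rightarrow> expr" where
  "ePi k e a = eNum (EAdd (EN 6) (EAdd (EMul e (EN (k + 2))) a))"
definition eDeg :: "nat \<Rightarrow> expr \<Rightarrow> expr" where
  "eDeg k a = ESum (fresh a) eE (eEq (eVt k (EV (fresh a))) (eVt k a))"
definition eRank :: "nat \<Rightarrow> expr \<Rightarrow> expr \<Rightarrow> expr" where
  "eRank k a e = (let x = max (fresh a) (fresh e) in ESum x e (eEq (eVt k (EV x)) (eVt k a)))"
definition eSel :: "nat \<Rightarrow> expr \<Rightarrow> expr \<Rightarrow> expr \<Rightarrow> expr" where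
  "eSel k a b e = EMul (eEq (eVt k e) (eVt k a)) (eEq (eRank k a e) (eMod b (eDeg k a)))"
definition ePhi :: "nat \<Rightarrow> nat \<Rightarrow> expr \<Rightarrow> nat \<Rightarrow> expr" where
  "ePhi k m h i = eMod (eDiv h (EMul (EN (m ^ k)) (ePow eE i))) eE"
text \<open>The position \<open>b\<close> of the digit is known only when the expression is
  evaluated, but the power of the base must be a constant in it. So all positions
  \<open>t < k\<close> are tried.\<close>

definition eSmall :: "nat \<Rightarrow> nat \<Rightarrow> expr \<Rightarrow> expr \<Rightarrow> expr" where
  "eSmall k c h b = eOrs (map (\<lambda>t. EMul (eEq b (EN t))
     (eLt (eMod (eDiv h (EN ((2 * c + 2) ^ t))) (EN (2 * c + 2))) (EN c))) [0..<k])"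
text \<open>The indices \<open>i\<close> and \<open>j\<close> are unrolled because they become
  exponents of \<open>eE\<close> in \<open>ePhi\<close>. The edges, whose number depends on the
  input, are bounded quantifiers over fresh variables.\<close>

definition eAdj0 :: "nat \<Rightarrow> nat \<Rightarrow> nat \<Rightarrow> expr \<Rightarrow> expr \<Rightarrow> expr" where
  "eAdj0 k c D h h' = (let x = max (fresh h) (fresh h'); \<phi> = ePhi k (2 * c + 2) in
     eOrs (concat (map (\<lambda>i. map (\<lambda>j.
       eEx x eE (eEx (x + 1) eE
         (EMul (eSel k (\<phi> h 0) (\<phi> h i) (EV x)) (EMul (eSel k (\<phi> h' 0) (\<phi> h' j) (EV (x + 1)))
           (EMul (eEq (eU k (EV x)) (eU k (EV (x + 1))))
             (eAll (x + 2) (EN k) (eNot (EMul (eSmall k c h (ePi k (EV x) (EV (x + 2))))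
               (eSmall k c h' (ePi k (EV (x + 1)) (EV (x + 2))))))))))))
       [1..<Suc D]) [1..<Suc D])))"
definition eAdj :: "nat \<Rightarrow> nat \<Rightarrow> nat \<Rightarrow> expr \<Rightarrow> expr \<Rightarrow> expr" where
  "eAdj k c D h h' = EMul (eNot (eEq h h')) (eOr (eAdj0 k c D h h') (eOr (eAdj0 k c D h h) (eAdj0 k c D h' h')))"

text \<open>The output consists of the order in unary with its terminating zero, the adjacency
  matrix and the prediction.\<close>

definition reduction :: "nat \<Rightarrow> nat \<Rightarrow> nat \<Rightarrow> nat \<Rightarrow> nat \<Rightarrow> nat \<Rightarrow> gen" where
  "reduction k c D a b r = (let B = EN (a + b + r);
       ord = EMul (EMul (ePow eE (Suc D)) (EN ((2 * c + 2) ^ k))) B in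
     GCat (GFor 0 ord (GOut (EN 1))) (GCat (GOut (EN 0))
       (GCat (GFor 0 ord (GFor 1 ord (GOut
          (EMul (eEq (eMod (EV 0) B) (eMod (EV 1) B)) (EMul (eLt (eMod (EV 0) B) (EN (a + b)))
            (eAdj k c D (eDiv (EV 0) B) (eDiv (EV 1) B)))))))
         (GFor 0 ord (GOut (eOr (eLt (eMod (EV 0) B) (EN a)) (eLe (EN (a + b)) (eMod (EV 0) B))))))))"

context gadget
begin

abbreviation w where "w \<equiv> enc_unique_game I"

lemma eval_eE [simp]: "eval w env eE = E"
  unfolding eE_def using eval_eNum[OF enc_unique_game_eq, where I1 = I and env = env and a = "EN 3"] game_nums_nth(1,2)[OF wf] by simp

lemma eval_eU: "eval w env e < E \<Longrightarrow> eval w env (eU k e) = u (eval w env e)"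
  unfolding eU_def
  using eval_eNum[OF enc_unique_game_eq, where I1 = I and env = env and a = "EAdd (EN 4) (EMul e (EN (k + 2)))"]
    game_nums_nth(3)[OF wf, of "eval w env e"] by simp

lemma eval_eVt: "eval w env e < E \<Longrightarrow> eval w env (eVt k e) = v (eval w env e)"
  unfolding eVt_def
  using eval_eNum[OF enc_unique_game_eq, where I1 = I and env = env and a = "EAdd (EN 5) (EMul e (EN (k + 2)))"]
    game_nums_nth(4)[OF wf, of "eval w env e"] by simp

lemma eval_ePi: "eval w env e < E \<Longrightarrow> eval w env a < k \<Longrightarrow> eval w env (ePi k e a) = \<pi> (eval w env e) (eval w env a)"
  unfolding ePi_def
  using eval_eNum[OF enc_unique_game_eq, where I1 = I and env = env and a = "EAdd (EN 6) (EAdd (EMul e (EN (k + 2))) a)"]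
    game_nums_nth(5)[OF wf, of "eval w env e" "eval w env a"] by simp

lemma eval_eDeg: 
  assumes "eval w env a < E"
  shows "eval w env (eDeg k a) = deg (eval w env a)"
proof -
  have "eval w env (eDeg k a) = (\<Sum>i<E. of_bool (v i = v (eval w env a)))"
    unfolding eDeg_def using assms by (auto simp: eval_eVt simp del: sum_of_bool_eq intro!: sum.cong)
  then show ?thesis unfolding sum_of_bool_lessThan deg_def by simp
qed

lemma eval_eRank: 
  assumes "eval w env a < E" "eval w env e < E"
  shows "eval w env (eRank k a e) = rank (eval w env a) (eval w env e)"
proof -
  have "eval w env (eRank k a e) = (\<Sum>i<eval w env e. of_bool (v i = v (eval w env a)))"
    unfolding eRank_def Let_def using assms by (auto simp: eval_eVt simp del: sum_of_bool_eq intro!: sum.cong)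
  then show ?thesis unfolding sum_of_bool_lessThan rank_def by simp
qed

lemma eval_eSel:
  assumes "eval w env a < E" "eval w env e < E"
  shows "eval w env (eSel k a b e) = of_bool (sel (eval w env a) (eval w env b) (eval w env e))"
  unfolding eSel_def sel_def using assms deg_pos[OF assms(1)]
  by (simp add: eval_eVt eval_eDeg eval_eRank)

lemma eval_ePhi: "eval w env (ePhi k m h i) = eval w env h div (m ^ k * E ^ i) mod E"
  unfolding ePhi_def using E_pos by simp

lemma eval_eSmall:
  assumes "eval w env b < k"
  shows "eval w env (eSmall k c h b) = of_bool (eval w env h div m ^ eval w env b mod m < c)"
  unfolding eSmall_def using assms by auto

lemma eval_eAdj0: "eval w env (eAdj0 k c D h h') = of_bool (adj0 (dec (eval w env h)) (dec (eval w env h')))"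
proof -
  define x where "x = max (fresh h) (fresh h')"
  have fr: "fresh h \<le> x" "fresh h' \<le> x" "fresh h \<le> x + 1" "fresh h' \<le> x + 1" "fresh h \<le> x + 2" "fresh h' \<le> x + 2"
    unfolding x_def by auto
  let ?h = "eval w env h" and ?h' = "eval w env h'"
  define body where "body = (\<lambda>i j. EMul (eSel k (ePhi k m h 0) (ePhi k m h i) (EV x)) (EMul (eSel k (ePhi k m h' 0) (ePhi k m h' j) (EV (x + 1)))
           (EMul (eEq (eU k (EV x)) (eU k (EV (x + 1))))
             (eAll (x + 2) (EN k) (eNot (EMul (eSmall k c h (ePi k (EV x) (EV (x + 2))))
               (eSmall k c h' (ePi k (EV (x + 1)) (EV (x + 2))))))))))"
  have body: "eval w (env(x := e, x + 1 := e')) (body i j) = of_bool (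
      sel (fst (dec ?h) 0) (fst (dec ?h) i) e \<and> sel (fst (dec ?h') 0) (fst (dec ?h') j) e' \<and> u e = u e' \<and>
      (\<forall>a<k. \<not> (snd (dec ?h) (\<pi> e a) < c \<and> snd (dec ?h') (\<pi> e' a) < c)))"
    if e: "e < E" "e' < E" and ij: "i \<in> {1..D}" "j \<in> {1..D}" for i j e e'
  proof -
    let ?env = "env(x := e, x + 1 := e')"
    have hh: "eval w ?env h = ?h" "eval w ?env h' = ?h'" using fr by simp_all
    have hh2: "eval w (?env(x + 2 := a)) h = ?h" "eval w (?env(x + 2 := a)) h' = ?h'" for a using fr by simp_all
    have \<phi>: "\<And>i. i \<le> D \<Longrightarrow> fst (dec ?h) i = ?h div (m ^ k * E ^ i) mod E" "\<And>i. i \<le> D \<Longrightarrow> fst (dec ?h') i = ?h' div (m ^ k * E ^ i) mod E"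
      by (simp_all add: dec_def)
    have ph: "i \<le> D \<Longrightarrow> eval w ?env (ePhi k m h i) = fst (dec ?h) i" "i \<le> D \<Longrightarrow> eval w ?env (ePhi k m h' i) = fst (dec ?h') i" for i
      by (simp_all only: eval_ePhi hh \<phi>)
    have lt: "fst (dec ?h) 0 < E" "fst (dec ?h') 0 < E" unfolding \<phi>[OF le0] using E_pos by simp_all
    have le: "i \<le> D" "j \<le> D" using ij by auto
    have env: "?env x = e" "?env (x + 1) = e'" by simp_all
    have s1: "eval w ?env (eSel k (ePhi k m h 0) (ePhi k m h i) (EV x)) = of_bool (sel (fst (dec ?h) 0) (fst (dec ?h) i) e)"
      by (subst eval_eSel) (simp_all only: ph[OF le0] ph[OF le(1)] eval.simps(1) env lt e)
    have s2: "eval w ?env (eSel k (ePhi k m h' 0) (ePhi k m h' j) (EV (x + 1))) = of_bool (sel (fst (dec ?h') 0) (fst (dec ?h') j) e')"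
      by (subst eval_eSel) (simp_all only: ph[OF le0] ph[OF le(2)] eval.simps(1) env lt e)
    have s3: "eval w ?env (eEq (eU k (EV x)) (eU k (EV (x + 1)))) = of_bool (u e = u e')"
      using e by (simp add: eval_eU)
    have small: "eval w (?env(x + 2 := a)) (eSmall k c h (ePi k (EV x) (EV (x + 2)))) = of_bool (snd (dec ?h) (\<pi> e a) < c)"
      "eval w (?env(x + 2 := a)) (eSmall k c h' (ePi k (EV (x + 1)) (EV (x + 2)))) = of_bool (snd (dec ?h') (\<pi> e' a) < c)" if a: "a < k" for a
    proof -
      have pk: "\<pi> e a < k" "\<pi> e' a < k" using pi_bij[OF e(1)] pi_bij[OF e(2)] a by (auto simp: bij_betw_def)
      have p1: "eval w (?env(x + 2 := a)) (ePi k (EV x) (EV (x + 2))) = \<pi> e a"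
        using e a by (subst eval_ePi) simp_all
      have p2: "eval w (?env(x + 2 := a)) (ePi k (EV (x + 1)) (EV (x + 2))) = \<pi> e' a"
        using e a by (subst eval_ePi) simp_all
      show "eval w (?env(x + 2 := a)) (eSmall k c h (ePi k (EV x) (EV (x + 2)))) = of_bool (snd (dec ?h) (\<pi> e a) < c)"
        using pk by (subst eval_eSmall) (simp_all only: p1 hh2, simp add: dec_def)
      show "eval w (?env(x + 2 := a)) (eSmall k c h' (ePi k (EV (x + 1)) (EV (x + 2)))) = of_bool (snd (dec ?h') (\<pi> e' a) < c)"
        using pk by (subst eval_eSmall) (simp_all only: p2 hh2, simp add: dec_def)
    qed
    have s4: "eval w ?env (eAll (x + 2) (EN k) (eNot (EMul (eSmall k c h (ePi k (EV x) (EV (x + 2))))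
               (eSmall k c h' (ePi k (EV (x + 1)) (EV (x + 2))))))) = of_bool (\<forall>a<k. \<not> (snd (dec ?h) (\<pi> e a) < c \<and> snd (dec ?h') (\<pi> e' a) < c))"
      unfolding eval_eAll eval_eNot eval.simps using small by (auto simp del: fun_upd_apply)
    show ?thesis unfolding body_def eval.simps(4) s1 s2 s3 s4 by simp
  qed
  have "eval w env (eAdj0 k c D h h') = of_bool (\<exists>i\<in>{1..D}. \<exists>j\<in>{1..D}. eval w env (eEx x eE (eEx (x + 1) eE (body i j))) \<noteq> 0)"
  proof -
    have "eAdj0 k c D h h' = eOrs (concat (map (\<lambda>i. map (\<lambda>j. eEx x eE (eEx (x + 1) eE (body i j))) [1..<Suc D]) [1..<Suc D]))"
      unfolding eAdj0_def Let_def x_def[symmetric] body_def ..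
    moreover have "set (concat (map (\<lambda>i. map (g i) [1..<Suc D]) [1..<Suc D])) = (\<Union>i\<in>{1..D}. g i ` {1..D})"
      for g :: "nat \<Rightarrow> nat \<Rightarrow> expr"
      by (simp add: atLeastLessThanSuc_atLeastAtMost del: upt_Suc)
    ultimately show ?thesis by (simp only: eval_eOrs) (rule arg_cong[where f = of_bool], blast)
  qed
  also have "\<dots> = of_bool (\<exists>i\<in>{1..D}. \<exists>j\<in>{1..D}. \<exists>e<E. \<exists>e'<E. eval w (env(x := e, x + 1 := e')) (body i j) \<noteq> 0)"
    by (simp only: eval_eEx eval_eE of_bool_eq_0_iff not_not)
  also have "\<dots> = of_bool (adj0 (dec ?h) (dec ?h'))"
    unfolding adj0_def by (intro arg_cong[where f = of_bool] bex_cong refl ex_cong1 conj_cong) (simp only: body of_bool_eq_0_iff not_not)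
  finally show ?thesis .
qed

lemma gout_reduction:
  assumes B: "0 < a + b + r"
  shows "gout w (\<lambda>_. 0) (reduction k c D a b r) = enc_ugraph (pad a b r H) @ enc_vertex_set (pad a b r H) (pad_prediction a b r H)"
proof -
  let ?B = "a + b + r" and ?G = "pad a b r H"
  define ord where "ord = EMul (EMul (ePow eE (Suc D)) (EN (m ^ k))) (EN ?B)"
  have ordG: "order ?G = n * ?B" by (simp add: pad_def order_H)
  have ord: "eval w env ord = order ?G" for env
    unfolding ordG by (simp add: ord_def n_def)
  have adj: "eval w env (eAdj k c D h h') \<noteq> 0 \<longleftrightarrow> {eval w env h, eval w env h'} \<in> uedges H"
    if "eval w env h < n" "eval w env h' < n" for env h h'
  proof -
    \<comment> \<open>\<open>eAdj\<close> compares vertex numbers whereas \<open>adj\<close>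
      compares decoded pairs.\<close>
    have "eval w env h = eval w env h' \<longleftrightarrow> dec (eval w env h) = dec (eval w env h')"
      using bij_dec that by (auto simp: bij_betw_def dest: inj_onD)
    then show ?thesis unfolding H_edge adj_def eAdj_def using that by (simp add: eval_eAdj0)
  qed
  note edge = pad_edge[where a = a and b = b and r = r and H = H, unfolded order_H]
  let ?env = "\<lambda>x y. (\<lambda>_. 0 :: nat)(0 := x, 1 := y)"
  have bit: "(eval w (?env x y) (EMul (eEq (eMod (EV 0) (EN ?B)) (eMod (EV 1) (EN ?B))) (EMul (eLt (eMod (EV 0) (EN ?B)) (EN (a + b)))
            (eAdj k c D (eDiv (EV 0) (EN ?B)) (eDiv (EV 1) (EN ?B))))) \<noteq> 0) = ({x, y} \<in> uedges ?G)"
    if xy: "x < order ?G" "y < order ?G" for x y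
  proof -
    have "x div ?B < n" "y div ?B < n" using xy unfolding ordG by (auto simp: less_mult_imp_div_less)
    then have "eval w (?env x y) (eAdj k c D (eDiv (EV 0) (EN ?B)) (eDiv (EV 1) (EN ?B))) \<noteq> 0 \<longleftrightarrow> {x div ?B, y div ?B} \<in> uedges H"
      using adj[of "?env x y" "eDiv (EV 0) (EN ?B)" "eDiv (EV 1) (EN ?B)"] B by simp
    then show ?thesis unfolding edge using xy B ordG by auto
  qed
  have matrix: "gout w (\<lambda>_. 0) (GFor 0 ord (GFor 1 ord (GOut
          (EMul (eEq (eMod (EV 0) (EN ?B)) (eMod (EV 1) (EN ?B))) (EMul (eLt (eMod (EV 0) (EN ?B)) (EN (a + b)))
            (eAdj k c D (eDiv (EV 0) (EN ?B)) (eDiv (EV 1) (EN ?B))))))))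
     = concat (map (\<lambda>x. map (\<lambda>y. {x, y} \<in> uedges ?G) [0..<order ?G]) [0..<order ?G])"
    unfolding gout.simps ord concat_map_singleton
    using bit by (intro arg_cong[where f = concat] map_cong refl) auto
  have pred: "gout w (\<lambda>_. 0) (GFor 0 ord (GOut (eOr (eLt (eMod (EV 0) (EN ?B)) (EN a)) (eLe (EN (a + b)) (eMod (EV 0) (EN ?B))))))
     = enc_vertex_set ?G (pad_prediction a b r H)"
    unfolding gout.simps ord concat_map_singleton enc_vertex_set_def
    using B by (intro map_cong refl) (auto simp: pad_prediction_def order_H ordG)
  have unary: "gout w (\<lambda>_. 0) (GFor 0 ord (GOut (EN 1))) = replicate (order ?G) True"
    unfolding gout.simps ord concat_map_singleton by (simp add: map_replicate_const)
  have "gout w (\<lambda>_. 0) (reduction k c D a b r) = replicate (order ?G) True @ [False] @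
     concat (map (\<lambda>x. map (\<lambda>y. {x, y} \<in> uedges ?G) [0..<order ?G]) [0..<order ?G]) @ enc_vertex_set ?G (pad_prediction a b r H)"
    unfolding reduction_def Let_def ord_def[symmetric] gout.simps(2) matrix pred unary by simp
  then show ?thesis by (simp add: enc_ugraph_def enc_nat_def)
qed

end

text \<open>The threshold \<open>t * order H\<close> on the size of the output separates the two
  promise cases. The machine composes the reduction to unique games, the generator for the padded
  graph, the algorithm and a count of the output; the generator depends on \<open>k\<close>, which
  the conjecture provides for the given \<open>\<epsilon>1\<close> and
  \<open>\<delta>\<close>.\<close>

lemma decide_by_prediction_algorithm:
  fixes \<epsilon>1 \<delta> :: real
  assumes ugc: unique_games_conjecture and alg: "polytime_prediction_algorithm A"
    and cD: "1 \<le> c" "1 \<le> D" and B: "0 < a + b + r" and pos: "0 < \<epsilon>1" "0 < \<delta>"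
    and sub: "\<And>G X. wf_ugraph G \<Longrightarrow> X \<subseteq> verts G \<Longrightarrow> A G X \<subseteq> verts G"
    and yes: "\<And>I. wf_unique_game I \<Longrightarrow> 1 - \<epsilon>1 \<le> game_value I \<Longrightarrow>
      t * order (gadget.H I c D) \<le> card (A (pad a b r (gadget.H I c D)) (pad_prediction a b r (gadget.H I c D)))"
    and no: "\<And>I. wf_unique_game I \<Longrightarrow> game_value I \<le> \<delta> \<Longrightarrow>
      card (A (pad a b r (gadget.H I c D)) (pad_prediction a b r (gadget.H I c D))) < t * order (gadget.H I c D)"
  shows "class_NP \<subseteq> class_P"
proof
  fix L assume L: "L \<in> class_NP"
  let ?Yes = "\<lambda>k. enc_unique_game ` {I. wf_unique_game I \<and> nlabels I = k \<and> game_value I \<ge> 1 - \<epsilon>1}"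
  let ?No = "\<lambda>k. enc_unique_game ` {I. wf_unique_game I \<and> nlabels I = k \<and> game_value I \<le> \<delta>}"
  obtain k where hard: "NP_hard_promise (?Yes k) (?No k)"
    using ugc pos unfolding unique_games_conjecture_def by blast
  have "\<exists>g. polytime_fun g \<and> (\<forall>w. (w \<in> L \<longrightarrow> g w \<in> ?Yes k) \<and> (w \<notin> L \<longrightarrow> g w \<in> ?No k))"
    using hard[unfolded NP_hard_promise_def] L by (rule bspec)
  then obtain g where g: "polytime_fun g" "\<And>w. w \<in> L \<Longrightarrow> g w \<in> ?Yes k" "\<And>w. w \<notin> L \<Longrightarrow> g w \<in> ?No k"
    by (elim exE conjE) auto
  define R where "R = (\<lambda>w I. wf_unique_game I \<and> nlabels I = k \<and> g w = enc_unique_game I \<and>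
     (w \<in> L \<longrightarrow> 1 - \<epsilon>1 \<le> game_value I) \<and> (w \<notin> L \<longrightarrow> game_value I \<le> \<delta>))"
  \<comment> \<open>The game is chosen for the analysis only; the machine works on the word
    \<open>g w\<close>.\<close>
  define game where "game = (\<lambda>w. SOME I. R w I)"
  have "\<exists>I. R w I" for w
  proof (cases "w \<in> L")
    case True
    then show ?thesis using g(2)[OF True] unfolding R_def by blast
  next
    case False
    then show ?thesis using g(3)[OF False] unfolding R_def by blast
  qed
  then have R: "R w (game w)" for w unfolding game_def by (rule someI_ex)
  have wf: "wf_unique_game (game w)" and k: "nlabels (game w) = k" and enc: "g w = enc_unique_game (game w)" for w
    using R[of w] unfolding R_def by auto
  define H where "H = (\<lambda>w. gadget.H (game w) c D)"
  define G where "G = (\<lambda>w. pad a b r (H w))"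
  define X where "X = (\<lambda>w. pad_prediction a b r (H w))"
  have gad: "gadget (game w) c D" for w using wf cD by unfold_locales
  have wfG: "wf_ugraph (G w)" "X w \<subseteq> verts (G w)" for w
    using wf_pad[OF gadget.wf_H[OF gad]] unfolding G_def X_def H_def
    by (auto simp: pad_prediction_def verts_def pad_def)
  have ordG: "order (G w) = order (H w) * (a + b + r)" for w by (simp add: G_def pad_def)
  define out where "out = (\<lambda>w. enc_vertex_set (G w) (A (G w) (X w)))"
  have "polytime_on UNIV g (\<lambda>w. gout (g w) (\<lambda>_. 0) (reduction k c D a b r))" by (rule gen_polytime)
  moreover have "gout (g w) (\<lambda>_. 0) (reduction k c D a b r) = enc_ugraph (G w) @ enc_vertex_set (G w) (X w)" for w
    using gadget.gout_reduction[OF gad B, of w] unfolding enc k G_def X_def H_def .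
  ultimately have "polytime_on UNIV g (\<lambda>w. enc_ugraph (G w) @ enc_vertex_set (G w) (X w))" by simp
  with g(1) have "polytime_on UNIV (\<lambda>w. w) (\<lambda>w. enc_ugraph (G w) @ enc_vertex_set (G w) (X w))" by (rule polytime_on_comp)
  moreover have "polytime_on UNIV (\<lambda>w. enc_ugraph (G w) @ enc_vertex_set (G w) (X w)) out"
    using polytime_on_reindex[OF alg[unfolded polytime_prediction_algorithm_def], of UNIV "\<lambda>w. (G w, X w)"] wfG
    unfolding out_def by simp
  ultimately have "polytime_on UNIV (\<lambda>w. w) out" by (rule polytime_on_comp)
  from polytime_on_comp[OF this polytime_compare_ones[where ?K1.0 = "a + b + r" and ?K2.0 = t]]
  have "polytime_on UNIV (\<lambda>w. w) (\<lambda>w. [t * length (out w) \<le> (a + b + r) * card {i. i < length (out w) \<and> out w ! i}])" .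
  moreover have "(t * length (out w) \<le> (a + b + r) * card {i. i < length (out w) \<and> out w ! i}) = (w \<in> L)" for w
  proof -
    have "A (G w) (X w) \<subseteq> {..<order (G w)}" using sub[OF wfG] by (simp add: verts_def)
    then have "{i. i < length (out w) \<and> out w ! i} = A (G w) (X w)" unfolding out_def enc_vertex_set_def by auto
    moreover have "length (out w) = order (H w) * (a + b + r)" by (simp add: out_def enc_vertex_set_def ordG)
    ultimately have "(t * length (out w) \<le> (a + b + r) * card {i. i < length (out w) \<and> out w ! i})
        = ((a + b + r) * (t * order (H w)) \<le> (a + b + r) * card (A (G w) (X w)))"
      by (simp only: mult_ac)
    also have "\<dots> = (t * order (H w) \<le> card (A (G w) (X w)))" using B by simp
    also have "\<dots> = (w \<in> L)"
    proof (cases "w \<in> L")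
      case True
      then have "1 - \<epsilon>1 \<le> game_value (game w)" using R[of w] unfolding R_def by blast
      then show ?thesis using True yes[OF wf] unfolding G_def X_def H_def by simp
    next
      case False
      then have "game_value (game w) \<le> \<delta>" using R[of w] unfolding R_def by blast
      then show ?thesis using False no[OF wf, of w] unfolding G_def X_def H_def by simp
    qed
    finally show ?thesis .
  qed
  ultimately show "L \<in> class_P" unfolding class_P_def by simp
qed

theorem theorem6:
  fixes A :: "ugraph \<Rightarrow> nat set \<Rightarrow> nat set"
    and f :: "real \<Rightarrow> real \<Rightarrow> real"
  assumes "unique_games_conjecture"
    and "class_P \<noteq> class_NP"
    and "polytime_prediction_algorithm A"
    and "\<And>G X. wf_ugraph G \<Longrightarrow> X \<subseteq> verts G \<Longrightarrow> independent_set G (A G X)"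
    and "\<And>G X Xstar. wf_ugraph G \<Longrightarrow> X \<subseteq> verts G \<Longrightarrow> maximum_independent_set G Xstar \<Longrightarrow>
           real (card (A G X)) \<ge>
             (1 - f (real (card (X - Xstar)) / real (OPT G)) (real (card (Xstar - X)) / real (OPT G)))
               * real (OPT G)"
    and "\<And>y. y \<ge> 0 \<Longrightarrow> mono_on {0..} (\<lambda>x. f x y)"
    and "\<And>x. x \<ge> 0 \<Longrightarrow> mono_on {0..} (\<lambda>y. f x y)"
  shows "\<forall>x y. x \<ge> 0 \<and> y \<ge> 0 \<and> x + y \<le> 1 \<longrightarrow> f x y \<ge> x + y"
proof (rule ccontr)
  assume "\<not> ?thesis"
  then obtain x y where xy: "0 \<le> x" "0 \<le> y" "x + y \<le> 1" "f x y < x + y" by (auto simp: not_le)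
  \<comment> \<open>Half of the assumed deficit, capped at \<open>1\<close>. One
    \<open>\<kappa>\<close> pays for surplus isolated vertices, which raise the optimum until the
    error ratios are at most \<open>x\<close> and \<open>y\<close>; the other keeps the guaranteed
    output above the bound of the second case.\<close>
  define \<kappa> where "\<kappa> = min ((x + y - f x y) / 2) 1"
  define \<epsilon> where "\<epsilon> = \<kappa> / 8"
  \<comment> \<open>Rounding costs a bounded number of copies. The worst case in the final estimate
    is \<open>2 + (1 - (x + y) + 2 * \<kappa>)\<close>, at most \<open>5\<close>.\<close>
  define M where "M = real (nat \<lceil>5 / \<kappa>\<rceil>)"
  have \<kappa>: "0 < \<kappa>" "\<kappa> \<le> 1" "1 - (x + y) + 2 * \<kappa> \<le> 1 - f x y" unfolding \<kappa>_def using xy by (auto simp: min_def field_simps)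
  have "5 / \<kappa> \<le> M" unfolding M_def by linarith
  then have M: "5 \<le> \<kappa> * M" using \<kappa> by (simp add: field_simps)
  have M0: "0 \<le> M" unfolding M_def by simp
  have \<epsilon>: "0 < \<epsilon>" "\<epsilon> \<le> 1/8" unfolding \<epsilon>_def using \<kappa> by auto
  define a b r where "a = nat \<lfloor>2 * x * M\<rfloor>" and "b = nat \<lfloor>2 * y * M\<rfloor>" and "r = nat \<lceil>(1 - (x + y) + \<kappa>) * M\<rceil>"
  have nn: "0 \<le> 2 * x * M" "0 \<le> 2 * y * M" "0 \<le> (1 - (x + y) + \<kappa>) * M" using xy \<kappa> M0 by auto
  have a: "2 * x * M - 1 \<le> real a" "real a \<le> 2 * x * M" unfolding a_def using nn by linarith+
  have b: "2 * y * M - 1 \<le> real b" "real b \<le> 2 * y * M" unfolding b_def using nn by linarith+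
  have r: "(1 - (x + y) + \<kappa>) * M \<le> real r" "real r \<le> (1 - (x + y) + \<kappa>) * M + 1" unfolding r_def using nn by linarith+
  have "\<kappa> * M \<le> (1 - (x + y) + \<kappa>) * M" using xy M0 by (intro mult_right_mono) auto
  then have "5 \<le> real r" using M r by linarith
  then have B: "0 < a + b + r" by linarith
  \<comment> \<open>A lower bound on the optimum in units of the order of \<open>H\<close>: of the
    surplus \<open>\<kappa> * M\<close> the deviation \<open>\<epsilon>\<close> takes at most a
    quarter, and rounding \<open>a\<close> and \<open>b\<close> down loses at most two copies of
    half weight.\<close>
  define Q where "Q = M * (1 + 3 / 4 * \<kappa>) - 1"
  \<comment> \<open>In the second case all copies together then contribute at most half the order of
    \<open>H\<close>, so \<open>r + 1\<close> is a separating threshold.\<close>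
  define \<gamma> where "\<gamma> = 1 / (2 * (real a + real b) + 2)"
  have \<gamma>: "0 < \<gamma>" "(real a + real b) * \<gamma> \<le> 1/2" unfolding \<gamma>_def by (auto simp: field_simps add_nonneg_pos)
  obtain c D \<epsilon>1 \<delta> where cD: "1 \<le> c" "1 \<le> D" and pos: "0 < \<epsilon>1" "0 < \<delta>"
    and yes: "\<And>I. wf_unique_game I \<Longrightarrow> 1 - \<epsilon>1 \<le> game_value I \<Longrightarrow>
       (1/2 - \<epsilon>) * real (order (gadget.H I c D)) \<le> real (OPT (gadget.H I c D))"
    and no: "\<And>I. wf_unique_game I \<Longrightarrow> game_value I \<le> \<delta> \<Longrightarrow>
       real (OPT (gadget.H I c D)) \<le> \<gamma> * real (order (gadget.H I c D))"
    using gap_reduction[OF \<gamma>(1) \<epsilon>(1)] by blast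
  have "class_NP \<subseteq> class_P"
  proof (rule decide_by_prediction_algorithm[OF assms(1,3) cD B pos])
    show "A G X \<subseteq> verts G" if "wf_ugraph G" "X \<subseteq> verts G" for G X
      using assms(4)[OF that] by (simp add: independent_set_def)
  next
    fix I assume wf: "wf_unique_game I" and val: "1 - \<epsilon>1 \<le> game_value I"
    interpret gadget I c D using wf cD by unfold_locales
    let ?n = "real (order H)" and ?o = "real (OPT H)"
    let ?G = "pad a b r H" and ?X = "pad_prediction a b r H"
    have n0: "0 \<le> ?n" by simp
    have o1: "(1/2 - \<epsilon>) * ?n \<le> ?o" by (rule yes[OF wf val])
    have o2: "2 * ?o \<le> ?n" using of_nat_mono[OF OPT_H_le_half, where 'a = real] unfolding order_H by simp
    obtain Y where Y: "maximum_independent_set H Y" using maximum_independent_set_exists by blast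
    define S where "S = {w. w < order H * (a + b + r) \<and> (w mod (a + b + r) < a + b \<longrightarrow> w div (a + b + r) \<in> Y)}"
    note pm = pad_maximum[OF wf_H B Y, folded S_def]
    have optG: "real (OPT ?G) = (real a + real b) * ?o + real r * ?n" unfolding pm(2) by simp
    have Q: "?n * Q \<le> real (OPT ?G)"
    proof -
      have "(2 * (x + y) * M - 2) * ((1/2 - \<epsilon>) * ?n) \<le> (real a + real b) * ((1/2 - \<epsilon>) * ?n)"
      proof (rule mult_right_mono)
        show "2 * (x + y) * M - 2 \<le> real a + real b" using a b by (simp add: algebra_simps)
        show "0 \<le> (1/2 - \<epsilon>) * ?n" using \<epsilon> by (intro mult_nonneg_nonneg) auto
      qed
      also have "\<dots> \<le> (real a + real b) * ?o" using o1 by (intro mult_left_mono) auto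
      finally have 1: "(2 * (x + y) * M - 2) * ((1/2 - \<epsilon>) * ?n) \<le> (real a + real b) * ?o" .
      have 2: "(1 - (x + y) + \<kappa>) * M * ?n \<le> real r * ?n" using r by (intro mult_right_mono) auto
      have "Q \<le> (2 * (x + y) * M - 2) * (1/2 - \<epsilon>) + (1 - (x + y) + \<kappa>) * M"
      proof -
        have "(x + y) * (2 * \<epsilon> * M) \<le> 1 * (2 * \<epsilon> * M)" using xy \<epsilon> M0 by (intro mult_right_mono) auto
        then show ?thesis unfolding Q_def using \<epsilon> by (simp add: \<epsilon>_def algebra_simps)
      qed
      then have "Q * ?n \<le> ((2 * (x + y) * M - 2) * (1/2 - \<epsilon>) + (1 - (x + y) + \<kappa>) * M) * ?n" by (rule mult_right_mono[OF _ n0])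
      also have "\<dots> = (2 * (x + y) * M - 2) * ((1/2 - \<epsilon>) * ?n) + (1 - (x + y) + \<kappa>) * M * ?n" by (simp add: algebra_simps)
      finally show ?thesis unfolding optG using 1 2 by (simp add: mult.commute)
    qed
    have Qge: "M * (1 + \<kappa> / 4) \<le> Q" unfolding Q_def using M by (simp add: algebra_simps)
    have "0 \<le> M * (1 + \<kappa> / 4)" using M0 \<kappa> by simp
    then have Q0: "0 \<le> Q" using Qge by linarith
    have "0 < order H" unfolding order_H n_def using E_pos by simp
    then have "0 < OPT ?G" unfolding pm(2) using \<open>5 \<le> real r\<close> by simp
    then have optpos: "0 < real (OPT ?G)" by simp
    \<comment> \<open>A copy predicted full errs on at most \<open>(1/2 + \<epsilon>) * n\<close>
      vertices. Twice this is \<open>(1 + \<kappa> / 4) * n\<close>, which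
      \<open>Q \<ge> M * (1 + \<kappa> / 4)\<close> absorbs.\<close>
    have plus: "real (card (?X - S)) / real (OPT ?G) \<le> x"
    proof -
      have "real (order H - OPT H) = ?n - ?o" using o2 by (simp add: of_nat_diff)
      then have "real (card (?X - S)) = real a * (?n - ?o)" unfolding pm(3) by simp
      also have "\<dots> \<le> 2 * x * M * ((1/2 + \<epsilon>) * ?n)"
        using a o1 o2 nn by (intro mult_mono) (auto simp: algebra_simps)
      also have "\<dots> = x * (M * (1 + \<kappa> / 4) * ?n)" by (simp add: \<epsilon>_def algebra_simps)
      also have "\<dots> \<le> x * (Q * ?n)" using Qge xy by (intro mult_left_mono mult_right_mono) auto
      also have "\<dots> \<le> x * real (OPT ?G)" using Q xy by (intro mult_left_mono) (auto simp: mult.commute)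
      finally show ?thesis using optpos by (simp add: pos_divide_le_eq)
    qed
    have minus: "real (card (S - ?X)) / real (OPT ?G) \<le> y"
    proof -
      have "real (card (S - ?X)) = real b * ?o" unfolding pm(4) by simp
      also have "\<dots> \<le> 2 * y * M * (?n / 2)" using b o2 nn by (intro mult_mono) auto
      also have "\<dots> = y * (M * ?n)" by simp
      also have "\<dots> \<le> y * (Q * ?n)"
      proof -
        have "M \<le> M * (1 + \<kappa> / 4)" using M0 \<kappa> by (simp add: algebra_simps)
        then show ?thesis using Qge xy by (intro mult_left_mono mult_right_mono) auto
      qed
      also have "\<dots> \<le> y * real (OPT ?G)" using Q xy by (intro mult_left_mono) (auto simp: mult.commute)
      finally show ?thesis using optpos by (simp add: pos_divide_le_eq)
    qed
    let ?p = "real (card (?X - S)) / real (OPT ?G)" and ?q = "real (card (S - ?X)) / real (OPT ?G)"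
    have pq: "0 \<le> ?p" "0 \<le> ?q" by auto
    have "f ?p ?q \<le> f x ?q" using mono_onD[OF assms(6)[OF pq(2)], of ?p x] pq xy plus by simp
    also have "\<dots> \<le> f x y" using mono_onD[OF assms(7)[OF xy(1)], of ?q y] pq xy minus by simp
    finally have fle: "f ?p ?q \<le> f x y" .
    have X: "?X \<subseteq> verts ?G" by (auto simp: pad_prediction_def verts_def pad_def)
    \<comment> \<open>The guaranteed output exceeds the isolated vertices by a whole copy; this is
      where \<open>5 \<le> \<kappa> * M\<close> is used in full.\<close>
    have "(real r + 1) * ?n \<le> (1 - (x + y) + 2 * \<kappa>) * Q * ?n"
    proof -
      have "real r + 1 \<le> (1 - (x + y) + \<kappa>) * M + 2" using r by simp
      also have "\<dots> \<le> (1 - (x + y) + 2 * \<kappa>) * (M - 1)"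
        using M xy \<kappa> by (simp add: algebra_simps)
      also have "\<dots> \<le> (1 - (x + y) + 2 * \<kappa>) * Q"
        using xy \<kappa> M0 by (intro mult_left_mono) (auto simp: Q_def algebra_simps)
      finally show ?thesis using n0 by (rule mult_right_mono)
    qed
    also have "\<dots> = (1 - (x + y) + 2 * \<kappa>) * (?n * Q)" by (simp add: algebra_simps)
    also have "\<dots> \<le> (1 - f x y) * real (OPT ?G)"
      using \<kappa> xy Q Q0 by (intro mult_mono) auto
    also have "\<dots> \<le> (1 - f ?p ?q) * real (OPT ?G)" using fle by (intro mult_right_mono) auto
    also have "\<dots> \<le> real (card (A ?G ?X))" by (rule assms(5)[OF wf_pad[OF wf_H] X pm(1)])
    finally have "real ((r + 1) * order H) \<le> real (card (A ?G ?X))" by (simp add: algebra_simps)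
    then show "(r + 1) * order H \<le> card (A ?G ?X)" by (simp only: of_nat_le_iff)
  next
    fix I assume wf: "wf_unique_game I" and val: "game_value I \<le> \<delta>"
    interpret gadget I c D using wf cD by unfold_locales
    let ?n = "real (order H)" and ?o = "real (OPT H)"
    let ?G = "pad a b r H" and ?X = "pad_prediction a b r H"
    obtain Y where Y: "maximum_independent_set H Y" using maximum_independent_set_exists by blast
    have X: "?X \<subseteq> verts ?G" by (auto simp: pad_prediction_def verts_def pad_def)
    have "card (A ?G ?X) \<le> OPT ?G" using assms(4)[OF wf_pad[OF wf_H] X] by (rule card_le_OPT)
    from of_nat_mono[OF this, where 'a = real]
    have "real (card (A ?G ?X)) \<le> (real a + real b) * ?o + real r * ?n"
      unfolding pad_maximum(2)[OF wf_H B Y] by simp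
    also have "\<dots> \<le> (real a + real b) * (\<gamma> * ?n) + real r * ?n"
      using no[OF wf val] by (intro add_right_mono mult_left_mono) auto
    also have "\<dots> = ((real a + real b) * \<gamma>) * ?n + real r * ?n" by simp
    also have "\<dots> \<le> 1/2 * ?n + real r * ?n" using \<gamma>(2) by (intro add_right_mono mult_right_mono) auto
    also have "\<dots> < (real r + 1) * ?n"
      using E_pos unfolding order_H n_def by (simp add: algebra_simps)
    finally have "real (card (A ?G ?X)) < real ((r + 1) * order H)" by (simp add: algebra_simps)
    then show "card (A ?G ?X) < (r + 1) * order H" by (simp only: of_nat_less_iff)
  qed
  then show False using class_P_subset_class_NP assms(2) by blast
qed

end
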